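(* Let $\mathbb X$ be a virtual equipment and let $j\colon A\to E$ be a tight-cell. The partial functor $u_{(-)}\colon\mathbf{RMnd}(j)^{\mathrm{op}}\to\underline{\mathbb X}/E$, defined on those $j$-relative monads $T$ admitting algebra objects and sending $T$ to $u_T\colon\mathbf{Alg}(T)\to E$, is fully faithful.
   Context: Virtual equipments. A virtual double category has objects; a category of tight-cells $f\colon A\to B$ (the composite of $f\colon A\to B$ and $g\colon B\to C$ is $gf$); loose-cells $p\colon A\nrightarrow B$; and 2-cells, each having as frame a chain of loose-cells $p_1\colon A_1\nrightarrow A_0,\dots,p_n\colon A_n\nrightarrow A_{n-1}$ ($n\ge 0$; chains are always listed in this order, and called a chain from $A_n$ to $A_0$), a loose-cell $q\colon B_n\nrightarrow B_0$, and tight-cells $f_0\colon A_0\to B_0$ (left) and $f_n\colon A_n\to B_n$ (right); 2-cells have identities and associative unital multicategory-style composition. $\phi\colon p_1,\dots,p_n\Rightarrow q$ denotes a 2-cell whose tight-cells are identities; $(\phi_1,\dots,\phi_n)$ denotes juxtaposition (followed by the opcartesian 2-cell when the codomains have a composite). A 2-cell $q_1,\dots,q_m\Rightarrow q$ is opcartesian if every 2-cell (with any tight-cells) with domain $p_1,\dots,p_l,q_1,\dots,q_m,r_1,\dots,r_n$ factors uniquely through it; then $q$ is the loose-composite $q_1\odot\cdots\odot q_m$ (the loose-identity $A(1,1)\colon A\nrightarrow A$ if $m=0$). A unary 2-cell from $p$ to $q$ with left $f$ and right $g$ is cartesian if every 2-cell into $q$ with left $ff'$ and right $gg'$ factors uniquely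 through it via a 2-cell with left $f'$ and right $g'$; then $p$ is the restriction $q(f,g)$. A virtual equipment has all loose-identities and restrictions. Write $E(f,g):=E(1,1)(f,g)$; for $f\colon D\to E$, $g\colon A\to E$ it is a loose-cell $A\nrightarrow D$. The canonical isomorphisms $q(f,g)\cong C(f,1)\odot q\odot B(1,g)$ are used implicitly. A 2-cell $f\Rightarrow g$ between tight-cells $A\to B$ is equivalently a 2-cell $B(1,f)\Rightarrow B(1,g)$, or $B(g,1)\Rightarrow B(f,1)$, or $()\Rightarrow B(f,g)$; objects, tight-cells and these 2-cells form a 2-category $\underline{\mathbb X}$. Restriction is functorial in 2-cells (contravariantly in the first argument, covariantly in the second). For $f\colon A\to B$, $\frown_f\colon ()\Rightarrow B(f,f)$ (corresponding to $1_f$) and $\smile_f\colon B(1,f),B(f,1)\Rightarrow B(1,1)$ are the canonical 2-cells. $\phi(f,g)$ denotes the 2-cell obtained from $\phi$ by restricting along $f$ on the left and $g$ on the right; e.g. $\smile_t(x,y)\colon E(x,t),E(t,y)\Rightarrow E(x,y)$ is composition. $\underline{\mathbb X}/E$ is the category whose objects are tight-cells with codomain $E$ and whose morphisms are strictly commuting triangles of tight-cells. Relative monads. A $j$-relative monad $T=(t,\dagger,\eta)$ comprises a tight-cell $t\colon A\to E$, a 2-cell $\dagger\colon E(j,t)\Rightarrow E(t,t)$ and a 2-cell $\eta\colon j\Rightarrow t$ such that: (i) $E(\eta,t)\circ\dagger=1$; (ii) $\dagger\circ E(j,\eta)\circ\frown_j=\frown_t$; (iii) the 2-cells $E(j,t),E(j,t)\Rightarrow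 E(t,t)$ given by $(\dagger,\dagger)$ followed by $\smile_t(t,t)$, and by $(1,\dagger)$ followed by $\smile_t(j,t)$ followed by $\dagger$, are equal. A morphism is a 2-cell $\tau\colon t\Rightarrow t'$ with $\tau\circ\eta=\eta'$ and $E(t,\tau)\circ\dagger=E(\tau,t')\circ\dagger'\circ E(j,\tau)$. These form $\mathbf{RMnd}(j)$. Algebras. A $T$-algebra is a tight-cell $e\colon D\to E$ with a 2-cell $\rtimes\colon E(j,e)\Rightarrow E(t,e)$ such that $E(\eta,e)\circ\rtimes=1$ and the 2-cells $E(j,t),E(j,e)\Rightarrow E(t,e)$ given by $(\dagger,\rtimes)$ followed by $\smile_t(t,e)$, and by $(1,\rtimes)$ followed by $\smile_t(j,e)$ followed by $\rtimes$, are equal. For a chain $p_1,\dots,p_n$ from $D'$ to $D$, a $(p_1,\dots,p_n)$-graded $T$-algebra morphism from $(e\colon D\to E,\rtimes)$ to $(e'\colon D'\to E,\rtimes')$ is a 2-cell $\epsilon\colon E(1,e),p_1,\dots,p_n\Rightarrow E(1,e')$ such that the 2-cells $E(1,t),E(j,1),E(1,e),p_1,\dots,p_n\Rightarrow E(1,e')$ given by $(\lambda,1,\dots,1)$ followed by $\epsilon$, and by $(1,1,\epsilon)$ followed by $\lambda'$, are equal; here $\lambda\colon E(1,t),E(j,1),E(1,e)\Rightarrow E(1,e)$ is $(1,\rtimes)$ followed by $\smile_t(1,e)$, and similarly $\lambda'$. Algebra object. A $T$-algebra $(u_T\colon\mathbf{Alg}(T)\to E,\rtimes_T)$ is an algebra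 object for $T$ when: (1) for every $T$-algebra $(e\colon D\to E,\rtimes)$ there is a unique tight-cell $\langle\rangle_{(e,\rtimes)}\colon D\to\mathbf{Alg}(T)$ with $u_T\langle\rangle_{(e,\rtimes)}=e$ and $\rtimes_T(1,\langle\rangle_{(e,\rtimes)})=\rtimes$; (2) for every graded $T$-algebra morphism $\epsilon\colon E(1,e),p_1,\dots,p_n\Rightarrow E(1,e')$ there is a unique 2-cell $\langle\rangle_\epsilon\colon\mathbf{Alg}(T)(1,\langle\rangle_{(e,\rtimes)}),p_1,\dots,p_n\Rightarrow\mathbf{Alg}(T)(1,\langle\rangle_{(e',\rtimes')})$ with $\epsilon=(1_{E(1,u_T)},\langle\rangle_\epsilon)$, using $E(1,e)\cong E(1,u_T)\odot\mathbf{Alg}(T)(1,\langle\rangle_{(e,\rtimes)})$. The functor $u_{(-)}$. For a morphism $\tau\colon T\to T'$ of $j$-relative monads admitting algebra objects, $u_\tau\colon\mathbf{Alg}(T')\to\mathbf{Alg}(T)$ is the tight-cell over $E$ induced by the $T$-algebra $(u_{T'},E(\tau,u_{T'})\circ\rtimes_{T'})$. *)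

theory Defs
  imports Main
begin

section \<open>Categories and functors\<close>

(* Composition is indexed by objects: hom-sets of distinct pairs of objects need not be disjoint.
   cat_comp C a b c g f is the composite of f : a -> b and g : b -> c. *)
record ('o, 'm) cat_data =
  cat_ob :: "'o set"
  cat_hom :: "'o \<Rightarrow> 'o \<Rightarrow> 'm set"
  cat_id :: "'o \<Rightarrow> 'm"
  cat_comp :: "'o \<Rightarrow> 'o \<Rightarrow> 'o \<Rightarrow> 'm \<Rightarrow> 'm \<Rightarrow> 'm"

locale category =
  fixes C :: "('o, 'm) cat_data"
  assumes id_hom: "a \<in> cat_ob C \<Longrightarrow> cat_id C a \<in> cat_hom C a a"
    and comp_hom: "\<lbrakk>a \<in> cat_ob C; b \<in> cat_ob C; c \<in> cat_ob C;
        f \<in> cat_hom C a b; g \<in> cat_hom C b c\<rbrakk> \<Longrightarrow> cat_comp C a b c g f \<in> cat_hom C a c"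
    and comp_id_left: "\<lbrakk>a \<in> cat_ob C; b \<in> cat_ob C; f \<in> cat_hom C a b\<rbrakk>
        \<Longrightarrow> cat_comp C a b b (cat_id C b) f = f"
    and comp_id_right: "\<lbrakk>a \<in> cat_ob C; b \<in> cat_ob C; f \<in> cat_hom C a b\<rbrakk>
        \<Longrightarrow> cat_comp C a a b f (cat_id C a) = f"
    and comp_assoc: "\<lbrakk>a \<in> cat_ob C; b \<in> cat_ob C; c \<in> cat_ob C; d \<in> cat_ob C;
        f \<in> cat_hom C a b; g \<in> cat_hom C b c; h \<in> cat_hom C c d\<rbrakk>
        \<Longrightarrow> cat_comp C a c d h (cat_comp C a b c g f) = cat_comp C a b d (cat_comp C b c d h g) f"

definition opposite :: "('o, 'm) cat_data \<Rightarrow> ('o, 'm) cat_data" where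
  "opposite C = \<lparr>cat_ob = cat_ob C, cat_hom = (\<lambda>a b. cat_hom C b a), cat_id = cat_id C,
     cat_comp = (\<lambda>a b c g f. cat_comp C c b a f g)\<rparr>"

definition full_subcategory :: "('o, 'm) cat_data \<Rightarrow> 'o set \<Rightarrow> ('o, 'm) cat_data" where
  "full_subcategory C S = C\<lparr>cat_ob := cat_ob C \<inter> S\<rparr>"

definition is_functor ::
  "('o, 'm) cat_data \<Rightarrow> ('p, 'n) cat_data \<Rightarrow> ('o \<Rightarrow> 'p) \<Rightarrow> ('o \<Rightarrow> 'o \<Rightarrow> 'm \<Rightarrow> 'n) \<Rightarrow> bool" where
  "is_functor C D F0 F1 \<longleftrightarrow>
     category C \<and> category D \<and>
     (\<forall>a\<in>cat_ob C. F0 a \<in> cat_ob D) \<and>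
     (\<forall>a\<in>cat_ob C. \<forall>b\<in>cat_ob C. \<forall>f\<in>cat_hom C a b. F1 a b f \<in> cat_hom D (F0 a) (F0 b)) \<and>
     (\<forall>a\<in>cat_ob C. F1 a a (cat_id C a) = cat_id D (F0 a)) \<and>
     (\<forall>a\<in>cat_ob C. \<forall>b\<in>cat_ob C. \<forall>c\<in>cat_ob C. \<forall>f\<in>cat_hom C a b. \<forall>g\<in>cat_hom C b c.
        F1 a c (cat_comp C a b c g f) = cat_comp D (F0 a) (F0 b) (F0 c) (F1 b c g) (F1 a b f))"

definition is_partial_functor ::
  "('o, 'm) cat_data \<Rightarrow> 'o set \<Rightarrow> ('p, 'n) cat_data \<Rightarrow> ('o \<Rightarrow> 'p) \<Rightarrow> ('o \<Rightarrow> 'o \<Rightarrow> 'm \<Rightarrow> 'n) \<Rightarrow> bool"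
where
  "is_partial_functor C S D F0 F1 \<longleftrightarrow>
     category C \<and> S \<subseteq> cat_ob C \<and> is_functor (full_subcategory C S) D F0 F1"

definition fully_faithful ::
  "('o, 'm) cat_data \<Rightarrow> ('p, 'n) cat_data \<Rightarrow> ('o \<Rightarrow> 'p) \<Rightarrow> ('o \<Rightarrow> 'o \<Rightarrow> 'm \<Rightarrow> 'n) \<Rightarrow> bool" where
  "fully_faithful C D F0 F1 \<longleftrightarrow>
     (\<forall>a\<in>cat_ob C. \<forall>b\<in>cat_ob C.
        bij_betw (F1 a b) (cat_hom C a b) (cat_hom D (F0 a) (F0 b)))"


section \<open>Virtual double categories\<close>

(* A loose-cell p goes from ldom p to lcod p.  A 2-cell c has domain the chain cdom c, codomain the
   loose-cell ccod c, left tight-cell cleft c and right tight-cell cright c.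
   tcomp X g f is the composite "g after f".
   paste X c f cs composes c with the juxtaposition of the list cs of 2-cells, whose left boundary
   is the tight-cell f; f carries information only if cs is empty (c being nullary). *)
record ('o, 't, 'l, 'c) vdc_data =
  Obj :: "'o set"
  Tight :: "'t set"
  tdom :: "'t \<Rightarrow> 'o"
  tcod :: "'t \<Rightarrow> 'o"
  tid :: "'o \<Rightarrow> 't"
  tcomp :: "'t \<Rightarrow> 't \<Rightarrow> 't"
  Loose :: "'l set"
  ldom :: "'l \<Rightarrow> 'o"
  lcod :: "'l \<Rightarrow> 'o"
  Cell :: "'c set"
  cdom :: "'c \<Rightarrow> 'l list"
  ccod :: "'c \<Rightarrow> 'l"
  cleft :: "'c \<Rightarrow> 't"
  cright :: "'c \<Rightarrow> 't"
  cid :: "'l \<Rightarrow> 'c"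
  paste :: "'c \<Rightarrow> 't \<Rightarrow> 'c list \<Rightarrow> 'c"

(* In the order in which chains are listed, a is the object at the left end (the codomain of the
   first loose-cell) and b the one at the right end: ps is a chain from b to a. *)
primrec chain :: "('o, 't, 'l, 'c) vdc_data \<Rightarrow> 'o \<Rightarrow> 'l list \<Rightarrow> 'o \<Rightarrow> bool" where
  "chain X a [] b \<longleftrightarrow> a \<in> Obj X \<and> a = b"
| "chain X a (p # ps) b \<longleftrightarrow> p \<in> Loose X \<and> lcod X p = a \<and> chain X (ldom X p) ps b"

primrec cell_path :: "('o, 't, 'l, 'c) vdc_data \<Rightarrow> 't \<Rightarrow> 'c list \<Rightarrow> 't \<Rightarrow> bool" where
  "cell_path X f [] g \<longleftrightarrow> f \<in> Tight X \<and> f = g"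
| "cell_path X f (c # cs) g \<longleftrightarrow> c \<in> Cell X \<and> cleft X c = f \<and> cell_path X (cright X c) cs g"

definition path_end :: "('o, 't, 'l, 'c) vdc_data \<Rightarrow> 't \<Rightarrow> 'c list \<Rightarrow> 't" where
  "path_end X f cs = (if cs = [] then f else cright X (last cs))"

fun paste_blocks ::
  "('o, 't, 'l, 'c) vdc_data \<Rightarrow> 't \<Rightarrow> 'c list \<Rightarrow> 'c list list \<Rightarrow> 'c list" where
  "paste_blocks X h (c # cs) (ds # dss) =
     paste X c h ds # paste_blocks X (path_end X h ds) cs dss"
| "paste_blocks X h _ _ = []"

locale vdc =
  fixes X :: "('o, 't, 'l, 'c) vdc_data"
begin

abbreviation tight_comp (infixr "\<cdot>" 70) where "g \<cdot> f \<equiv> tcomp X g f"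

definition cells :: "'l list \<Rightarrow> 'l \<Rightarrow> 't \<Rightarrow> 't \<Rightarrow> 'c set" where
  "cells ps q f g =
     {c \<in> Cell X. cdom X c = ps \<and> ccod X c = q \<and> cleft X c = f \<and> cright X c = g}"

(* the 2-cells ps => q whose tight-cells are identities *)
definition globular :: "'l list \<Rightarrow> 'l \<Rightarrow> 'c set" where
  "globular ps q = cells ps q (tid X (lcod X q)) (tid X (ldom X q))"

definition composable :: "'c \<Rightarrow> 't \<Rightarrow> 'c list \<Rightarrow> 't \<Rightarrow> bool" where
  "composable c f cs g \<longleftrightarrow> c \<in> Cell X \<and> cell_path X f cs g \<and> map (ccod X) cs = cdom X c \<and>
     tcod X f = tdom X (cleft X c)"

(* composition of 2-cells along a nonempty list *)
definition comp2 :: "'c \<Rightarrow> 'c list \<Rightarrow> 'c" (infixr "\<bullet>" 65) where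
  "c \<bullet> cs = paste X c (cleft X (hd cs)) cs"

end

locale virtual_double_category = vdc X for X :: "('o, 't, 'l, 'c) vdc_data" +
  assumes tid_tight: "a \<in> Obj X \<Longrightarrow> tid X a \<in> Tight X \<and> tdom X (tid X a) = a \<and> tcod X (tid X a) = a"
    and tight_ends: "f \<in> Tight X \<Longrightarrow> tdom X f \<in> Obj X \<and> tcod X f \<in> Obj X"
    and tcomp_tight: "\<lbrakk>f \<in> Tight X; g \<in> Tight X; tcod X f = tdom X g\<rbrakk>
        \<Longrightarrow> g \<cdot> f \<in> Tight X \<and> tdom X (g \<cdot> f) = tdom X f \<and> tcod X (g \<cdot> f) = tcod X g"
    and tcomp_tid_left: "f \<in> Tight X \<Longrightarrow> tid X (tcod X f) \<cdot> f = f"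
    and tcomp_tid_right: "f \<in> Tight X \<Longrightarrow> f \<cdot> tid X (tdom X f) = f"
    and tcomp_assoc: "\<lbrakk>f \<in> Tight X; g \<in> Tight X; h \<in> Tight X; tcod X f = tdom X g; tcod X g = tdom X h\<rbrakk>
        \<Longrightarrow> (h \<cdot> g) \<cdot> f = h \<cdot> (g \<cdot> f)"
    and loose_ends: "p \<in> Loose X \<Longrightarrow> ldom X p \<in> Obj X \<and> lcod X p \<in> Obj X"
    and cell_frame: "c \<in> Cell X \<Longrightarrow>
        cleft X c \<in> Tight X \<and> cright X c \<in> Tight X \<and> ccod X c \<in> Loose X \<and>
        lcod X (ccod X c) = tcod X (cleft X c) \<and> ldom X (ccod X c) = tcod X (cright X c) \<and>
        chain X (tdom X (cleft X c)) (cdom X c) (tdom X (cright X c))"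
    and cid_globular: "p \<in> Loose X \<Longrightarrow> cid X p \<in> globular [p] p"
    and paste_cells: "composable c f cs g \<Longrightarrow>
        paste X c f cs \<in>
          cells (concat (map (cdom X) cs)) (ccod X c) (cleft X c \<cdot> f) (cright X c \<cdot> g)"
    and paste_cid_left: "c \<in> Cell X \<Longrightarrow> paste X (cid X (ccod X c)) (cleft X c) [c] = c"
    and paste_cid_right: "c \<in> Cell X \<Longrightarrow>
        paste X c (tid X (tdom X (cleft X c))) (map (cid X) (cdom X c)) = c"
    and paste_assoc: "\<lbrakk>composable c f cs g; list_all2 (\<lambda>ds d. map (ccod X) ds = cdom X d) dss cs;
          cell_path X h (concat dss) k; tcod X h = tdom X f\<rbrakk>
        \<Longrightarrow> paste X (paste X c f cs) h (concat dss) = paste X c (f \<cdot> h) (paste_blocks X h cs dss)"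


section \<open>Virtual equipments\<close>

context vdc
begin

(* The two chain conditions locate the domain of c in the domain of d, which matters when
   cdom X c is empty. *)
definition opcartesian :: "'c \<Rightarrow> bool" where
  "opcartesian c \<longleftrightarrow> c \<in> globular (cdom X c) (ccod X c) \<and>
     (\<forall>d ps rs. d \<in> Cell X \<and> cdom X d = ps @ cdom X c @ rs \<and>
          chain X (tdom X (cleft X d)) ps (lcod X (ccod X c)) \<and>
          chain X (ldom X (ccod X c)) rs (tdom X (cright X d)) \<longrightarrow>
        (\<exists>!d'. d' \<in> cells (ps @ [ccod X c] @ rs) (ccod X d) (cleft X d) (cright X d) \<and>
           d = d' \<bullet> (map (cid X) ps @ [c] @ map (cid X) rs)))"

definition cartesian :: "'c \<Rightarrow> bool" where
  "cartesian c \<longleftrightarrow> c \<in> Cell X \<and>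
     (\<exists>p. cdom X c = [p] \<and>
       (\<forall>d f g. d \<in> Cell X \<and> ccod X d = ccod X c \<and>
            f \<in> Tight X \<and> tcod X f = tdom X (cleft X c) \<and> cleft X d = cleft X c \<cdot> f \<and>
            g \<in> Tight X \<and> tcod X g = tdom X (cright X c) \<and> cright X d = cright X c \<cdot> g \<longrightarrow>
          (\<exists>!d'. d' \<in> cells (cdom X d) p f g \<and> d = c \<bullet> [d'])))"

end

locale virtual_equipment = virtual_double_category X for X :: "('o, 't, 'l, 'c) vdc_data" +
  assumes loose_identities:
      "a \<in> Obj X \<Longrightarrow> \<exists>c. opcartesian c \<and> cdom X c = [] \<and> lcod X (ccod X c) = a"
    and restrictions:
      "\<lbrakk>q \<in> Loose X; f \<in> Tight X; g \<in> Tight X; tcod X f = lcod X q; tcod X g = ldom X q\<rbrakk>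
        \<Longrightarrow> \<exists>c. cartesian c \<and> ccod X c = q \<and> cleft X c = f \<and> cright X c = g"

context vdc
begin

definition lid_cell :: "'o \<Rightarrow> 'c" where
  "lid_cell a = (SOME c. opcartesian c \<and> cdom X c = [] \<and> lcod X (ccod X c) = a)"

definition lid :: "'o \<Rightarrow> 'l" where
  "lid a = ccod X (lid_cell a)"

definition cart :: "'l \<Rightarrow> 't \<Rightarrow> 't \<Rightarrow> 'c" where
  "cart q f g = (SOME c. cartesian c \<and> ccod X c = q \<and> cleft X c = f \<and> cright X c = g)"

definition restr :: "'l \<Rightarrow> 't \<Rightarrow> 't \<Rightarrow> 'l" where
  "restr q f g = hd (cdom X (cart q f g))"

(* the factorisation of d through the cartesian 2-cell c with left f and right g *)
definition cart_factor :: "'c \<Rightarrow> 't \<Rightarrow> 't \<Rightarrow> 'c \<Rightarrow> 'c" where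
  "cart_factor c f g d = (THE d'. d' \<in> cells (cdom X d) (hd (cdom X c)) f g \<and> d = c \<bullet> [d'])"

(* hom f g is the loose-cell E(f,g), where E is the common codomain of f and g.  The chosen
   hom (tid X E) (tid X E) is isomorphic but not necessarily equal to lid E; the canonical
   isomorphisms between restrictions enter below through the 2-cells hcart. *)
definition hcart :: "'t \<Rightarrow> 't \<Rightarrow> 'c" where
  "hcart f g = cart (lid (tcod X f)) f g"

definition hom :: "'t \<Rightarrow> 't \<Rightarrow> 'l" where
  "hom f g = restr (lid (tcod X f)) f g"

(* The 2-cell into E(f,g) with identity tight-cells that corresponds to a 2-cell d into the
   loose-identity of E with left f and right g. *)
definition into_hom :: "'t \<Rightarrow> 't \<Rightarrow> 'c \<Rightarrow> 'c" where
  "into_hom f g d = cart_factor (hcart f g) (tid X (tdom X f)) (tid X (tdom X g)) d"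

(* the unitor p, B(1,1) => p for p with source B *)
definition runit :: "'l \<Rightarrow> 'c" where
  "runit p = (THE c. c \<in> globular [p, lid (ldom X p)] p \<and>
     c \<bullet> [cid X p, lid_cell (ldom X p)] = cid X p)"

(* () => E(f,f) *)
definition frown :: "'t \<Rightarrow> 'c" where
  "frown f = into_hom f f (paste X (lid_cell (tcod X f)) f [])"

(* smile x t y : E(x,t), E(t,y) => E(x,y) is the restriction along x and y of the 2-cell
   E(1,t), E(t,1) => E(1,1), up to E(1,t)(x,1) = E(x,t) and E(t,1)(1,y) = E(t,y).  When t is an
   identity it exhibits E(x,y) as the composite of E(x,1) and E(1,y). *)
definition smile :: "'t \<Rightarrow> 't \<Rightarrow> 't \<Rightarrow> 'c" where
  "smile x t y = into_hom x y (runit (lid (tcod X t)) \<bullet> [hcart x t, hcart t y])"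

(* the opcartesian 2-cell E(1,u), B(1,x) => E(1,ux) for u : B -> E and x : D -> B *)
definition hom_split :: "'t \<Rightarrow> 't \<Rightarrow> 'c" where
  "hom_split u x = into_hom (tid X (tcod X u)) (u \<cdot> x)
     (hcart (tid X (tcod X u)) u \<bullet>
       [runit (hom (tid X (tcod X u)) u) \<bullet>
         [cid X (hom (tid X (tcod X u)) u), hcart (tid X (tdom X u)) x]])"

(* for c : E(f,g) => E(f',g'), the 2-cell c(1,x) : E(f,gx) => E(f',g'x), using
   E(f,g)(1,x) = E(f,gx) *)
definition restr_right :: "'t \<Rightarrow> 't \<Rightarrow> 't \<Rightarrow> 't \<Rightarrow> 't \<Rightarrow> 'c \<Rightarrow> 'c" where
  "restr_right f g f' g' x c = into_hom f' (g' \<cdot> x)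
     (hcart f' g' \<bullet> [c \<bullet> [cart_factor (hcart f g) (tid X (tdom X f)) x (hcart f (g \<cdot> x))]])"

(* 2-cells f => g between tight-cells are represented in the form () => E(f,g) *)
definition two_cells :: "'t \<Rightarrow> 't \<Rightarrow> 'c set" where
  "two_cells f g = globular [] (hom f g)"

(* s after r, for r : f => g and s : g => h *)
definition vcomp :: "'t \<Rightarrow> 't \<Rightarrow> 't \<Rightarrow> 'c \<Rightarrow> 'c \<Rightarrow> 'c" where
  "vcomp f g h s r = smile f g h \<bullet> [r, s]"

(* E(r,h) : E(g,h) => E(f,h) for r : f => g *)
definition hom_pre :: "'t \<Rightarrow> 't \<Rightarrow> 'c \<Rightarrow> 't \<Rightarrow> 'c" where
  "hom_pre f g r h = smile f g h \<bullet> [r, cid X (hom g h)]"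

(* E(h,r) : E(h,f) => E(h,g) for r : f => g *)
definition hom_post :: "'t \<Rightarrow> 't \<Rightarrow> 't \<Rightarrow> 'c \<Rightarrow> 'c" where
  "hom_post h f g r = smile h f g \<bullet> [cid X (hom h f), r]"

end


section \<open>Relative monads and their algebras\<close>

record ('t, 'c) rmnd_data =
  carrier :: 't
  extension :: 'c
  unit :: 'c

record ('t, 'c) alg_data =
  alg_carrier :: 't
  alg_action :: 'c

context vdc
begin

definition relative_monad :: "'t \<Rightarrow> ('t, 'c) rmnd_data \<Rightarrow> bool" where
  "relative_monad j T \<longleftrightarrow> (let t = carrier T; dag = extension T; \<eta> = unit T in
     t \<in> Tight X \<and> tdom X t = tdom X j \<and> tcod X t = tcod X j \<and>
     dag \<in> globular [hom j t] (hom t t) \<and>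
     \<eta> \<in> two_cells j t \<and>
     hom_pre j t \<eta> t \<bullet> [dag] = cid X (hom j t) \<and>
     dag \<bullet> [hom_post j j t \<eta> \<bullet> [frown j]] = frown t \<and>
     smile t t t \<bullet> [dag, dag] = dag \<bullet> [smile j t t \<bullet> [cid X (hom j t), dag]])"

definition monad_morphism ::
  "'t \<Rightarrow> ('t, 'c) rmnd_data \<Rightarrow> ('t, 'c) rmnd_data \<Rightarrow> 'c \<Rightarrow> bool" where
  "monad_morphism j T T' \<tau> \<longleftrightarrow> (let t = carrier T; t' = carrier T' in
     \<tau> \<in> two_cells t t' \<and>
     vcomp j t t' \<tau> (unit T) = unit T' \<and>
     hom_post t t t' \<tau> \<bullet> [extension T] =
       hom_pre t t' \<tau> t' \<bullet> [extension T' \<bullet> [hom_post j t t' \<tau>]])"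

definition RMnd :: "'t \<Rightarrow> (('t, 'c) rmnd_data, 'c) cat_data" where
  "RMnd j = \<lparr>cat_ob = {T. relative_monad j T},
     cat_hom = (\<lambda>T T'. {\<tau>. monad_morphism j T T' \<tau>}),
     cat_id = (\<lambda>T. frown (carrier T)),
     cat_comp = (\<lambda>T T' T'' \<sigma> \<tau>. vcomp (carrier T) (carrier T') (carrier T'') \<sigma> \<tau>)\<rparr>"

definition slice :: "'o \<Rightarrow> ('t, 't) cat_data" where
  "slice E = \<lparr>cat_ob = {f \<in> Tight X. tcod X f = E},
     cat_hom = (\<lambda>f g. {h \<in> Tight X. tdom X h = tdom X f \<and> tcod X h = tdom X g \<and> g \<cdot> h = f}),
     cat_id = (\<lambda>f. tid X (tdom X f)),
     cat_comp = (\<lambda>f g k b a. b \<cdot> a)\<rparr>"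

definition algebra :: "'t \<Rightarrow> ('t, 'c) rmnd_data \<Rightarrow> ('t, 'c) alg_data \<Rightarrow> bool" where
  "algebra j T a \<longleftrightarrow> (let t = carrier T; e = alg_carrier a; act = alg_action a in
     e \<in> Tight X \<and> tcod X e = tcod X j \<and>
     act \<in> globular [hom j e] (hom t e) \<and>
     hom_pre j t (unit T) e \<bullet> [act] = cid X (hom j e) \<and>
     smile t t e \<bullet> [extension T, act] = act \<bullet> [smile j t e \<bullet> [cid X (hom j t), act]])"

(* the 2-cell lambda : E(1,t), E(j,1), E(1,e) => E(1,e) *)
definition action_cell :: "'t \<Rightarrow> ('t, 'c) rmnd_data \<Rightarrow> ('t, 'c) alg_data \<Rightarrow> 'c" where
  "action_cell j T a = (let t = carrier T; e = alg_carrier a; I = tid X (tcod X j) in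
     smile I t e \<bullet> [cid X (hom I t), alg_action a \<bullet> [smile j I e]])"

definition graded_morphism ::
  "'t \<Rightarrow> ('t, 'c) rmnd_data \<Rightarrow> 'l list \<Rightarrow> ('t, 'c) alg_data \<Rightarrow> ('t, 'c) alg_data \<Rightarrow> 'c \<Rightarrow> bool" where
  "graded_morphism j T ps a a' \<epsilon> \<longleftrightarrow>
     (let t = carrier T; e = alg_carrier a; e' = alg_carrier a'; I = tid X (tcod X j) in
       \<epsilon> \<in> globular (hom I e # ps) (hom I e') \<and>
       \<epsilon> \<bullet> (action_cell j T a # map (cid X) ps) =
         action_cell j T a' \<bullet> [cid X (hom I t), cid X (hom j I), \<epsilon>])"

(* x mediates from the algebra a to the algebra u:  u x = a  as algebras *)
definition mediates ::
  "'t \<Rightarrow> ('t, 'c) rmnd_data \<Rightarrow> ('t, 'c) alg_data \<Rightarrow> ('t, 'c) alg_data \<Rightarrow> 't \<Rightarrow> bool" where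
  "mediates j T u a x \<longleftrightarrow>
     x \<in> Tight X \<and> tdom X x = tdom X (alg_carrier a) \<and> tcod X x = tdom X (alg_carrier u) \<and>
     alg_carrier u \<cdot> x = alg_carrier a \<and>
     restr_right j (alg_carrier u) (carrier T) (alg_carrier u) x (alg_action u) = alg_action a"

definition mediating ::
  "'t \<Rightarrow> ('t, 'c) rmnd_data \<Rightarrow> ('t, 'c) alg_data \<Rightarrow> ('t, 'c) alg_data \<Rightarrow> 't" where
  "mediating j T u a = (THE x. mediates j T u a x)"

definition algebra_object :: "'t \<Rightarrow> ('t, 'c) rmnd_data \<Rightarrow> ('t, 'c) alg_data \<Rightarrow> bool" where
  "algebra_object j T u \<longleftrightarrow>
     algebra j T u \<and>
     (\<forall>a. algebra j T a \<longrightarrow> (\<exists>!x. mediates j T u a x)) \<and>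
     (\<forall>a a' ps \<epsilon>. algebra j T a \<and> algebra j T a' \<and>
          chain X (tdom X (alg_carrier a)) ps (tdom X (alg_carrier a')) \<and>
          graded_morphism j T ps a a' \<epsilon> \<longrightarrow>
        (let x = mediating j T u a; x' = mediating j T u a';
             I = tid X (tdom X (alg_carrier u)); v = alg_carrier u in
         \<exists>!\<nu>. \<nu> \<in> globular (hom I x # ps) (hom I x') \<and>
           \<epsilon> \<bullet> (hom_split v x # map (cid X) ps) =
             hom_split v x' \<bullet> [cid X (hom (tid X (tcod X v)) v), \<nu>]))"

definition admitting :: "'t \<Rightarrow> ('t, 'c) rmnd_data set" where
  "admitting j = {T. relative_monad j T \<and> (\<exists>u. algebra_object j T u)}"

(* The functor u, relative to a choice alg of algebra objects.  A morphism T' -> T in the opposite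
   of RMnd(j) is a monad morphism \<tau> : T -> T'. *)
definition u_ob :: "(('t, 'c) rmnd_data \<Rightarrow> ('t, 'c) alg_data) \<Rightarrow> ('t, 'c) rmnd_data \<Rightarrow> 't" where
  "u_ob alg T = alg_carrier (alg T)"

definition u_mor :: "'t \<Rightarrow> (('t, 'c) rmnd_data \<Rightarrow> ('t, 'c) alg_data) \<Rightarrow>
    ('t, 'c) rmnd_data \<Rightarrow> ('t, 'c) rmnd_data \<Rightarrow> 'c \<Rightarrow> 't" where
  "u_mor j alg T' T \<tau> = mediating j T (alg T)
     \<lparr>alg_carrier = u_ob alg T',
      alg_action = hom_pre (carrier T) (carrier T') \<tau> (u_ob alg T') \<bullet> [alg_action (alg T')]\<rparr>"

end

end

(* Morphisms x : u_T' -> u_T over E correspond, by the universal property of Alg(T), to T-algebra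
   structures r on u_T'.  Such a structure is the pullback of the T'-action along a unique monad
   morphism tau, obtained by evaluating r(1,f), for f the free T'-algebra tight-cell, at the unit
   of T'.  That r factors in this way is the crux: the T'-action, viewed as the graded morphism
   E(1,t'), E(j,u_T') => E(1,u_T') out of the free T'-algebra, is induced by a 2-cell on the level
   of Alg(T'), and r is natural in such 2-cells.

   A 2-cell into E(f,g) is replaced throughout by its composite with the cartesian 2-cell into the
   loose-identity of E.  These 2-cells form a monoid-like structure under the binary product below,
   in which the axioms of monads and algebras become equations between elements. *)
theory Submission
  imports Defs
begin

section \<open>Pasting in virtual double categories\<close>

text \<open>The obstacle: an action \<open>r\<close> on \<open>v\<close> is a 2-cell E(j,v) =>
  E(t,v), so it has no reason to commute with right multiplication by an arbitrary 2-cell into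
  E(1,1). It does commute with those that come through \<open>lid_map v\<close> from the source of
  \<open>v\<close> (\<open>ap_mul\<close>). Condition (2) of an algebra object supplies just these:
  every value of the T'-action on u_T' is \<open>lid_map v \<bullet> [s]\<close> with
  \<open>s\<close> starting at the free tight-cell f. Hence, with e' the unit of T' and act its
  action on u_T', r(e') \<otimes> act(d) = r(e' \<otimes> act(d)) = r(d), and r(e') is the wanted
  monad morphism. Elements are taken in the loose-identity because the chosen E(f,g)(1,x) and
  E(f,gx) are merely isomorphic; composed with their cartesian 2-cells, both give 2-cells with one
  frame, and no coherence isomorphism has to be carried along. \<open>smile\<close> then becomes
  \<otimes>, \<open>frown\<close> its unit, and E(r,h), E(h,r) multiplications, while extensions and
  actions become operators. Their laws hold first for the generic element \<open>hcart\<close> and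
  reach all others by pasting: the Yoneda argument in this setting.\<close>

context virtual_double_category
begin

lemma tight_ends_simps [simp]:
  "f \<in> Tight X \<Longrightarrow> tdom X f \<in> Obj X" "f \<in> Tight X \<Longrightarrow> tcod X f \<in> Obj X"
  using tight_ends by auto

lemma tid_simps [simp]:
  assumes "a \<in> Obj X"
  shows "tid X a \<in> Tight X" "tdom X (tid X a) = a" "tcod X (tid X a) = a"
  using tid_tight[OF assms] by auto

lemma tcomp_simps [simp]:
  assumes "f \<in> Tight X" "g \<in> Tight X" "tcod X f = tdom X g"
  shows "g \<cdot> f \<in> Tight X" "tdom X (g \<cdot> f) = tdom X f" "tcod X (g \<cdot> f) = tcod X g"
  using tcomp_tight[OF assms] by auto

lemma tcomp_tid [simp]:
  "\<lbrakk>f \<in> Tight X; tcod X f = a\<rbrakk> \<Longrightarrow> tid X a \<cdot> f = f"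
  "\<lbrakk>f \<in> Tight X; tdom X f = a\<rbrakk> \<Longrightarrow> f \<cdot> tid X a = f"
  using tcomp_tid_left tcomp_tid_right by auto

lemma cellsD:
  assumes "c \<in> cells ps q f g"
  shows "c \<in> Cell X" "cdom X c = ps" "ccod X c = q" "cleft X c = f" "cright X c = g"
    "f \<in> Tight X" "g \<in> Tight X" "q \<in> Loose X" "lcod X q = tcod X f" "ldom X q = tcod X g"
    "chain X (tdom X f) ps (tdom X g)"
  using assms cell_frame[of c] by (auto simp: cells_def)

lemma nullary_cell_tdom: "c \<in> cells [] q f g \<Longrightarrow> tdom X g = tdom X f"
  using cellsD(11)[of c "[]" q f g] by simp

lemma chain_append:
  "chain X a (ps @ qs) c \<longleftrightarrow> (\<exists>b. chain X a ps b \<and> chain X b qs c)"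
  if "a \<in> Obj X"
  using that by (induction ps arbitrary: a) (auto dest: loose_ends)

lemma cid_in:
  assumes "p \<in> Loose X"
  shows "cid X p \<in> cells [p] p (tid X (lcod X p)) (tid X (ldom X p))"
  using cid_globular[OF assms] by (simp add: globular_def)

lemma cell_path_end: "cell_path X f cs g \<Longrightarrow> path_end X f cs = g"
  by (induction cs arbitrary: f) (auto simp: path_end_def)

lemma cell_path_append:
  "\<lbrakk>cell_path X f cs g; cell_path X g ds h\<rbrakk> \<Longrightarrow> cell_path X f (cs @ ds) h"
  by (induction cs arbitrary: f) auto

lemma cell_path_cid:
  "chain X a ps b \<Longrightarrow> cell_path X (tid X a) (map (cid X) ps) (tid X b)"
proof (induction ps arbitrary: a)
  case (Cons p ps)
  then show ?case using cid_in[of p] by (auto simp: cells_def)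
qed auto

lemma map_ccod_cid: "chain X a ps b \<Longrightarrow> map (ccod X) (map (cid X) ps) = ps"
proof (induction ps arbitrary: a)
  case (Cons p ps)
  then show ?case using cid_in[of p] by (auto simp: cells_def)
qed auto

lemma concat_cdom_cid: "chain X a ps b \<Longrightarrow> concat (map (cdom X) (map (cid X) ps)) = ps"
proof (induction ps arbitrary: a)
  case (Cons p ps)
  then show ?case using cid_in[of p] by (auto simp: cells_def)
qed auto

lemma paste_in:
  assumes "c \<in> cells qs q f g" "cell_path X a cs b" "map (ccod X) cs = qs" "tcod X a = tdom X f"
  shows "paste X c a cs \<in> cells (concat (map (cdom X) cs)) q (f \<cdot> a) (g \<cdot> b)"
  using paste_cells[of c a cs b] assms by (simp add: composable_def cells_def)

lemma paste_tid:
  assumes "c \<in> cells [] q f g"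
  shows "paste X c (tid X (tdom X f)) [] = c"
  using paste_cid_right[of c] assms by (simp add: cells_def)

lemma comp1_in:
  assumes "c \<in> cells [p] q f g" "d \<in> cells ps p a b"
  shows "c \<bullet> [d] \<in> cells ps q (f \<cdot> a) (g \<cdot> b)"
  using paste_in[OF assms(1), of a "[d]" b] cellsD[OF assms(1)] cellsD[OF assms(2)]
  by (simp add: comp2_def)

text \<open>Associativity of pasting with a single outer block. \<open>h\<close> is an argument of
  its own since \<open>ds\<close> is empty when \<open>d\<close> is nullary, and then nothing else
  records the left boundary.\<close>

lemma comp1_paste:
  assumes "c \<in> cells [p] q f g" "d \<in> cells ps p a b"
    "cell_path X h ds k" "map (ccod X) ds = ps" "tcod X h = tdom X a"
  shows "paste X (c \<bullet> [d]) h ds = c \<bullet> [paste X d h ds]"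
  using paste_assoc[of c a "[d]" b "[ds]" h k] cellsD[OF assms(1)] cellsD[OF assms(2)]
    cellsD(4)[OF paste_in[OF assms(2-5)]] assms(3-5)
  by (simp add: comp2_def composable_def)

lemma comp1_assoc:
  assumes "c \<in> cells [p] q f g" "d \<in> cells [p'] p a b" "e \<in> cells ps p' h k"
  shows "(c \<bullet> [d]) \<bullet> [e] = c \<bullet> [d \<bullet> [e]]"
  using comp1_paste[OF assms(1,2), of h "[e]" k] cellsD[OF assms(2)] cellsD[OF assms(3)]
  by (simp add: comp2_def)

lemma cid_comp1:
  assumes "c \<in> cells ps q f g"
  shows "cid X q \<bullet> [c] = c"
  using paste_cid_left[of c] cellsD[OF assms] by (simp add: comp2_def)

lemma comp1_cid:
  assumes "c \<in> cells [p] q f g"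
  shows "c \<bullet> [cid X p] = c"
  using paste_cid_right[of c] cellsD[OF assms] cellsD[OF cid_in[of p]] by (simp add: comp2_def)

lemma paste_cid:
  assumes "c \<in> cells [p] q f g"
  shows "paste X c (tid X (tdom X f)) [cid X p] = c"
  using paste_cid_right[of c] cellsD[OF assms] by (simp)

end

section \<open>The product of 2-cells into loose-identities\<close>

context virtual_equipment
begin

text \<open>Opcartesianness makes the chosen 2-cell globular, so its right boundary is the identity
  of \<open>ldom X (lid a)\<close>. As its domain chain is empty, both boundaries have the same
  source, and that object is \<open>a\<close>.\<close>

lemma lid_cell:
  assumes "a \<in> Obj X"
  shows "opcartesian (lid_cell a)" "lid_cell a \<in> cells [] (lid a) (tid X a) (tid X a)"
proof -
  have *: "opcartesian (lid_cell a) \<and> cdom X (lid_cell a) = [] \<and> lcod X (ccod X (lid_cell a)) = a"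
    unfolding lid_cell_def by (rule someI_ex) (rule loose_identities[OF assms])
  then show "opcartesian (lid_cell a)" by simp
  from * have 1: "lid_cell a \<in> cells [] (lid a) (tid X a) (tid X (ldom X (lid a)))"
    by (auto simp: opcartesian_def globular_def lid_def)
  have "ldom X (lid a) \<in> Obj X" using loose_ends cellsD(8)[OF 1] by blast
  with 1 show "lid_cell a \<in> cells [] (lid a) (tid X a) (tid X a)"
    using nullary_cell_tdom[OF 1] assms by simp
qed

lemma lid_simps [simp]:
  assumes "a \<in> Obj X"
  shows "lid a \<in> Loose X" "ldom X (lid a) = a" "lcod X (lid a) = a"
  using cellsD[OF lid_cell(2)[OF assms]] assms by auto

text \<open>Opcartesianness of \<open>lid_cell b\<close> with nothing to its right. The left
  boundary is made explicit because \<open>comp2\<close> reads it off the head of the list, which is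
  an identity 2-cell or \<open>lid_cell b\<close> according to whether \<open>ps\<close> is
  nonempty.\<close>

lemma lid_extension:
  assumes b: "b \<in> Obj X" and d: "d \<in> cells ps q f g" and g: "tdom X g = b"
  shows "\<exists>!d'. d' \<in> cells (ps @ [lid b]) q f g \<and>
    d = paste X d' (tid X (tdom X f)) (map (cid X) ps @ [lid_cell b])"
proof -
  note D = cellsD[OF d]
  note L = cellsD[OF lid_cell(2)[OF b]]
  have hd: "cleft X (hd (map (cid X) ps @ [lid_cell b])) = tid X (tdom X f)"
    using D(11) L g cellsD(4)[OF cid_in] by (cases ps) auto
  have "\<exists>!d'. d' \<in> cells (ps @ [ccod X (lid_cell b)] @ []) (ccod X d) (cleft X d) (cright X d) \<and>
           d = d' \<bullet> (map (cid X) ps @ [lid_cell b] @ map (cid X) [])"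
    using lid_cell(1)[OF b, unfolded opcartesian_def, THEN conjunct2, rule_format, of d ps "[]"] D L g b
    by (simp del: append_assoc)
  then show ?thesis using D L hd by (simp add: comp2_def)
qed

text \<open>A trailing loose-identity in a domain can be filled with \<open>lid_cell b\<close>
  without loss. The laws of \<otimes> that are not immediate from the definition of
  \<open>runit\<close> rest on this.\<close>

lemma lid_cancel:
  assumes b: "b \<in> Obj X" and d: "d \<in> cells (ps @ [lid b]) q f g" and d': "d' \<in> cells (ps @ [lid b]) q f g"
    and eq: "paste X d (tid X (tdom X f)) (map (cid X) ps @ [lid_cell b])
      = paste X d' (tid X (tdom X f)) (map (cid X) ps @ [lid_cell b])"
  shows "d = d'"
proof -
  note D = cellsD[OF d]
  note L = cellsD[OF lid_cell(2)[OF b]]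
  have ch: "chain X (tdom X f) ps b" "tdom X g = b"
    using D(11) D(6) b by (auto simp: chain_append)
  have "paste X d (tid X (tdom X f)) (map (cid X) ps @ [lid_cell b]) \<in>
      cells (concat (map (cdom X) (map (cid X) ps @ [lid_cell b]))) q (f \<cdot> tid X (tdom X f)) (g \<cdot> tid X b)"
    by (rule paste_in[OF d])
      (use map_ccod_cid[OF ch(1)] cell_path_cid[OF ch(1)] L D in \<open>auto intro: cell_path_append\<close>)
  then have "paste X d (tid X (tdom X f)) (map (cid X) ps @ [lid_cell b]) \<in> cells ps q f g"
    using concat_cdom_cid[OF ch(1)] L D ch by simp
  from lid_extension[OF b this ch(2)] show ?thesis using d d' eq by blast
qed

lemma runit:
  assumes "p \<in> Loose X"
  shows "runit p \<in> cells [p, lid (ldom X p)] p (tid X (lcod X p)) (tid X (ldom X p))"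
    and "runit p \<bullet> [cid X p, lid_cell (ldom X p)] = cid X p"
proof -
  have o: "ldom X p \<in> Obj X" "lcod X p \<in> Obj X" using loose_ends assms by auto
  have "\<exists>!c. c \<in> globular [p, lid (ldom X p)] p \<and> c \<bullet> [cid X p, lid_cell (ldom X p)] = cid X p"
    using lid_extension[OF o(1) cid_in[OF assms]] o cellsD[OF cid_in[OF assms]]
    by (simp add: globular_def comp2_def eq_commute[of "cid X p"])
  from theI'[OF this] show "runit p \<in> cells [p, lid (ldom X p)] p (tid X (lcod X p)) (tid X (ldom X p))"
     "runit p \<bullet> [cid X p, lid_cell (ldom X p)] = cid X p"
    by (simp_all add: runit_def globular_def)
qed

text \<open>Right unitors suffice: the codomain of \<open>x\<close> is arbitrary and that of
  \<open>y\<close> a loose-identity. This is a right action in general, and a product when both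
  codomains are loose-identities.\<close>

definition mul :: "'c \<Rightarrow> 'c \<Rightarrow> 'c" (infixr "\<otimes>" 66) where
  "x \<otimes> y = runit (ccod X x) \<bullet> [x, y]"

definition one :: "'t \<Rightarrow> 'c" where
  "one f = paste X (lid_cell (tcod X f)) f []"

lemma one_in:
  assumes "f \<in> Tight X"
  shows "one f \<in> cells [] (lid (tcod X f)) f f"
  using paste_in[OF lid_cell(2), of "tcod X f" f "[]" f] assms by (simp add: one_def)

lemma one_paste:
  assumes "f \<in> Tight X" "a \<in> Tight X" "tcod X a = tdom X f"
  shows "paste X (one f) a [] = one (f \<cdot> a)"
  using paste_assoc[of "lid_cell (tcod X f)" f "[]" f "[]" a a] assms
    cellsD[OF lid_cell(2)[of "tcod X f"]]
  by (simp add: one_def composable_def)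

lemma cells_lidD:
  assumes "y \<in> cells qs (lid b) f h" "b \<in> Obj X"
  shows "tcod X f = b" "tcod X h = b"
  using cellsD[OF assms(1)] assms(2) by auto

lemma mul_in:
  assumes "x \<in> cells ps p f g" "y \<in> cells qs (lid b) g h" "tcod X g = b"
  shows "x \<otimes> y \<in> cells (ps @ qs) p f h"
proof -
  note D = cellsD[OF assms(1)] cellsD[OF assms(2)]
  have "b \<in> Obj X" using D(7) assms(3) by auto
  then have "tcod X h = b" "ldom X p = b" using cells_lidD[OF assms(2)] D assms by auto
  then show ?thesis
    using paste_in[OF runit(1)[of p], of f "[x, y]" h] D assms(3) by (simp add: mul_def comp2_def)
qed

text \<open>Naturality in the domain, from associativity of pasting with two blocks.
  \<open>a'\<close> is the left boundary of the second block, which may be empty.\<close>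

lemma mul_paste:
  assumes "x \<in> cells ps p f g" "y \<in> cells qs (lid b) g h" "tcod X g = b"
    and "cell_path X a as a'" "map (ccod X) as = ps" "cell_path X a' bs a''" "map (ccod X) bs = qs"
    and "tcod X a = tdom X f"
  shows "paste X (x \<otimes> y) a (as @ bs) = paste X x a as \<otimes> paste X y a' bs"
proof -
  note D = cellsD[OF assms(1)] cellsD[OF assms(2)] cellsD[OF paste_in[OF assms(1,4,5,8)]]
  note R = cellsD[OF runit(1)[of p]]
  show ?thesis
    using paste_assoc[of "runit p" f "[x, y]" h "[as, bs]" a a''] D R assms
      cell_path_append[of a as a' bs a''] cell_path_end[of a as a']
    by (simp add: mul_def comp2_def composable_def)
qed

text \<open>In contrast to the left unit law, this is the defining equation of \<open>runit\<close>
  with \<open>x\<close> pasted onto it.\<close>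

lemma mul_one:
  assumes "x \<in> cells ps p f g"
  shows "x \<otimes> one g = x"
proof -
  note D = cellsD[OF assms]
  define b where "b = tcod X g"
  have b: "b \<in> Obj X" "ldom X p = b" "lcod X p \<in> Obj X" using D by (auto simp: b_def)
  note L = cellsD[OF lid_cell(2)[OF b(1)]]
  note C = cellsD[OF cid_in[OF D(8)]]
  note R = cellsD[OF runit(1)[OF D(8)]]
  have x: "paste X (cid X p) f [x] = x" using cid_comp1[OF assms] D by (simp add: comp2_def)
  have "composable (runit p) (tid X (lcod X p)) [cid X p, lid_cell b] (tid X b)"
    using L C R b by (simp add: composable_def)
  \<comment> \<open>Nothing is pasted onto \<open>lid_cell b\<close>: the empty second block, with
    left boundary \<open>g\<close>, turns it into \<open>one g\<close>.\<close>
  moreover have "list_all2 (\<lambda>ds d. map (ccod X) ds = cdom X d) [[x], []] [cid X p, lid_cell b]"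
    using L C D by simp
  moreover have "cell_path X f (concat [[x], []]) g" using D by simp
  moreover have "tcod X f = tdom X (tid X (lcod X p))" using D b by simp
  ultimately have "paste X (paste X (runit p) (tid X (lcod X p)) [cid X p, lid_cell b]) f (concat [[x], []]) =
     paste X (runit p) (tid X (lcod X p) \<cdot> f) (paste_blocks X f [cid X p, lid_cell b] [[x], []])"
    by (rule paste_assoc)
  then have "paste X (runit p \<bullet> [cid X p, lid_cell b]) f [x] = x \<otimes> one g"
    using D C x by (simp add: path_end_def comp2_def mul_def one_def b_def)
  with runit(2)[OF D(8)] b x show ?thesis by simp
qed

lemma one_tid: "a \<in> Obj X \<Longrightarrow> one (tid X a) = lid_cell a"
  using paste_tid[OF lid_cell(2)] by (simp add: one_def)

text \<open>By naturality the universal case \<open>y = cid X (lid b)\<close> suffices. There the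
  two sides are compared after filling the domain with \<open>lid_cell b\<close>; the left one
  becomes \<open>lid_cell b \<otimes> one (tid X b)\<close>, to which the right unit law
  applies.\<close>

lemma one_mul:
  assumes "y \<in> cells qs (lid b) f h" "tcod X f = b"
  shows "one f \<otimes> y = y"
proof -
  note D = cellsD[OF assms(1)]
  have b: "b \<in> Obj X" using D assms by auto
  note L = lid_cell(2)[OF b] and C = cid_in[of "lid b"]
  have 1: "lid_cell b \<otimes> cid X (lid b) = cid X (lid b)"
  proof (rule lid_cancel[OF b, of _ "[]"])
    show "lid_cell b \<otimes> cid X (lid b) \<in> cells ([] @ [lid b]) (lid b) (tid X b) (tid X b)"
      using mul_in[OF L] C b by simp
    show "cid X (lid b) \<in> cells ([] @ [lid b]) (lid b) (tid X b) (tid X b)" using C b by simp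
    have "paste X (lid_cell b \<otimes> cid X (lid b)) (tid X b) ([] @ [lid_cell b]) =
       paste X (lid_cell b) (tid X b) [] \<otimes> paste X (cid X (lid b)) (tid X b) [lid_cell b]"
      by (rule mul_paste[OF L, of "cid X (lid b)" "[lid b]" b "tid X b"]) (use C b cellsD[OF L] in auto)
    also have "\<dots> = lid_cell b \<otimes> one (tid X b)"
      using paste_tid[OF L] cid_comp1[OF L] b cellsD[OF L] by (simp add: comp2_def one_tid)
    also have "\<dots> = lid_cell b" by (rule mul_one[OF L])
    also have "\<dots> = paste X (cid X (lid b)) (tid X b) [lid_cell b]"
      using cid_comp1[OF L] cellsD[OF L] by (simp add: comp2_def)
    finally show "paste X (lid_cell b \<otimes> cid X (lid b)) (tid X (tdom X (tid X b))) (map (cid X) [] @ [lid_cell b]) =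
       paste X (cid X (lid b)) (tid X (tdom X (tid X b))) (map (cid X) [] @ [lid_cell b])"
      using b by simp
  qed
  have "paste X (lid_cell b \<otimes> cid X (lid b)) f ([] @ [y]) = paste X (lid_cell b) f [] \<otimes> paste X (cid X (lid b)) f [y]"
    by (rule mul_paste[OF L, of "cid X (lid b)" "[lid b]" b "tid X b"]) (use C b cellsD[OF L] D assms in auto)
  moreover have "paste X (cid X (lid b)) f [y] = y"
    using cid_comp1[OF assms(1)] D by (simp add: comp2_def)
  ultimately show ?thesis using 1 assms(2) by (simp add: one_def)
qed

text \<open>Both bracketings are pasted from the case of three identity 2-cells. In that case the
  last factor may be replaced by \<open>lid_cell b\<close>, which is a unit, and both bracketings
  shrink to \<open>cid X p \<otimes> cid X (lid b)\<close>.\<close>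

lemma mul_assoc:
  assumes x: "x \<in> cells ps p f g" and y: "y \<in> cells qs (lid b) g h" and z: "z \<in> cells rs (lid b) h k"
    and b: "tcod X g = b"
  shows "(x \<otimes> y) \<otimes> z = x \<otimes> (y \<otimes> z)"
proof -
  note D = cellsD[OF x] cellsD[OF y] cellsD[OF z]
  have bo: "b \<in> Obj X" "lcod X p \<in> Obj X" "ldom X p = b"
    using tight_ends_simps[OF D(7)] tight_ends_simps[OF D(6)] D(9,10) b by simp_all
  note P = cid_in[OF D(8)] note L = cid_in[of "lid b"]
  have L': "cid X (lid b) \<in> cells [lid b] (lid b) (tid X b) (tid X b)" using L bo by simp
  note C = lid_cell(2)[OF bo(1)]
  have P': "cid X p \<in> cells [p] p (tid X (lcod X p)) (tid X b)" using P bo by simp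
  have PL: "cid X p \<otimes> cid X (lid b) \<in> cells ([p] @ [lid b]) p (tid X (lcod X p)) (tid X b)"
    by (rule mul_in[OF P' L']) (use bo in auto)
  have LL: "cid X (lid b) \<otimes> cid X (lid b) \<in> cells ([lid b] @ [lid b]) (lid b) (tid X b) (tid X b)"
    by (rule mul_in[OF L' L']) (use bo in auto)
  have PL_L: "(cid X p \<otimes> cid X (lid b)) \<otimes> cid X (lid b) \<in> cells (([p] @ [lid b]) @ [lid b]) p (tid X (lcod X p)) (tid X b)"
    by (rule mul_in[OF PL L']) (use bo in auto)
  have P_LL: "cid X p \<otimes> (cid X (lid b) \<otimes> cid X (lid b)) \<in> cells ([p] @ [lid b] @ [lid b]) p (tid X (lcod X p)) (tid X b)"
    by (rule mul_in[OF P' LL]) (use bo in auto)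
  note cd = cellsD[OF P'] cellsD[OF L'] cellsD[OF C]
  have e: "paste X (cid X p) (tid X (lcod X p)) [cid X p] = cid X p"
      "paste X (cid X (lid b)) (tid X b) [cid X (lid b)] = cid X (lid b)"
      "paste X (cid X (lid b)) (tid X b) [lid_cell b] = lid_cell b"
    using paste_cid[OF P'] paste_cid[OF L'] cid_comp1[OF C] bo cd by (simp_all add: comp2_def)
  have assoc: "(cid X p \<otimes> cid X (lid b)) \<otimes> cid X (lid b) = cid X p \<otimes> (cid X (lid b) \<otimes> cid X (lid b))"
  proof (rule lid_cancel[OF bo(1)])
    show "(cid X p \<otimes> cid X (lid b)) \<otimes> cid X (lid b) \<in> cells ([p, lid b] @ [lid b]) p (tid X (lcod X p)) (tid X b)"
      using PL_L by simp
    show "cid X p \<otimes> (cid X (lid b) \<otimes> cid X (lid b)) \<in> cells ([p, lid b] @ [lid b]) p (tid X (lcod X p)) (tid X b)"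
      using P_LL by simp
    have "paste X ((cid X p \<otimes> cid X (lid b)) \<otimes> cid X (lid b)) (tid X (lcod X p)) (([cid X p] @ [cid X (lid b)]) @ [lid_cell b])
      = paste X (cid X p \<otimes> cid X (lid b)) (tid X (lcod X p)) ([cid X p] @ [cid X (lid b)]) \<otimes> paste X (cid X (lid b)) (tid X b) [lid_cell b]"
      by (rule mul_paste[OF PL L']) (use bo cd in auto)
    also have "paste X (cid X p \<otimes> cid X (lid b)) (tid X (lcod X p)) ([cid X p] @ [cid X (lid b)]) =
        paste X (cid X p) (tid X (lcod X p)) [cid X p] \<otimes> paste X (cid X (lid b)) (tid X b) [cid X (lid b)]"
      by (rule mul_paste[OF P' L']) (use bo cd in auto)
    also have "(paste X (cid X p) (tid X (lcod X p)) [cid X p] \<otimes> paste X (cid X (lid b)) (tid X b) [cid X (lid b)]) \<otimes> paste X (cid X (lid b)) (tid X b) [lid_cell b]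
       = cid X p \<otimes> cid X (lid b)"
      using mul_one[OF PL] bo by (simp add: e one_tid)
    finally have 1: "paste X ((cid X p \<otimes> cid X (lid b)) \<otimes> cid X (lid b)) (tid X (lcod X p)) (([cid X p] @ [cid X (lid b)]) @ [lid_cell b]) = cid X p \<otimes> cid X (lid b)" .
    have "paste X (cid X p \<otimes> (cid X (lid b) \<otimes> cid X (lid b))) (tid X (lcod X p)) ([cid X p] @ ([cid X (lid b)] @ [lid_cell b]))
      = paste X (cid X p) (tid X (lcod X p)) [cid X p] \<otimes> paste X (cid X (lid b) \<otimes> cid X (lid b)) (tid X b) ([cid X (lid b)] @ [lid_cell b])"
      by (rule mul_paste[OF P' LL]) (use bo cd in auto)
    also have "paste X (cid X (lid b) \<otimes> cid X (lid b)) (tid X b) ([cid X (lid b)] @ [lid_cell b]) =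
       paste X (cid X (lid b)) (tid X b) [cid X (lid b)] \<otimes> paste X (cid X (lid b)) (tid X b) [lid_cell b]"
      by (rule mul_paste[OF L' L']) (use bo cd in auto)
    also have "\<dots> = cid X (lid b)" using mul_one[OF L'] bo by (simp add: e one_tid)
    finally have 2: "paste X (cid X p \<otimes> (cid X (lid b) \<otimes> cid X (lid b))) (tid X (lcod X p)) ([cid X p] @ ([cid X (lid b)] @ [lid_cell b])) = cid X p \<otimes> cid X (lid b)"
      by (simp add: e)
    show "paste X ((cid X p \<otimes> cid X (lid b)) \<otimes> cid X (lid b)) (tid X (tdom X (tid X (lcod X p)))) (map (cid X) [p, lid b] @ [lid_cell b]) =
      paste X (cid X p \<otimes> cid X (lid b) \<otimes> cid X (lid b)) (tid X (tdom X (tid X (lcod X p)))) (map (cid X) [p, lid b] @ [lid_cell b])"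
      using 1 2 bo by simp
  qed
  have e': "paste X (cid X p) f [x] = x" "paste X (cid X (lid b)) g [y] = y" "paste X (cid X (lid b)) h [z] = z"
    using cid_comp1[OF x] cid_comp1[OF y] cid_comp1[OF z] D by (simp_all add: comp2_def)
  have "paste X ((cid X p \<otimes> cid X (lid b)) \<otimes> cid X (lid b)) f (([x] @ [y]) @ [z])
    = paste X (cid X p \<otimes> cid X (lid b)) f ([x] @ [y]) \<otimes> paste X (cid X (lid b)) h [z]"
    by (rule mul_paste[OF PL L']) (use bo cd D in auto)
  also have "paste X (cid X p \<otimes> cid X (lid b)) f ([x] @ [y]) = paste X (cid X p) f [x] \<otimes> paste X (cid X (lid b)) g [y]"
    by (rule mul_paste[OF P' L']) (use bo cd D in auto)
  finally have 1: "paste X ((cid X p \<otimes> cid X (lid b)) \<otimes> cid X (lid b)) f (([x] @ [y]) @ [z]) = (x \<otimes> y) \<otimes> z"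
    by (simp add: e')
  have "paste X (cid X p \<otimes> (cid X (lid b) \<otimes> cid X (lid b))) f ([x] @ ([y] @ [z]))
    = paste X (cid X p) f [x] \<otimes> paste X (cid X (lid b) \<otimes> cid X (lid b)) g ([y] @ [z])"
    by (rule mul_paste[OF P' LL]) (use bo cd D in auto)
  also have "paste X (cid X (lid b) \<otimes> cid X (lid b)) g ([y] @ [z]) = paste X (cid X (lid b)) g [y] \<otimes> paste X (cid X (lid b)) h [z]"
    by (rule mul_paste[OF L' L']) (use bo cd D in auto)
  finally have 2: "paste X (cid X p \<otimes> (cid X (lid b) \<otimes> cid X (lid b))) f ([x] @ ([y] @ [z])) = x \<otimes> (y \<otimes> z)"
    by (simp add: e')
  from 1 2 assoc show ?thesis by simp
qed


(* for g : B -> E, the action B(1,1) => E(1,1) of g on loose-identities *)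
definition lid_map :: "'t \<Rightarrow> 'c" where
  "lid_map g = (THE w. w \<in> cells [lid (tdom X g)] (lid (tcod X g)) g g \<and>
     one g = w \<bullet> [lid_cell (tdom X g)])"

lemma lid_map_ex1:
  assumes g: "g \<in> Tight X"
  shows "\<exists>!w. w \<in> cells [lid (tdom X g)] (lid (tcod X g)) g g \<and> one g = w \<bullet> [lid_cell (tdom X g)]"
  using lid_extension[OF _ one_in[OF g] refl] cellsD[OF lid_cell(2)[of "tdom X g"]] g
  by (simp add: comp2_def)

lemma lid_map:
  assumes "g \<in> Tight X"
  shows "lid_map g \<in> cells [lid (tdom X g)] (lid (tcod X g)) g g"
    and "lid_map g \<bullet> [lid_cell (tdom X g)] = one g"
  using theI'[OF lid_map_ex1[OF assms]] by (simp_all add: lid_map_def)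

lemma lid_map_one:
  assumes g: "g \<in> Tight X" and a: "a \<in> Tight X" "tcod X a = tdom X g"
  shows "lid_map g \<bullet> [one a] = one (g \<cdot> a)"
proof -
  have "paste X (lid_map g \<bullet> [lid_cell (tdom X g)]) a [] = lid_map g \<bullet> [paste X (lid_cell (tdom X g)) a []]"
    by (rule comp1_paste[OF lid_map(1)[OF g] lid_cell(2)]) (use assms in auto)
  then show ?thesis using lid_map(2)[OF g] one_paste[OF g a] a by (simp add: one_def)
qed

lemma lid_map_tid:
  assumes a: "a \<in> Obj X"
  shows "lid_map (tid X a) = cid X (lid a)"
proof -
  have "cid X (lid a) \<in> cells [lid a] (lid a) (tid X a) (tid X a)"
    using cid_in[of "lid a"] a by simp
  moreover have "one (tid X a) = cid X (lid a) \<bullet> [lid_cell a]"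
    using cid_comp1[OF lid_cell(2)[OF a]] one_tid[OF a] by simp
  ultimately show ?thesis
    using lid_map_ex1[of "tid X a"] lid_map[of "tid X a"] a by (simp, metis)
qed

lemma lid_map_in:
  assumes g: "g \<in> Tight X" and y: "y \<in> cells qs (lid (tdom X g)) b d"
  shows "lid_map g \<bullet> [y] \<in> cells qs (lid (tcod X g)) (g \<cdot> b) (g \<cdot> d)"
  by (rule comp1_in[OF lid_map(1)[OF g] y])

text \<open>The factor \<open>y\<close> lives over the source of \<open>g\<close>, so composing with
  \<open>c\<close> has to transport it along \<open>g\<close>, and \<open>lid_map g\<close> does so.
  The generic form is \<open>c \<bullet> [runit p] = c \<otimes> lid_map g\<close>: both sides
  become \<open>c\<close> once the trailing loose-identity is filled with its unit.\<close>

lemma comp1_mul: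
  assumes c: "c \<in> cells [p] q f g" and x: "x \<in> cells ps p a b"
    and y: "y \<in> cells qs (lid (tdom X g)) b d"
  shows "c \<bullet> [x \<otimes> y] = (c \<bullet> [x]) \<otimes> (lid_map g \<bullet> [y])"
proof -
  note D = cellsD[OF c] cellsD[OF x] cellsD[OF y]
  have o: "tdom X g \<in> Obj X" "tdom X f \<in> Obj X" using D(6,7) by auto
  have p: "p \<in> Loose X" "ldom X p = tdom X g" "lcod X p = tdom X f"
    using D(11) by auto
  have b: "tcod X b = tdom X g" using cells_lidD[OF y] o by simp
  have r: "runit p \<in> cells [p, lid (tdom X g)] p (tid X (tdom X f)) (tid X (tdom X g))"
    and ru: "runit p \<bullet> [cid X p, lid_cell (tdom X g)] = cid X p"
    using runit[OF p(1)] p by simp_all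
  note w = lid_map[OF D(7)]
  note L = lid_cell(2)[OF o(1)]
  have P: "cid X p \<in> cells [p] p (tid X (tdom X f)) (tid X (tdom X g))"
    using cid_in[OF p(1)] p by simp
  note cd = cellsD[OF P] cellsD[OF L]
  have 1: "c \<bullet> [runit p] \<in> cells ([p] @ [lid (tdom X g)]) q f g"
    using comp1_in[OF c r] D by simp
  have 2: "c \<otimes> lid_map g \<in> cells ([p] @ [lid (tdom X g)]) q f g"
    by (rule mul_in[OF c w(1)]) simp
  have "c \<bullet> [runit p] = c \<otimes> lid_map g"
  proof (rule lid_cancel[OF o(1) 1 2])
    have "paste X (c \<bullet> [runit p]) (tid X (tdom X f)) [cid X p, lid_cell (tdom X g)] =
       c \<bullet> [paste X (runit p) (tid X (tdom X f)) [cid X p, lid_cell (tdom X g)]]"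
      by (rule comp1_paste[OF c r]) (use cd o in auto)
    also have "\<dots> = c"
      using ru cd comp1_cid[OF c] by (simp add: comp2_def)
    finally have 3: "paste X (c \<bullet> [runit p]) (tid X (tdom X f)) [cid X p, lid_cell (tdom X g)] = c" .
    have "paste X (c \<otimes> lid_map g) (tid X (tdom X f)) ([cid X p] @ [lid_cell (tdom X g)])
      = paste X c (tid X (tdom X f)) [cid X p] \<otimes> paste X (lid_map g) (tid X (tdom X g)) [lid_cell (tdom X g)]"
      by (rule mul_paste[OF c w(1)]) (use cd o D in auto)
    also have "\<dots> = c"
      using paste_cid[OF c] w(2) cd mul_one[OF c] by (simp add: comp2_def)
    finally show "paste X (c \<bullet> [runit p]) (tid X (tdom X f)) (map (cid X) [p] @ [lid_cell (tdom X g)]) =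
      paste X (c \<otimes> lid_map g) (tid X (tdom X f)) (map (cid X) [p] @ [lid_cell (tdom X g)])"
      using 3 by simp
  qed
  then have "paste X (c \<bullet> [runit p]) a [x, y] = paste X (c \<otimes> lid_map g) a ([x] @ [y])" by simp
  also have "\<dots> = paste X c a [x] \<otimes> paste X (lid_map g) b [y]"
    by (rule mul_paste[OF c w(1)]) (use D p in auto)
  also have "paste X (c \<bullet> [runit p]) a [x, y] = c \<bullet> [paste X (runit p) a [x, y]]"
    by (rule comp1_paste[OF c r]) (use D p o in auto)
  finally show ?thesis using D by (simp add: mul_def comp2_def)
qed

section \<open>Restrictions of loose-identities\<close>

lemma cart_ex:
  assumes "q \<in> Loose X" "f \<in> Tight X" "g \<in> Tight X" "tcod X f = lcod X q" "tcod X g = ldom X q"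
  shows "cartesian (cart q f g)" "cart q f g \<in> cells [restr q f g] q f g"
proof -
  have *: "cartesian (cart q f g) \<and> ccod X (cart q f g) = q \<and> cleft X (cart q f g) = f \<and> cright X (cart q f g) = g"
    unfolding cart_def by (rule someI_ex) (rule restrictions[OF assms])
  then show "cartesian (cart q f g)" by simp
  with * show "cart q f g \<in> cells [restr q f g] q f g"
    by (auto simp: cartesian_def cells_def restr_def)
qed

definition parallel :: "'t \<Rightarrow> 't \<Rightarrow> bool" where
  "parallel f g \<longleftrightarrow> f \<in> Tight X \<and> g \<in> Tight X \<and> tcod X f = tcod X g"

lemma parallelD: "parallel f g \<Longrightarrow> f \<in> Tight X" "parallel f g \<Longrightarrow> g \<in> Tight X"
  "parallel f g \<Longrightarrow> tcod X g = tcod X f"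
  by (auto simp: parallel_def)

lemma hcart:
  assumes "parallel f g"
  shows "cartesian (hcart f g)" "hcart f g \<in> cells [hom f g] (lid (tcod X f)) f g"
  using cart_ex[of "lid (tcod X f)" f g] parallelD[OF assms] by (auto simp: hcart_def hom_def)

lemma hom_simps [simp]:
  assumes "parallel f g"
  shows "hom f g \<in> Loose X" "lcod X (hom f g) = tdom X f" "ldom X (hom f g) = tdom X g"
  using cellsD(11)[OF hcart(2)[OF assms]] by auto

abbreviation fac :: "'t \<Rightarrow> 't \<Rightarrow> 't \<Rightarrow> 't \<Rightarrow> 'c \<Rightarrow> 'c" where
  "fac f g \<equiv> cart_factor (hcart f g)"

lemma fac_ex1:
  assumes fg: "parallel f g" and ab: "a \<in> Tight X" "tcod X a = tdom X f" "b \<in> Tight X" "tcod X b = tdom X g"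
    and d: "d \<in> cells ps (lid (tcod X f)) (f \<cdot> a) (g \<cdot> b)"
  shows "\<exists>!d'. d' \<in> cells ps (hom f g) a b \<and> d = hcart f g \<bullet> [d']"
proof -
  note D = cellsD[OF d] note H = cellsD[OF hcart(2)[OF fg]]
  obtain p where p: "cdom X (hcart f g) = [p]" and *: "\<And>d f' g'. d \<in> Cell X \<and> ccod X d = ccod X (hcart f g) \<and>
      f' \<in> Tight X \<and> tcod X f' = tdom X (cleft X (hcart f g)) \<and> cleft X d = cleft X (hcart f g) \<cdot> f' \<and>
      g' \<in> Tight X \<and> tcod X g' = tdom X (cright X (hcart f g)) \<and> cright X d = cright X (hcart f g) \<cdot> g' \<Longrightarrow>
      \<exists>!d'. d' \<in> cells (cdom X d) p f' g' \<and> d = hcart f g \<bullet> [d']"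
    using hcart(1)[OF fg] unfolding cartesian_def by blast
  show ?thesis using *[of d a b] D(1-5) H(1-5) ab p by simp
qed

lemma fac:
  assumes fg: "parallel f g" and ab: "a \<in> Tight X" "tcod X a = tdom X f" "b \<in> Tight X" "tcod X b = tdom X g"
    and d: "d \<in> cells ps (lid (tcod X f)) (f \<cdot> a) (g \<cdot> b)"
  shows "fac f g a b d \<in> cells ps (hom f g) a b" "hcart f g \<bullet> [fac f g a b d] = d"
  using theI'[OF fac_ex1[OF assms]] cellsD(2)[OF d] cellsD(2)[OF hcart(2)[OF fg]]
  by (simp_all add: cart_factor_def)

lemma hcart_comp_in:
  assumes fg: "parallel f g" and c: "c \<in> cells ps (hom f g) a b"
  shows "hcart f g \<bullet> [c] \<in> cells ps (lid (tcod X f)) (f \<cdot> a) (g \<cdot> b)"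
  by (rule comp1_in[OF hcart(2)[OF fg] c])

lemma cells_homD:
  assumes fg: "parallel f g" and c: "c \<in> cells ps (hom f g) a b"
  shows "a \<in> Tight X" "tcod X a = tdom X f" "b \<in> Tight X" "tcod X b = tdom X g"
  using cellsD[OF c] fg by auto

text \<open>Uniqueness of factorisations; it is the reason why equations between 2-cells into E(f,g)
  may be checked on elements.\<close>

lemma hcart_cancel:
  assumes fg: "parallel f g" and c: "c \<in> cells ps (hom f g) a b" and c': "c' \<in> cells ps (hom f g) a b"
    and eq: "hcart f g \<bullet> [c] = hcart f g \<bullet> [c']"
  shows "c = c'"
  using fac_ex1[OF fg cells_homD[OF fg c] hcart_comp_in[OF fg c]] c c' eq by blast

lemma fac_hcart:
  assumes fg: "parallel f g" and c: "c \<in> cells ps (hom f g) a b"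
  shows "fac f g a b (hcart f g \<bullet> [c]) = c"
  using hcart_cancel[OF fg _ c] fac[OF fg cells_homD[OF fg c] hcart_comp_in[OF fg c]] by blast

lemma fac_paste:
  assumes fg: "parallel f g" and ab: "a \<in> Tight X" "tcod X a = tdom X f" "b \<in> Tight X" "tcod X b = tdom X g"
    and d: "d \<in> cells ps (lid (tcod X f)) (f \<cdot> a) (g \<cdot> b)"
    and cs: "cell_path X h cs k" "map (ccod X) cs = ps" "tcod X h = tdom X a"
  shows "paste X (fac f g a b d) h cs = fac f g (a \<cdot> h) (b \<cdot> k) (paste X d h cs)"
proof -
  note F = fac[OF fg ab d]
  have "hcart f g \<bullet> [paste X (fac f g a b d) h cs] = paste X d h cs"
    using comp1_paste[OF hcart(2)[OF fg] F(1) cs] F(2) by simp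
  then show ?thesis using fac_hcart[OF fg paste_in[OF F(1) cs]] by simp
qed

lemma into_hom:
  assumes fg: "parallel f g" and d: "d \<in> cells ps (lid (tcod X f)) f g"
  shows "into_hom f g d \<in> cells ps (hom f g) (tid X (tdom X f)) (tid X (tdom X g))"
    and "hcart f g \<bullet> [into_hom f g d] = d"
  using fac[OF fg, of "tid X (tdom X f)" "tid X (tdom X g)" d ps] d parallelD[OF fg]
  by (simp_all add: into_hom_def)

lemma globular_hom:
  assumes "parallel f g"
  shows "globular ps (hom f g) = cells ps (hom f g) (tid X (tdom X f)) (tid X (tdom X g))"
  using assms by (simp add: globular_def)

lemma hcart_globular_in:
  assumes fg: "parallel f g" and c: "c \<in> globular ps (hom f g)"
  shows "hcart f g \<bullet> [c] \<in> cells ps (lid (tcod X f)) f g"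
  using hcart_comp_in[OF fg c[unfolded globular_hom[OF fg]]] parallelD[OF fg] by simp

lemma hcart_cancel_globular:
  assumes fg: "parallel f g" and c: "c \<in> globular ps (hom f g)" "c' \<in> globular ps (hom f g)"
    and eq: "hcart f g \<bullet> [c] = hcart f g \<bullet> [c']"
  shows "c = c'"
  using hcart_cancel[OF fg] c eq unfolding globular_hom[OF fg] by blast

lemma hcart_cid:
  assumes "parallel f g"
  shows "hcart f g \<bullet> [cid X (hom f g)] = hcart f g"
  using comp1_cid[OF hcart(2)[OF assms]] .

lemma frown:
  assumes "f \<in> Tight X"
  shows "frown f \<in> globular [] (hom f f)" "hcart f f \<bullet> [frown f] = one f"
  using into_hom[of f f "one f" "[]"] one_in[OF assms] assms globular_hom[of f f]
  by (simp_all add: parallel_def frown_def one_def)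

lemma smile:
  assumes "parallel x t" "parallel t y"
  shows "smile x t y \<in> globular [hom x t, hom t y] (hom x y)"
    and "hcart x y \<bullet> [smile x t y] = hcart x t \<otimes> hcart t y"
proof -
  have xy: "parallel x y" using assms by (simp add: parallel_def)
  have e: "tcod X t = tcod X x" using parallelD[OF assms(1)] by simp
  have t: "hcart t y \<in> cells [hom t y] (lid (tcod X x)) t y" using hcart(2)[OF assms(2)] e by simp
  have m: "hcart x t \<otimes> hcart t y \<in> cells [hom x t, hom t y] (lid (tcod X x)) x y"
    using mul_in[OF hcart(2)[OF assms(1)] t e] by simp
  have s: "smile x t y = into_hom x y (hcart x t \<otimes> hcart t y)"
    using cellsD(3)[OF hcart(2)[OF assms(1)]] e by (simp add: smile_def mul_def)
  show "smile x t y \<in> globular [hom x t, hom t y] (hom x y)"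
    "hcart x y \<bullet> [smile x t y] = hcart x t \<otimes> hcart t y"
    using into_hom[OF xy m] globular_hom[OF xy] s by simp_all
qed

text \<open>Composition in E is multiplication of elements. Through this every axiom stated with
  \<open>smile\<close> becomes an equation about \<otimes>; the common boundary \<open>b\<close>
  need not be an identity.\<close>

lemma smile_comp:
  assumes "parallel x t" "parallel t y"
    and c: "c \<in> cells ps (hom x t) a b" and c': "c' \<in> cells qs (hom t y) b d"
  shows "smile x t y \<bullet> [c, c'] \<in> cells (ps @ qs) (hom x y) a d"
    and "hcart x y \<bullet> [smile x t y \<bullet> [c, c']] = (hcart x t \<bullet> [c]) \<otimes> (hcart t y \<bullet> [c'])"
proof -
  have xy: "parallel x y" using assms by (simp add: parallel_def)
  have e: "tcod X t = tcod X x" using parallelD[OF assms(1)] by simp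
  have t: "hcart t y \<in> cells [hom t y] (lid (tcod X x)) t y" using hcart(2)[OF assms(2)] e by simp
  note s = smile(1)[OF assms(1,2), unfolded globular_hom[OF xy]]
  note D = cellsD[OF c] cellsD[OF c'] cells_homD[OF assms(1) c] cells_homD[OF assms(2) c']
  have "paste X (smile x t y) a [c, c'] \<in> cells (concat (map (cdom X) [c, c'])) (hom x y) (tid X (tdom X x) \<cdot> a) (tid X (tdom X y) \<cdot> d)"
    by (rule paste_in[OF s]) (use D parallelD[OF assms(1)] in auto)
  then show "smile x t y \<bullet> [c, c'] \<in> cells (ps @ qs) (hom x y) a d"
    using D by (simp add: comp2_def)
  have "hcart x y \<bullet> [paste X (smile x t y) a [c, c']] = paste X (hcart x y \<bullet> [smile x t y]) a [c, c']"
    by (rule comp1_paste[OF hcart(2)[OF xy] s, symmetric]) (use D parallelD[OF assms(1)] in auto)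
  also have "\<dots> = paste X (hcart x t \<otimes> hcart t y) a ([c] @ [c'])"
    using smile(2)[OF assms(1,2)] by simp
  also have "\<dots> = paste X (hcart x t) a [c] \<otimes> paste X (hcart t y) b [c']"
    by (rule mul_paste[OF hcart(2)[OF assms(1)] t]) (use D e in auto)
  finally show "hcart x y \<bullet> [smile x t y \<bullet> [c, c']] = (hcart x t \<bullet> [c]) \<otimes> (hcart t y \<bullet> [c'])"
    using D by (simp add: comp2_def)
qed

section \<open>Operators on elements induced by 2-cells E(f,g) => E(f',g')\<close>

definition hom_transf :: "'t \<Rightarrow> 't \<Rightarrow> 't \<Rightarrow> 't \<Rightarrow> 'c \<Rightarrow> bool" where
  "hom_transf f g f' g' c \<longleftrightarrow> parallel f g \<and> parallel f' g' \<and> tcod X f' = tcod X f \<and>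
     tdom X f' = tdom X f \<and> tdom X g' = tdom X g \<and> c \<in> globular [hom f g] (hom f' g')"

(* the Yoneda-style action of c : E(f,g) => E(f',g') on 2-cells d into the loose-identity with
   left f and right g b; the tight-cell b is an argument since g and g b do not determine it *)
definition ap :: "'t \<Rightarrow> 't \<Rightarrow> 't \<Rightarrow> 't \<Rightarrow> 'c \<Rightarrow> 't \<Rightarrow> 'c \<Rightarrow> 'c" where
  "ap f g f' g' c b d = hcart f' g' \<bullet> [c \<bullet> [fac f g (tid X (tdom X f)) b d]]"

context
  fixes f g f' g' c
  assumes tr: "hom_transf f g f' g' c"
begin

lemma hom_transfD:
  "parallel f g" "parallel f' g'" "tcod X f' = tcod X f" "tdom X f' = tdom X f" "tdom X g' = tdom X g"
  "c \<in> cells [hom f g] (hom f' g') (tid X (tdom X f)) (tid X (tdom X g))"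
  using tr globular_hom[of f' g' "[hom f g]"] by (auto simp: hom_transf_def)

lemma hom_transf_comp_in:
  assumes "d \<in> cells ps (hom f g) a b"
  shows "c \<bullet> [d] \<in> cells ps (hom f' g') a b"
  using comp1_in[OF hom_transfD(6) assms] cells_homD[OF hom_transfD(1) assms] by simp

lemma ap_hcart_comp:
  assumes "d \<in> cells ps (hom f g) (tid X (tdom X f)) b"
  shows "ap f g f' g' c b (hcart f g \<bullet> [d]) = hcart f' g' \<bullet> [c \<bullet> [d]]"
  using fac_hcart[OF hom_transfD(1) assms] by (simp add: ap_def)

text \<open>\<open>hcart f g\<close> is the generic element, as it factors through itself by an
  identity. Its image determines \<open>c\<close>.\<close>

lemma ap_hcart: "ap f g f' g' c (tid X (tdom X g)) (hcart f g) = hcart f' g' \<bullet> [c]"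
  using ap_hcart_comp[of "cid X (hom f g)" "[hom f g]" "tid X (tdom X g)"] cid_in[of "hom f g"] hom_transfD(1)
    hcart_cid[OF hom_transfD(1)] comp1_cid[OF hom_transfD(6)] by simp

context
  fixes b d ps
  assumes b: "b \<in> Tight X" "tcod X b = tdom X g"
    and d: "d \<in> cells ps (lid (tcod X f)) f (g \<cdot> b)"
begin

lemma hom_transf_fac:
  "fac f g (tid X (tdom X f)) b d \<in> cells ps (hom f g) (tid X (tdom X f)) b"
  "hcart f g \<bullet> [fac f g (tid X (tdom X f)) b d] = d"
proof -
  have *: "tid X (tdom X f) \<in> Tight X" "tcod X (tid X (tdom X f)) = tdom X f"
    using parallelD[OF hom_transfD(1)] by auto
  have d': "d \<in> cells ps (lid (tcod X f)) (f \<cdot> tid X (tdom X f)) (g \<cdot> b)"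
    using d parallelD[OF hom_transfD(1)] by simp
  show "fac f g (tid X (tdom X f)) b d \<in> cells ps (hom f g) (tid X (tdom X f)) b"
    "hcart f g \<bullet> [fac f g (tid X (tdom X f)) b d] = d"
    by (rule fac[OF hom_transfD(1) * b d'])+
qed

lemma ap_in: "ap f g f' g' c b d \<in> cells ps (lid (tcod X f)) f' (g' \<cdot> b)"
  using hcart_comp_in[OF hom_transfD(2) hom_transf_comp_in[OF hom_transf_fac(1)]]
    hom_transfD(3,4) parallelD[OF hom_transfD(2)] by (simp add: ap_def)

text \<open>Naturality of the operator in the domain of its argument. The right boundary
  \<open>k\<close> of the pasted 2-cells is absorbed into the tight-cell argument.\<close>

lemma ap_paste:
  assumes cs: "cell_path X (tid X (tdom X f)) cs k" "map (ccod X) cs = ps"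
  shows "paste X (ap f g f' g' c b d) (tid X (tdom X f)) cs =
    ap f g f' g' c (b \<cdot> k) (paste X d (tid X (tdom X f)) cs)"
proof -
  note F = hom_transf_fac
  have i: "tid X (tdom X f) \<in> Tight X" "tcod X (tid X (tdom X f)) = tdom X f" "tdom X (tid X (tdom X f)) = tdom X f"
    using parallelD[OF hom_transfD(1)] by auto
  have i3: "tcod X (tid X (tdom X f)) = tdom X (tid X (tdom X f))" using i by simp
  have d': "d \<in> cells ps (lid (tcod X f)) (f \<cdot> tid X (tdom X f)) (g \<cdot> b)"
    using d parallelD[OF hom_transfD(1)] by simp
  have "paste X (ap f g f' g' c b d) (tid X (tdom X f)) cs =
    hcart f' g' \<bullet> [paste X (c \<bullet> [fac f g (tid X (tdom X f)) b d]) (tid X (tdom X f)) cs]"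
    unfolding ap_def
    by (rule comp1_paste[OF hcart(2)[OF hom_transfD(2)] hom_transf_comp_in[OF F(1)] cs i3])
  also have "paste X (c \<bullet> [fac f g (tid X (tdom X f)) b d]) (tid X (tdom X f)) cs =
     c \<bullet> [paste X (fac f g (tid X (tdom X f)) b d) (tid X (tdom X f)) cs]"
    by (rule comp1_paste[OF hom_transfD(6) F(1) cs i3])
  also have "paste X (fac f g (tid X (tdom X f)) b d) (tid X (tdom X f)) cs =
     fac f g (tid X (tdom X f) \<cdot> tid X (tdom X f)) (b \<cdot> k) (paste X d (tid X (tdom X f)) cs)"
    by (rule fac_paste[OF hom_transfD(1) i(1,2) b d' cs i3])
  finally show ?thesis using i by (simp add: ap_def)
qed

text \<open>\<open>s\<close> is a 2-cell over the source of \<open>g\<close>, so it can be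
  multiplied onto the factorisation of \<open>d\<close> through E(f,g) before \<open>c\<close> is
  applied. A right factor over E that does not come from that source could not be moved inside in
  this way; this is what makes transposition along an algebra object necessary later.\<close>

lemma ap_mul:
  assumes s: "s \<in> cells qs (lid (tdom X g)) b x"
  shows "ap f g f' g' c x (d \<otimes> (lid_map g \<bullet> [s])) = ap f g f' g' c b d \<otimes> (lid_map g' \<bullet> [s])"
proof -
  note F = hom_transf_fac
  let ?F = "fac f g (tid X (tdom X f)) b d"
  note G = hom_transfD
  have o: "tdom X g \<in> Obj X" using parallelD[OF G(1)] by simp
  have m: "?F \<otimes> s \<in> cells (ps @ qs) (hom f g) (tid X (tdom X f)) x"
    by (rule mul_in[OF F(1) s b(2)])
  have "d \<otimes> (lid_map g \<bullet> [s]) = hcart f g \<bullet> [?F \<otimes> s]"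
    using comp1_mul[OF hcart(2)[OF G(1)] F(1) s] F(2) by simp
  then have "ap f g f' g' c x (d \<otimes> (lid_map g \<bullet> [s])) = hcart f' g' \<bullet> [c \<bullet> [?F \<otimes> s]]"
    using ap_hcart_comp[OF m] by simp
  \<comment> \<open>The right boundary of \<open>c\<close> is an identity, so the transport of
    \<open>s\<close> in \<open>comp1_mul\<close> is trivial.\<close>
  also have "c \<bullet> [?F \<otimes> s] = (c \<bullet> [?F]) \<otimes> s"
  proof -
    have s': "s \<in> cells qs (lid (tdom X (tid X (tdom X g)))) b x" using s o by simp
    show ?thesis
      using comp1_mul[OF G(6) F(1) s'] lid_map_tid[OF o] cid_comp1[OF s] by simp
  qed
  also have "hcart f' g' \<bullet> [(c \<bullet> [?F]) \<otimes> s] = (hcart f' g' \<bullet> [c \<bullet> [?F]]) \<otimes> (lid_map g' \<bullet> [s])"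
    by (rule comp1_mul[OF hcart(2)[OF G(2)] hom_transf_comp_in[OF F(1)]]) (use s G in simp)
  finally show ?thesis by (simp add: ap_def)
qed

end

lemma restr_right:
  assumes x: "x \<in> Tight X" "tcod X x = tdom X g"
  shows "hom_transf f (g \<cdot> x) f' (g' \<cdot> x) (restr_right f g f' g' x c)"
    and "hcart f' (g' \<cdot> x) \<bullet> [restr_right f g f' g' x c] = ap f g f' g' c x (hcart f (g \<cdot> x))"
proof -
  note G = hom_transfD
  note p = parallelD[OF G(1)] parallelD[OF G(2)]
  have par: "parallel f (g \<cdot> x)" "parallel f' (g' \<cdot> x)"
    using p G x by (auto simp: parallel_def)
  note a = ap_in[OF x hcart(2)[OF par(1)]]
  have e: "restr_right f g f' g' x c = into_hom f' (g' \<cdot> x) (ap f g f' g' c x (hcart f (g \<cdot> x)))"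
    by (simp add: restr_right_def ap_def)
  have a': "ap f g f' g' c x (hcart f (g \<cdot> x)) \<in> cells [hom f (g \<cdot> x)] (lid (tcod X f')) f' (g' \<cdot> x)"
    using a G by simp
  show "hom_transf f (g \<cdot> x) f' (g' \<cdot> x) (restr_right f g f' g' x c)"
    using into_hom(1)[OF par(2) a'] par G p x globular_hom[OF par(2)] by (simp add: hom_transf_def e)
  show "hcart f' (g' \<cdot> x) \<bullet> [restr_right f g f' g' x c] = ap f g f' g' c x (hcart f (g \<cdot> x))"
    using into_hom(2)[OF par(2) a'] e by simp
qed

end

text \<open>Restricting \<open>c\<close> along \<open>x\<close> only shifts the tight-cell argument
  from \<open>b\<close> to \<open>x \<cdot> b\<close>. In this form the 2-cell
  \<open>restr_right\<close> can be eliminated from the notion of a mediating tight-cell.\<close>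

lemma ap_restr_right:
  assumes tr: "hom_transf f g f' g' c" and x: "x \<in> Tight X" "tcod X x = tdom X g"
    and b: "b \<in> Tight X" "tcod X b = tdom X x" and d: "d \<in> cells ps (lid (tcod X f)) f ((g \<cdot> x) \<cdot> b)"
  shows "ap f (g \<cdot> x) f' (g' \<cdot> x) (restr_right f g f' g' x c) b d = ap f g f' g' c (x \<cdot> b) d"
proof -
  note G = hom_transfD[OF tr] note R = restr_right[OF tr x]
  note G' = hom_transfD[OF R(1)]
  have b': "b \<in> Tight X" "tcod X b = tdom X (g \<cdot> x)" using b x parallelD[OF G(1)] by auto
  let ?F = "fac f (g \<cdot> x) (tid X (tdom X f)) b d"
  note F = hom_transf_fac[OF R(1) b' d]
  note cF = cellsD[OF F(1)]
  have p: "cell_path X (tid X (tdom X f)) [?F] b" "map (ccod X) [?F] = [hom f (g \<cdot> x)]"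
    using cF by auto
  have "ap f (g \<cdot> x) f' (g' \<cdot> x) (restr_right f g f' g' x c) b d =
     hcart f' (g' \<cdot> x) \<bullet> [restr_right f g f' g' x c \<bullet> [?F]]" by (simp add: ap_def)
  also have "\<dots> = (hcart f' (g' \<cdot> x) \<bullet> [restr_right f g f' g' x c]) \<bullet> [?F]"
    by (rule comp1_assoc[OF hcart(2)[OF G'(2)] G'(6) F(1), symmetric])
  also have "\<dots> = ap f g f' g' c (x \<cdot> b) (hcart f (g \<cdot> x) \<bullet> [?F])"
    using ap_paste[OF tr x hcart(2)[OF G'(1)] p] cF R(2) by (simp add: comp2_def)
  finally show ?thesis using F(2) by simp
qed

text \<open>The composite of E(1,u) and B(1,x) becomes a product of generic elements, the second of
  which is carried from B to E by \<open>lid_map u\<close>.\<close>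

lemma hom_split:
  assumes u: "u \<in> Tight X" and x: "x \<in> Tight X" "tcod X x = tdom X u"
  defines "I \<equiv> tid X (tcod X u)" and "J \<equiv> tid X (tdom X u)"
  shows "hom_split u x \<in> globular [hom I u, hom J x] (hom I (u \<cdot> x))"
    and "hcart I (u \<cdot> x) \<bullet> [hom_split u x] = hcart I u \<otimes> (lid_map u \<bullet> [hcart J x])"
proof -
  have o: "tcod X u \<in> Obj X" "tdom X u \<in> Obj X" using u by auto
  have IJ: "I \<in> Tight X" "tcod X I = tcod X u" "tdom X I = tcod X u"
     "J \<in> Tight X" "tcod X J = tdom X u" "tdom X J = tdom X u"
    using o by (auto simp: I_def J_def)
  have p: "parallel I u" "parallel J x" "parallel I (u \<cdot> x)"
    using IJ u x by (auto simp: parallel_def)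
  have c: "cid X (hom I u) \<in> cells [hom I u] (hom I u) I J"
    using cid_in[of "hom I u"] p IJ by (simp add: I_def J_def)
  have h: "hcart J x \<in> cells [hom J x] (lid (tdom X u)) J x" using hcart(2)[OF p(2)] IJ by simp
  have "hcart I u \<bullet> [cid X (hom I u) \<otimes> hcart J x] = (hcart I u \<bullet> [cid X (hom I u)]) \<otimes> (lid_map u \<bullet> [hcart J x])"
    by (rule comp1_mul[OF hcart(2)[OF p(1)] c h])
  then have e: "hcart I u \<bullet> [cid X (hom I u) \<otimes> hcart J x] = hcart I u \<otimes> (lid_map u \<bullet> [hcart J x])"
    by (simp add: hcart_cid[OF p(1)])
  have s: "hom_split u x = into_hom I (u \<cdot> x) (hcart I u \<bullet> [cid X (hom I u) \<otimes> hcart J x])"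
    using cellsD(3)[OF c] by (simp add: hom_split_def mul_def I_def J_def)
  have "hcart I u \<otimes> (lid_map u \<bullet> [hcart J x]) \<in> cells ([hom I u] @ [hom J x]) (lid (tcod X I)) I (u \<cdot> x)"
    by (rule mul_in[OF hcart(2)[OF p(1)]]) (use lid_map_in[OF u h] u IJ in \<open>auto simp: J_def\<close>)
  then have m: "hcart I u \<otimes> (lid_map u \<bullet> [hcart J x]) \<in> cells [hom I u, hom J x] (lid (tcod X I)) I (u \<cdot> x)"
    by simp
  show "hom_split u x \<in> globular [hom I u, hom J x] (hom I (u \<cdot> x))"
    "hcart I (u \<cdot> x) \<bullet> [hom_split u x] = hcart I u \<otimes> (lid_map u \<bullet> [hcart J x])"
    using into_hom[OF p(3) m] e s globular_hom[OF p(3)] by simp_all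
qed


text \<open>Associativity moves the factorisation of \<open>d\<close> to the outside. A law known
  for the generic value \<open>hcart f' g' \<bullet> [c]\<close> thus gives the law for
  \<open>d\<close> by pasting.\<close>

lemma ap_alt:
  assumes tr: "hom_transf f g f' g' c" and b: "b \<in> Tight X" "tcod X b = tdom X g"
    and d: "d \<in> cells ps (lid (tcod X f)) f (g \<cdot> b)"
  shows "ap f g f' g' c b d = paste X (hcart f' g' \<bullet> [c]) (tid X (tdom X f)) [fac f g (tid X (tdom X f)) b d]"
  using comp1_assoc[OF hcart(2)[OF hom_transfD(2)[OF tr]] hom_transfD(6)[OF tr] hom_transf_fac(1)[OF tr b d]]
    cellsD[OF hom_transf_fac(1)[OF tr b d]]
  by (simp add: ap_def comp2_def)

lemma ap_tid_in:
  assumes tr: "hom_transf f g f' g' c" and d: "d \<in> cells ps (lid (tcod X f)) f g"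
  shows "ap f g f' g' c (tid X (tdom X g)) d \<in> cells ps (lid (tcod X f)) f' g'"
  using ap_in[OF tr, of "tid X (tdom X g)" d ps] d parallelD[OF hom_transfD(1)[OF tr]]
    parallelD[OF hom_transfD(2)[OF tr]] hom_transfD(5)[OF tr] by simp

lemma hom_transf_eqI:
  assumes "hom_transf f g f' g' c" "hom_transf f g f' g' c'"
    and "hcart f' g' \<bullet> [c] = hcart f' g' \<bullet> [c']"
  shows "c = c'"
  using hcart_cancel_globular[of f' g' c "[hom f g]" c'] assms by (auto simp: hom_transf_def)

lemma hom_transf_comp:
  assumes "hom_transf f g f' g' c" "hom_transf f' g' f'' g'' c'"
  shows "hom_transf f g f'' g'' (c' \<bullet> [c])"
    and "\<lbrakk>b \<in> Tight X; tcod X b = tdom X g; d \<in> cells ps (lid (tcod X f)) f (g \<cdot> b)\<rbrakk> \<Longrightarrow>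
      ap f g f'' g'' (c' \<bullet> [c]) b d = ap f' g' f'' g'' c' b (ap f g f' g' c b d)"
proof -
  note G = hom_transfD[OF assms(1)] note G' = hom_transfD[OF assms(2)]
  have o: "tdom X f \<in> Obj X" "tdom X g \<in> Obj X" using parallelD[OF G(1)] by auto
  have "c' \<bullet> [c] \<in> cells [hom f g] (hom f'' g'') (tid X (tdom X f)) (tid X (tdom X g))"
    using comp1_in[OF G'(6) G(6)] G o by simp
  then show *: "hom_transf f g f'' g'' (c' \<bullet> [c])"
    using G G' globular_hom[OF G'(2)] by (simp add: hom_transf_def)
  assume b: "b \<in> Tight X" "tcod X b = tdom X g" and d: "d \<in> cells ps (lid (tcod X f)) f (g \<cdot> b)"
  note F = hom_transf_fac[OF assms(1) b d]
  have F': "c \<bullet> [fac f g (tid X (tdom X f)) b d] \<in> cells ps (hom f' g') (tid X (tdom X f')) b"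
    using hom_transf_comp_in[OF assms(1) F(1)] G by simp
  show "ap f g f'' g'' (c' \<bullet> [c]) b d = ap f' g' f'' g'' c' b (ap f g f' g' c b d)"
    using ap_hcart_comp[OF assms(2) F'] comp1_assoc[OF G'(6) G(6) F(1)] by (simp add: ap_def)
qed

text \<open>E(r,h) acts by left multiplication with the element of \<open>r\<close>: pasting the
  factorisation of \<open>d\<close> leaves the nullary first factor alone and turns the second into
  \<open>d\<close>.\<close>

lemma hom_pre:
  assumes r: "r \<in> globular [] (hom f g)" and fg: "parallel f g" and gh: "parallel g h"
  shows "hom_transf g h f h (hom_pre f g r h)"
    and "hcart f h \<bullet> [hom_pre f g r h] = (hcart f g \<bullet> [r]) \<otimes> hcart g h"
    and "\<lbrakk>b \<in> Tight X; tcod X b = tdom X h; d \<in> cells ps (lid (tcod X g)) g (h \<cdot> b)\<rbrakk> \<Longrightarrow>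
      ap g h f h (hom_pre f g r h) b d = (hcart f g \<bullet> [r]) \<otimes> d"
proof -
  note p = parallelD[OF fg] parallelD[OF gh]
  have fh: "parallel f h" using p by (simp add: parallel_def)
  note r' = r[unfolded globular_hom[OF fg]]
  have A: "tdom X f = tdom X g" using nullary_cell_tdom[OF r'] p by simp
  have c: "cid X (hom g h) \<in> cells [hom g h] (hom g h) (tid X (tdom X g)) (tid X (tdom X h))"
    using cid_in[of "hom g h"] gh by simp
  note s = smile_comp[OF fg gh r' c]
  show tr: "hom_transf g h f h (hom_pre f g r h)"
    using s(1) p A fh gh by (simp add: hom_transf_def hom_pre_def globular_hom[OF fh])
  show e: "hcart f h \<bullet> [hom_pre f g r h] = (hcart f g \<bullet> [r]) \<otimes> hcart g h"
    using s(2) hcart_cid[OF gh] by (simp add: hom_pre_def)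
  assume b: "b \<in> Tight X" "tcod X b = tdom X h" and d: "d \<in> cells ps (lid (tcod X g)) g (h \<cdot> b)"
  let ?F = "fac g h (tid X (tdom X g)) b d"
  note F = hom_transf_fac[OF tr b d]
  have r1: "hcart f g \<bullet> [r] \<in> cells [] (lid (tcod X f)) f g"
    using hcart_globular_in[OF fg r] p by simp
  have h1: "hcart g h \<in> cells [hom g h] (lid (tcod X f)) g h" using hcart(2)[OF gh] p by simp
  have "ap g h f h (hom_pre f g r h) b d = paste X ((hcart f g \<bullet> [r]) \<otimes> hcart g h) (tid X (tdom X g)) ([] @ [?F])"
    using ap_alt[OF tr b d] e by simp
  also have "\<dots> = paste X (hcart f g \<bullet> [r]) (tid X (tdom X g)) [] \<otimes> paste X (hcart g h) (tid X (tdom X g)) [?F]"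
    by (rule mul_paste[OF r1 h1]) (use p A cellsD[OF F(1)] in auto)
  also have "\<dots> = (hcart f g \<bullet> [r]) \<otimes> d"
    using paste_tid[OF r1] A F(2) cellsD[OF F(1)] by (simp add: comp2_def)
  finally show "ap g h f h (hom_pre f g r h) b d = (hcart f g \<bullet> [r]) \<otimes> d" .
qed

text \<open>E(h,r) acts by right multiplication. The operator is evaluated at an identity on the
  right, since for a general tight-cell the element of \<open>r\<close> would have to be restricted
  along it as well.\<close>

lemma hom_post:
  assumes r: "r \<in> globular [] (hom f g)" and hf: "parallel h f" and fg: "parallel f g"
  shows "hom_transf h f h g (hom_post h f g r)"
    and "hcart h g \<bullet> [hom_post h f g r] = hcart h f \<otimes> (hcart f g \<bullet> [r])"
    and "d \<in> cells ps (lid (tcod X h)) h f \<Longrightarrow>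
      ap h f h g (hom_post h f g r) (tid X (tdom X f)) d = d \<otimes> (hcart f g \<bullet> [r])"
proof -
  note p = parallelD[OF hf] parallelD[OF fg]
  have hg: "parallel h g" using p by (simp add: parallel_def)
  note r' = r[unfolded globular_hom[OF fg]]
  have A: "tdom X g = tdom X f" using nullary_cell_tdom[OF r'] p by simp
  have c: "cid X (hom h f) \<in> cells [hom h f] (hom h f) (tid X (tdom X h)) (tid X (tdom X f))"
    using cid_in[of "hom h f"] hf by simp
  note s = smile_comp[OF hf fg c r']
  show tr: "hom_transf h f h g (hom_post h f g r)"
    using s(1) p A hf hg by (simp add: hom_transf_def hom_post_def globular_hom[OF hg])
  show e: "hcart h g \<bullet> [hom_post h f g r] = hcart h f \<otimes> (hcart f g \<bullet> [r])"
    using s(2) hcart_cid[OF hf] by (simp add: hom_post_def)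
  assume d: "d \<in> cells ps (lid (tcod X h)) h f"
  have b: "tid X (tdom X f) \<in> Tight X" "tcod X (tid X (tdom X f)) = tdom X f" using p by auto
  have d': "d \<in> cells ps (lid (tcod X h)) h (f \<cdot> tid X (tdom X f))" using d p by simp
  let ?F = "fac h f (tid X (tdom X h)) (tid X (tdom X f)) d"
  note F = hom_transf_fac[OF tr b d']
  have r1: "hcart f g \<bullet> [r] \<in> cells [] (lid (tcod X h)) f g"
    using hcart_globular_in[OF fg r] p by simp
  have h1: "hcart h f \<in> cells [hom h f] (lid (tcod X h)) h f" using hcart(2)[OF hf] p by simp
  have "ap h f h g (hom_post h f g r) (tid X (tdom X f)) d = paste X (hcart h f \<otimes> (hcart f g \<bullet> [r])) (tid X (tdom X h)) ([?F] @ [])"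
    using ap_alt[OF tr b d'] e by simp
  also have "\<dots> = paste X (hcart h f) (tid X (tdom X h)) [?F] \<otimes> paste X (hcart f g \<bullet> [r]) (tid X (tdom X f)) []"
    by (rule mul_paste[OF h1 r1]) (use p A cellsD[OF F(1)] in auto)
  also have "\<dots> = d \<otimes> (hcart f g \<bullet> [r])"
    using paste_tid[OF r1] F(2) cellsD[OF F(1)] by (simp add: comp2_def)
  finally show "ap h f h g (hom_post h f g r) (tid X (tdom X f)) d = d \<otimes> (hcart f g \<bullet> [r])" .
qed

end

section \<open>Relative monads and algebras in terms of elements\<close>

locale tight_cell_in_equipment = virtual_equipment X for X :: "('o, 't, 'l, 'c) vdc_data" +
  fixes j :: 't
  assumes j: "j \<in> Tight X"
begin

abbreviation A where "A \<equiv> tdom X j"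
abbreviation E where "E \<equiv> tcod X j"
abbreviation el where "el ps f g \<equiv> cells ps (lid E) f g"

lemma AE [simp]: "A \<in> Obj X" "E \<in> Obj X"
  using j by auto

definition eta :: "('t, 'c) rmnd_data \<Rightarrow> 'c" where
  "eta T = hcart j (carrier T) \<bullet> [unit T]"

definition ext :: "('t, 'c) rmnd_data \<Rightarrow> 'c \<Rightarrow> 'c" where
  "ext T d = ap j (carrier T) (carrier T) (carrier T) (extension T) (tid X A) d"

definition free_alg :: "('t, 'c) rmnd_data \<Rightarrow> ('t, 'c) alg_data" where
  "free_alg T = \<lparr>alg_carrier = carrier T, alg_action = extension T\<rparr>"

text \<open>The argument \<open>b\<close> makes this the action of the algebra restricted along
  \<open>b\<close>; at an identity it is the action of \<open>a\<close> itself.\<close>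

definition act :: "('t, 'c) rmnd_data \<Rightarrow> ('t, 'c) alg_data \<Rightarrow> 't \<Rightarrow> 'c \<Rightarrow> 'c" where
  "act T a b d = ap j (alg_carrier a) (carrier T) (alg_carrier a) (alg_action a) b d"

lemma act_free: "act T (free_alg T) (tid X A) = ext T"
  by (simp add: act_def ext_def free_alg_def fun_eq_iff)

lemma rm_frame:
  assumes "relative_monad j T"
  shows "carrier T \<in> Tight X" "tdom X (carrier T) = A" "tcod X (carrier T) = E"
    "unit T \<in> globular [] (hom j (carrier T))"
    "hom_transf j (carrier T) (carrier T) (carrier T) (extension T)"
    "parallel j (carrier T)" "parallel (carrier T) (carrier T)"
  using assms j by (auto simp: relative_monad_def Let_def two_cells_def hom_transf_def parallel_def)

lemma eta_in:
  assumes T: "relative_monad j T"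
  shows "eta T \<in> el [] j (carrier T)"
  using hcart_globular_in[OF rm_frame(6,4)[OF T]] by (simp add: eta_def)

text \<open>The typing part of \<open>algebra\<close>, kept apart so that the operator
  \<open>act\<close> can be handled before the laws are established.\<close>

definition alg_frame :: "('t, 'c) rmnd_data \<Rightarrow> ('t, 'c) alg_data \<Rightarrow> bool" where
  "alg_frame T a \<longleftrightarrow> alg_carrier a \<in> Tight X \<and> tcod X (alg_carrier a) = E \<and>
    hom_transf j (alg_carrier a) (carrier T) (alg_carrier a) (alg_action a)"

lemma alg_frameD:
  assumes "alg_frame T a"
  shows "alg_carrier a \<in> Tight X" "tcod X (alg_carrier a) = E"
    "hom_transf j (alg_carrier a) (carrier T) (alg_carrier a) (alg_action a)"
  using assms by (auto simp: alg_frame_def)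

lemma act_in:
  assumes a: "alg_frame T a" and b: "b \<in> Tight X" "tcod X b = tdom X (alg_carrier a)"
    and d: "d \<in> el ps j (alg_carrier a \<cdot> b)"
  shows "act T a b d \<in> el ps (carrier T) (alg_carrier a \<cdot> b)"
  using ap_in[OF alg_frameD(3)[OF a] b d] by (simp add: act_def)

text \<open>Both laws are equations between 2-cells into restrictions, hence between their elements:
  E(\<eta>,e) turns into left multiplication by \<open>eta T\<close> and each \<open>smile\<close>
  into \<otimes>. What remains are the laws at the generic elements.\<close>

lemma algebra_iff:
  assumes T: "relative_monad j T"
  defines "t \<equiv> carrier T"
  shows "algebra j T a \<longleftrightarrow> alg_frame T a \<and>
    eta T \<otimes> (hcart t (alg_carrier a) \<bullet> [alg_action a]) = hcart j (alg_carrier a) \<and>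
    (hcart t t \<bullet> [extension T]) \<otimes> (hcart t (alg_carrier a) \<bullet> [alg_action a]) =
      act T a (tid X (tdom X (alg_carrier a))) (hcart j t \<otimes> (hcart t (alg_carrier a) \<bullet> [alg_action a]))"
proof -
  note M = rm_frame[OF T, folded t_def]
  define e where "e = alg_carrier a"
  have "(hom_pre j t (unit T) e \<bullet> [alg_action a] = cid X (hom j e) \<and>
      smile t t e \<bullet> [extension T, alg_action a] = alg_action a \<bullet> [smile j t e \<bullet> [cid X (hom j t), alg_action a]]) \<longleftrightarrow>
    eta T \<otimes> (hcart t e \<bullet> [alg_action a]) = hcart j e \<and>
    (hcart t t \<bullet> [extension T]) \<otimes> (hcart t e \<bullet> [alg_action a]) =
      act T a (tid X (tdom X e)) (hcart j t \<otimes> (hcart t e \<bullet> [alg_action a]))"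
    if fr: "alg_frame T a"
  proof -
    note F = alg_frameD[OF fr, folded e_def t_def] note G = hom_transfD[OF F(3)]
    have te: "parallel t e" "parallel j e" using M F j by (auto simp: parallel_def)
    note P = hom_pre[OF M(4,6) te(1)]
    have act: "hcart t e \<bullet> [alg_action a] \<in> el [hom j e] t e"
      using hcart_comp_in[OF te(1) G(6)] F M by simp
    have i: "tid X (tdom X e) \<in> Tight X" "tcod X (tid X (tdom X e)) = tdom X e" using F by auto
    note C = hom_transf_comp[OF F(3) P(1)]
    have c1: "hom_transf j e j e (cid X (hom j e))"
      using te j cid_globular[of "hom j e"] by (simp add: hom_transf_def)
    have act': "ap j e t e (alg_action a) (tid X (tdom X e)) (hcart j e) = hcart t e \<bullet> [alg_action a]"
      by (rule ap_hcart[OF F(3)])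
    have "hcart j e \<bullet> [hom_pre j t (unit T) e \<bullet> [alg_action a]] = ap j e j e (hom_pre j t (unit T) e \<bullet> [alg_action a]) (tid X (tdom X e)) (hcart j e)"
      by (rule ap_hcart[OF C(1), symmetric])
    also have "\<dots> = ap t e j e (hom_pre j t (unit T) e) (tid X (tdom X e)) (hcart t e \<bullet> [alg_action a])"
      using C(2)[OF i, of "hcart j e" "[hom j e]"] hcart(2)[OF te(2)] F(1) act' by simp
    also have "\<dots> = eta T \<otimes> (hcart t e \<bullet> [alg_action a])"
      using P(3)[OF i, of "hcart t e \<bullet> [alg_action a]" "[hom j e]"] act F(1) M(3) by (simp add: eta_def t_def)
    finally have 1: "hcart j e \<bullet> [hom_pre j t (unit T) e \<bullet> [alg_action a]] = eta T \<otimes> (hcart t e \<bullet> [alg_action a])" .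
    have A: "hom_pre j t (unit T) e \<bullet> [alg_action a] = cid X (hom j e) \<longleftrightarrow> eta T \<otimes> (hcart t e \<bullet> [alg_action a]) = hcart j e"
      using hom_transf_eqI[OF C(1) c1] 1 hcart_cid[OF te(2)] by auto
    have ac: "alg_action a \<in> cells [hom j e] (hom t e) (tid X A) (tid X (tdom X e))" using G(6) .
    have ex: "extension T \<in> cells [hom j t] (hom t t) (tid X A) (tid X A)"
      using hom_transfD(6)[OF M(5)] M by simp
    have ci: "cid X (hom j t) \<in> cells [hom j t] (hom j t) (tid X A) (tid X A)"
      using cid_in[of "hom j t"] M by simp
    note s1 = smile_comp[OF M(7) te(1) ex ac]
    note s2 = smile_comp[OF M(6) te(1) ci ac]
    note s3 = hom_transf_comp_in[OF F(3) s2(1)]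
    have 2: "hcart t e \<bullet> [alg_action a \<bullet> [smile j t e \<bullet> [cid X (hom j t), alg_action a]]] =
        act T a (tid X (tdom X e)) (hcart j t \<otimes> (hcart t e \<bullet> [alg_action a]))"
      using ap_hcart_comp[OF F(3) s2(1)] s2(2) hcart_cid[OF M(6)]
      by (simp add: act_def e_def t_def)
    have "smile t t e \<bullet> [extension T, alg_action a] = alg_action a \<bullet> [smile j t e \<bullet> [cid X (hom j t), alg_action a]] \<longleftrightarrow>
      (hcart t t \<bullet> [extension T]) \<otimes> (hcart t e \<bullet> [alg_action a]) =
      act T a (tid X (tdom X e)) (hcart j t \<otimes> (hcart t e \<bullet> [alg_action a]))"
      using hcart_cancel[OF te(1) s1(1), of "alg_action a \<bullet> [smile j t e \<bullet> [cid X (hom j t), alg_action a]]"] s3 s1(2) 2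
      by auto
    with A show ?thesis by simp
  qed
  moreover have "algebra j T a \<longleftrightarrow> alg_frame T a \<and> hom_pre j t (unit T) e \<bullet> [alg_action a] = cid X (hom j e) \<and>
      smile t t e \<bullet> [extension T, alg_action a] = alg_action a \<bullet> [smile j t e \<bullet> [cid X (hom j t), alg_action a]]"
    using j M by (auto simp: algebra_def Let_def alg_frame_def hom_transf_def e_def t_def parallel_def)
  ultimately show ?thesis unfolding e_def by blast
qed

lemma algebra_frame: "algebra j T a \<Longrightarrow> relative_monad j T \<Longrightarrow> alg_frame T a"
  using algebra_iff by blast

text \<open>The unit law at the generic element, pasted with the factorisation of \<open>d\<close>
  through E(j,e). Since the right boundary of that factorisation may be any \<open>b\<close>, the
  restricted algebras are covered too.\<close>

lemma eta_act:
  assumes T: "relative_monad j T" and a: "algebra j T a"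
    and b: "b \<in> Tight X" "tcod X b = tdom X (alg_carrier a)" and d: "d \<in> el ps j (alg_carrier a \<cdot> b)"
  shows "eta T \<otimes> act T a b d = d"
proof -
  define t e where "t = carrier T" and "e = alg_carrier a"
  note M = rm_frame[OF T, folded t_def]
  note F = alg_frameD[OF algebra_frame[OF a T], folded e_def t_def] note G = hom_transfD[OF F(3)]
  have te: "parallel t e" "parallel j e" using M F j by (auto simp: parallel_def)
  have U: "eta T \<otimes> (hcart t e \<bullet> [alg_action a]) = hcart j e"
    using a algebra_iff[OF T] by (simp add: e_def t_def)
  have act: "hcart t e \<bullet> [alg_action a] \<in> el [hom j e] t e"
    using hcart_comp_in[OF te(1) G(6)] F M by simp
  let ?F = "fac j e (tid X A) b d"
  note f = hom_transf_fac[OF F(3) b[folded e_def] d[folded e_def]]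
  have "paste X (eta T \<otimes> (hcart t e \<bullet> [alg_action a])) (tid X A) ([] @ [?F]) =
    paste X (eta T) (tid X A) [] \<otimes> paste X (hcart t e \<bullet> [alg_action a]) (tid X A) [?F]"
    by (rule mul_paste[OF eta_in[OF T, folded t_def] act]) (use cellsD[OF f(1)] M in auto)
  also have "paste X (eta T) (tid X A) [] = eta T"
    by (rule paste_tid[OF eta_in[OF T]])
  also have "paste X (hcart t e \<bullet> [alg_action a]) (tid X A) [?F] = act T a b d"
    using ap_alt[OF F(3) b[folded e_def] d[folded e_def]] by (simp add: act_def t_def e_def)
  finally have "paste X (hcart j e) (tid X A) [?F] = eta T \<otimes> act T a b d"
    using U by simp
  then show ?thesis using f(2) cellsD[OF f(1)] by (simp add: comp2_def)
qed

text \<open>The same passage for the associativity law: the factorisations of \<open>d\<close> and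
  \<open>d'\<close> are pasted side by side onto the equation between generic elements.\<close>

lemma ext_act:
  assumes T: "relative_monad j T" and a: "algebra j T a"
    and b: "b \<in> Tight X" "tcod X b = tdom X (alg_carrier a)" 
    and d: "d \<in> el ps j (carrier T)" and d': "d' \<in> el qs j (alg_carrier a \<cdot> b)"
  shows "ext T d \<otimes> act T a b d' = act T a b (d \<otimes> act T a b d')"
proof -
  define t e where "t = carrier T" and "e = alg_carrier a"
  note M = rm_frame[OF T, folded t_def]
  note F = alg_frameD[OF algebra_frame[OF a T], folded e_def t_def] note G = hom_transfD[OF F(3)]
  have te: "parallel t e" "parallel j e" using M F j by (auto simp: parallel_def)
  have U: "(hcart t t \<bullet> [extension T]) \<otimes> (hcart t e \<bullet> [alg_action a]) =
      act T a (tid X (tdom X e)) (hcart j t \<otimes> (hcart t e \<bullet> [alg_action a]))"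
    using a algebra_iff[OF T] by (simp add: e_def t_def)
  have act: "hcart t e \<bullet> [alg_action a] \<in> el [hom j e] t e"
    using hcart_comp_in[OF te(1) G(6)] F M by simp
  have jt: "hcart j t \<in> el [hom j t] j t" using hcart(2)[OF M(6)] .
  have ex: "hcart t t \<bullet> [extension T] \<in> el [hom j t] t t"
    using hcart_comp_in[OF M(7) hom_transfD(6)[OF M(5)]] M by simp
  have i: "tid X A \<in> Tight X" "tcod X (tid X A) = tdom X t" using M by auto
  have d0: "d \<in> el ps j (t \<cdot> tid X A)" using d M by (simp add: t_def)
  let ?F = "fac j t (tid X A) (tid X A) d" and ?F' = "fac j e (tid X A) b d'"
  note f = hom_transf_fac[OF M(5) i d0]
  note f' = hom_transf_fac[OF F(3) b[folded e_def] d'[folded e_def]]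
  note D = cellsD[OF f(1)] cellsD[OF f'(1)]
  have ie: "tid X (tdom X e) \<in> Tight X" "tcod X (tid X (tdom X e)) = tdom X e" using F by auto
  have ap': "paste X (hcart t e \<bullet> [alg_action a]) (tid X A) [?F'] = act T a b d'"
    using ap_alt[OF F(3) b[folded e_def] d'[folded e_def]] by (simp add: act_def t_def e_def)
  have 1: "paste X ((hcart t t \<bullet> [extension T]) \<otimes> (hcart t e \<bullet> [alg_action a])) (tid X A) ([?F] @ [?F']) =
    paste X (hcart t t \<bullet> [extension T]) (tid X A) [?F] \<otimes> paste X (hcart t e \<bullet> [alg_action a]) (tid X A) [?F']"
    by (rule mul_paste[OF ex act]) (use D M in \<open>auto simp: t_def\<close>)
  have 2: "paste X (hcart t t \<bullet> [extension T]) (tid X A) [?F] = ext T d"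
    using ap_alt[OF M(5) i d0] by (simp add: ext_def t_def)
  have 3: "paste X (hcart j t \<otimes> (hcart t e \<bullet> [alg_action a])) (tid X A) ([?F] @ [?F']) =
    paste X (hcart j t) (tid X A) [?F] \<otimes> paste X (hcart t e \<bullet> [alg_action a]) (tid X A) [?F']"
    by (rule mul_paste[OF jt act]) (use D M in \<open>auto simp: t_def\<close>)
  have 4: "paste X (hcart j t) (tid X A) [?F] = d" using f(2) D by (simp add: comp2_def)
  have m: "hcart j t \<otimes> (hcart t e \<bullet> [alg_action a]) \<in> el ([hom j t] @ [hom j e]) j (e \<cdot> tid X (tdom X e))"
    using mul_in[OF jt act] M F by simp
  have cp: "cell_path X (tid X A) ([?F] @ [?F']) b" using D M by auto
  have mc: "map (ccod X) ([?F] @ [?F']) = [hom j t] @ [hom j e]" using D by auto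
  have "paste X (act T a (tid X (tdom X e)) (hcart j t \<otimes> (hcart t e \<bullet> [alg_action a]))) (tid X A) ([?F] @ [?F'])
     = act T a (tid X (tdom X e) \<cdot> b) (paste X (hcart j t \<otimes> (hcart t e \<bullet> [alg_action a])) (tid X A) ([?F] @ [?F']))"
    using ap_paste[OF F(3) ie m cp mc] by (simp add: act_def e_def t_def)
  with 1 2 3 4 ap' U b show ?thesis by (simp add: e_def)
qed

lemma free_algebra: "relative_monad j T \<Longrightarrow> algebra j T (free_alg T)"
  using j by (auto simp: relative_monad_def algebra_def free_alg_def Let_def)

lemma ext_in:
  assumes T: "relative_monad j T" and d: "d \<in> el ps j (carrier T)"
  shows "ext T d \<in> el ps (carrier T) (carrier T)"
  using ap_tid_in[OF rm_frame(5)[OF T] d] rm_frame[OF T] by (simp add: ext_def)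

text \<open>Axiom (ii). \<open>frown j\<close> has element \<open>one j\<close>, so E(j,\<eta>)
  sends it to \<open>one j \<otimes> eta T\<close>, which is \<open>eta T\<close>; the extension of
  this is the element of \<open>frown (carrier T)\<close>.\<close>

lemma ext_eta:
  assumes T: "relative_monad j T"
  shows "ext T (eta T) = one (carrier T)"
proof -
  define t where "t = carrier T"
  note M = rm_frame[OF T, folded t_def]
  have jj: "parallel j j" using j by (simp add: parallel_def)
  note P = hom_post[OF M(4) jj M(6)]
  have f: "frown j \<in> cells [] (hom j j) (tid X A) (tid X A)" using frown(1)[OF j] globular_hom[OF jj] by simp
  note h = hom_transf_comp_in[OF P(1) f]
  have o: "one j \<in> el [] j j" using one_in[OF j] .
  have "hcart j t \<bullet> [hom_post j j t (unit T) \<bullet> [frown j]] = ap j j j t (hom_post j j t (unit T)) (tid X A) (one j)"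
    using ap_hcart_comp[OF P(1) f] frown(2)[OF j] by simp
  also have "\<dots> = eta T"
    using P(3)[OF o] one_mul[OF eta_in[OF T]] j by (simp add: eta_def t_def)
  finally have "ext T (eta T) = hcart t t \<bullet> [extension T \<bullet> [hom_post j j t (unit T) \<bullet> [frown j]]]"
    using ap_hcart_comp[OF M(5) h] by (simp add: ext_def t_def)
  also have "extension T \<bullet> [hom_post j j t (unit T) \<bullet> [frown j]] = frown t"
    using T by (simp add: relative_monad_def Let_def t_def)
  also have "hcart t t \<bullet> [frown t] = one t" using frown(2)[OF M(1)] .
  finally show ?thesis by (simp add: t_def)
qed

section \<open>Monad morphisms as elements\<close>

definition mor :: "('t, 'c) rmnd_data \<Rightarrow> ('t, 'c) rmnd_data \<Rightarrow> 'c \<Rightarrow> 'c" where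
  "mor T T' \<tau> = hcart (carrier T) (carrier T') \<bullet> [\<tau>]"

text \<open>Compatibility with the extensions, evaluated at the generic element
  \<open>hcart j t\<close>: E(t,\<tau>) multiplies on the right, E(\<tau>,t') on the left, and
  E(j,\<tau>) multiplies the argument of \<open>ext T'\<close>.\<close>

lemma monad_morphism_iff:
  assumes T: "relative_monad j T" and T': "relative_monad j T'"
  defines "t \<equiv> carrier T" and "t' \<equiv> carrier T'"
  shows "monad_morphism j T T' \<tau> \<longleftrightarrow> \<tau> \<in> two_cells t t' \<and> eta T \<otimes> mor T T' \<tau> = eta T' \<and>
    (hcart t t \<bullet> [extension T]) \<otimes> mor T T' \<tau> = mor T T' \<tau> \<otimes> ext T' (hcart j t \<otimes> mor T T' \<tau>)"
proof -
  note M = rm_frame[OF T, folded t_def] and M' = rm_frame[OF T', folded t'_def]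
  have tt': "parallel t t'" using M M' by (simp add: parallel_def)
  have "vcomp j t t' \<tau> (unit T) = unit T' \<longleftrightarrow> eta T \<otimes> mor T T' \<tau> = eta T'"
    "hom_post t t t' \<tau> \<bullet> [extension T] = hom_pre t t' \<tau> t' \<bullet> [extension T' \<bullet> [hom_post j t t' \<tau>]] \<longleftrightarrow>
     (hcart t t \<bullet> [extension T]) \<otimes> mor T T' \<tau> = mor T T' \<tau> \<otimes> ext T' (hcart j t \<otimes> mor T T' \<tau>)"
    if ta: "\<tau> \<in> two_cells t t'"
  proof -
    note ta1 = ta[unfolded two_cells_def] note ta2 = ta1[unfolded globular_hom[OF tt']]
    have ta3: "\<tau> \<in> cells [] (hom t t') (tid X A) (tid X A)" using ta2 M M' by simp
    have m: "mor T T' \<tau> \<in> el [] t t'" using hcart_globular_in[OF tt' ta1] M by (simp add: mor_def t_def t'_def)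
    have u: "unit T \<in> cells [] (hom j t) (tid X A) (tid X A)" using M(4) M by (simp add: globular_hom)
    note s = smile_comp[OF M(6) tt' u ta3]
    have s1: "smile j t t' \<bullet> [unit T, \<tau>] \<in> globular [] (hom j t')" using s(1) M' by (simp add: globular_hom)
    show "vcomp j t t' \<tau> (unit T) = unit T' \<longleftrightarrow> eta T \<otimes> mor T T' \<tau> = eta T'"
      using hcart_cancel_globular[OF M'(6) s1 M'(4)] s(2) 
      by (auto simp: vcomp_def eta_def mor_def t_def t'_def)
    note Q = hom_post[OF ta1 M(7) tt'] and R = hom_post[OF ta1 M(6) tt'] and P = hom_pre[OF ta1 tt' M'(7)]
    note C1 = hom_transf_comp[OF M(5) Q(1)] note C2 = hom_transf_comp[OF R(1) M'(5)]
    note C3 = hom_transf_comp[OF C2(1) P(1)]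
    have jt: "hcart j t \<in> el [hom j t] j t" using hcart(2)[OF M(6)] .
    have dt: "tdom X t = A" "tdom X t' = A" using M M' by auto
    have i: "tid X A \<in> Tight X" "tcod X (tid X A) = tdom X t" "tcod X (tid X A) = tdom X t'" using M M' by auto
    have jt1: "hcart j t \<in> el [hom j t] j (t \<cdot> tid X A)" using jt M by simp
    have ex: "hcart t t \<bullet> [extension T] \<in> el [hom j t] t t"
      using hcart_comp_in[OF M(7) hom_transfD(6)[OF M(5)]] M by simp
    have 1: "hcart t t' \<bullet> [hom_post t t t' \<tau> \<bullet> [extension T]] = (hcart t t \<bullet> [extension T]) \<otimes> mor T T' \<tau>"
      using ap_hcart[OF C1(1)] C1(2)[OF i(1,2) jt1] ap_hcart[OF M(5)] Q(3)[of "hcart t t \<bullet> [extension T]"] ex dt M(3)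
      by (simp add: mor_def t_def[symmetric] t'_def[symmetric])
    have m2: "hcart j t \<otimes> mor T T' \<tau> \<in> el [hom j t] j t'" using mul_in[OF jt m] M by simp
    have e2: "ext T' (hcart j t \<otimes> mor T T' \<tau>) \<in> el [hom j t] t' t'"
      using ext_in[OF T' m2[unfolded t'_def]] by (simp add: t'_def)
    have "hcart t t' \<bullet> [hom_pre t t' \<tau> t' \<bullet> [extension T' \<bullet> [hom_post j t t' \<tau>]]] = 
       ap t' t' t t' (hom_pre t t' \<tau> t') (tid X A) (ap j t t' t' (extension T' \<bullet> [hom_post j t t' \<tau>]) (tid X A) (hcart j t))"
      using ap_hcart[OF C3(1)] C3(2)[OF i(1,2) jt1] dt by simp
    also have "ap j t t' t' (extension T' \<bullet> [hom_post j t t' \<tau>]) (tid X A) (hcart j t) = 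
       ext T' (hcart j t \<otimes> mor T T' \<tau>)"
      using C2(2)[OF i(1,2) jt1] R(3)[OF jt] dt by (simp add: mor_def ext_def t_def t'_def)
    also have "ap t' t' t t' (hom_pre t t' \<tau> t') (tid X A) (ext T' (hcart j t \<otimes> mor T T' \<tau>)) = mor T T' \<tau> \<otimes> ext T' (hcart j t \<otimes> mor T T' \<tau>)"
      using P(3)[OF i(1,3), of "ext T' (hcart j t \<otimes> mor T T' \<tau>)" "[hom j t]"] e2 M' by (simp add: mor_def t_def t'_def)
    finally have 2: "hcart t t' \<bullet> [hom_pre t t' \<tau> t' \<bullet> [extension T' \<bullet> [hom_post j t t' \<tau>]]] = mor T T' \<tau> \<otimes> ext T' (hcart j t \<otimes> mor T T' \<tau>)" .
    show "hom_post t t t' \<tau> \<bullet> [extension T] = hom_pre t t' \<tau> t' \<bullet> [extension T' \<bullet> [hom_post j t t' \<tau>]] \<longleftrightarrow>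
     (hcart t t \<bullet> [extension T]) \<otimes> mor T T' \<tau> = mor T T' \<tau> \<otimes> ext T' (hcart j t \<otimes> mor T T' \<tau>)"
      using hom_transf_eqI[OF C1(1) C3(1)] 1 2 by auto
  qed
  then show ?thesis unfolding monad_morphism_def Let_def t_def t'_def by blast
qed


text \<open>Converse to \<open>eta_act\<close> and \<open>ext_act\<close>: the laws for all elements
  include those for the generic ones.\<close>

lemma algebraI:
  assumes T: "relative_monad j T" and a: "alg_frame T a"
    and 1: "\<And>ps d. d \<in> el ps j (alg_carrier a) \<Longrightarrow>
      eta T \<otimes> act T a (tid X (tdom X (alg_carrier a))) d = d"
    and 2: "\<And>ps qs d d'. \<lbrakk>d \<in> el ps j (carrier T); d' \<in> el qs j (alg_carrier a)\<rbrakk> \<Longrightarrow>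
      ext T d \<otimes> act T a (tid X (tdom X (alg_carrier a))) d' =
        act T a (tid X (tdom X (alg_carrier a))) (d \<otimes> act T a (tid X (tdom X (alg_carrier a))) d')"
  shows "algebra j T a"
proof -
  note M = rm_frame[OF T] note F = alg_frameD[OF a]
  have p: "parallel j (alg_carrier a)" using F j by (simp add: parallel_def)
  have "hcart (carrier T) (carrier T) \<bullet> [extension T] = ext T (hcart j (carrier T))"
    using ap_hcart[OF M(5)] M by (simp add: ext_def)
  moreover have "hcart (carrier T) (alg_carrier a) \<bullet> [alg_action a] = act T a (tid X (tdom X (alg_carrier a))) (hcart j (alg_carrier a))"
    using ap_hcart[OF F(3)] by (simp add: act_def)
  ultimately show ?thesis
    unfolding algebra_iff[OF T] using a 1[OF hcart(2)[OF p]] 2[OF hcart(2)[OF M(6)] hcart(2)[OF p]] by simp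
qed

lemma mor_in:
  assumes T: "relative_monad j T" and T': "relative_monad j T'" and \<tau>: "\<tau> \<in> two_cells (carrier T) (carrier T')"
  shows "mor T T' \<tau> \<in> el [] (carrier T) (carrier T')"
proof -
  have "parallel (carrier T) (carrier T')" using rm_frame[OF T] rm_frame[OF T'] by (simp add: parallel_def)
  from hcart_globular_in[OF this \<tau>[unfolded two_cells_def]] show ?thesis
    using rm_frame(3)[OF T] by (simp add: mor_def)
qed

lemma mor_inj:
  assumes T: "relative_monad j T" and T': "relative_monad j T'"
    and "\<tau> \<in> two_cells (carrier T) (carrier T')" "\<sigma> \<in> two_cells (carrier T) (carrier T')"
    and "mor T T' \<tau> = mor T T' \<sigma>"
  shows "\<tau> = \<sigma>"
proof -
  have "parallel (carrier T) (carrier T')" using rm_frame[OF T] rm_frame[OF T'] by (simp add: parallel_def)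
  from hcart_cancel_globular[OF this] show ?thesis using assms by (auto simp: two_cells_def mor_def)
qed

lemma mor_surj:
  assumes T: "relative_monad j T" and T': "relative_monad j T'" and m: "m \<in> el [] (carrier T) (carrier T')"
  obtains \<tau> where "\<tau> \<in> two_cells (carrier T) (carrier T')" "mor T T' \<tau> = m"
proof -
  have p: "parallel (carrier T) (carrier T')" using rm_frame[OF T] rm_frame[OF T'] by (simp add: parallel_def)
  have m': "m \<in> cells [] (lid (tcod X (carrier T))) (carrier T) (carrier T')" using m rm_frame(3)[OF T] by simp
  show thesis
    using that[of "into_hom (carrier T) (carrier T') m"] into_hom[OF p m'] globular_hom[OF p]
    by (simp add: two_cells_def mor_def)
qed

text \<open>The last claim extends the generic equation to \<open>d\<close> by pasting its
  factorisation. The factors \<open>mor T T' \<tau>\<close> are nullary and remain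
  unchanged.\<close>

lemma monad_morphismD:
  assumes T: "relative_monad j T" and T': "relative_monad j T'" and m: "monad_morphism j T T' \<tau>"
  shows "\<tau> \<in> two_cells (carrier T) (carrier T')" "eta T \<otimes> mor T T' \<tau> = eta T'"
    and "d \<in> el ps j (carrier T) \<Longrightarrow> ext T d \<otimes> mor T T' \<tau> = mor T T' \<tau> \<otimes> ext T' (d \<otimes> mor T T' \<tau>)"
proof -
  define t t' m where "t = carrier T" and "t' = carrier T'" and "m = mor T T' \<tau>"
  note M = rm_frame[OF T, folded t_def] and M' = rm_frame[OF T', folded t'_def]
  have *: "\<tau> \<in> two_cells t t'" "eta T \<otimes> m = eta T'" "(hcart t t \<bullet> [extension T]) \<otimes> m = m \<otimes> ext T' (hcart j t \<otimes> m)"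
    using assms(3) monad_morphism_iff[OF T T'] by (simp_all add: t_def t'_def m_def)
  then show "\<tau> \<in> two_cells (carrier T) (carrier T')" "eta T \<otimes> mor T T' \<tau> = eta T'" by (simp_all add: t_def t'_def m_def)
  assume "d \<in> el ps j (carrier T)"
  then have d: "d \<in> el ps j t" by (simp add: t_def)
  have m: "m \<in> el [] t t'" using mor_in[OF T T'] * by (simp add: t_def t'_def m_def)
  have i: "tid X A \<in> Tight X" "tcod X (tid X A) = tdom X t" "tcod X (tid X A) = tdom X t'" using M M' by auto
  have d0: "d \<in> el ps j (t \<cdot> tid X A)" using d M by simp
  let ?F = "fac j t (tid X A) (tid X A) d"
  note f = hom_transf_fac[OF M(5) i(1,2) d0] note D = cellsD[OF f(1)]
  have jt: "hcart j t \<in> el [hom j t] j t" using hcart(2)[OF M(6)] .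
  have ex: "hcart t t \<bullet> [extension T] \<in> el [hom j t] t t"
    using hcart_comp_in[OF M(7) hom_transfD(6)[OF M(5)]] M by simp
  have jm: "hcart j t \<otimes> m \<in> el [hom j t] j t'" using mul_in[OF jt m] M by simp
  have jm': "hcart j t \<otimes> m \<in> el [hom j t] j (t' \<cdot> tid X A)" using jm M' by simp
  have e2: "ext T' (hcart j t \<otimes> m) \<in> el [hom j t] t' t'"
    using ext_in[OF T' jm[unfolded t'_def]] by (simp add: t'_def)
  have m0: "paste X m (tid X A) [] = m" using paste_tid[OF m] M by simp
  have p: "cell_path X (tid X A) [?F] (tid X A)" "map (ccod X) [?F] = [hom j t]" using D by auto
  have "paste X ((hcart t t \<bullet> [extension T]) \<otimes> m) (tid X A) ([?F] @ []) = 
     paste X (hcart t t \<bullet> [extension T]) (tid X A) [?F] \<otimes> paste X m (tid X A) []"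
    by (rule mul_paste[OF ex m]) (use D M in auto)
  also have "\<dots> = ext T d \<otimes> m"
    using ap_alt[OF M(5) i(1,2) d0] m0 by (simp add: ext_def t_def)
  finally have 1: "paste X ((hcart t t \<bullet> [extension T]) \<otimes> m) (tid X A) [?F] = ext T d \<otimes> m" by simp
  have "paste X (m \<otimes> ext T' (hcart j t \<otimes> m)) (tid X A) ([] @ [?F]) =
     paste X m (tid X A) [] \<otimes> paste X (ext T' (hcart j t \<otimes> m)) (tid X A) [?F]"
    by (rule mul_paste[OF m e2]) (use D M M' in auto)
  also have "paste X (ext T' (hcart j t \<otimes> m)) (tid X A) [?F] = ext T' (paste X (hcart j t \<otimes> m) (tid X A) [?F])"
    using ap_paste[OF M'(5) i(1,3) jm' p] i by (simp add: ext_def t'_def)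
  also have "paste X (hcart j t \<otimes> m) (tid X A) [?F] = paste X (hcart j t \<otimes> m) (tid X A) ([?F] @ [])" by simp
  also have "\<dots> = paste X (hcart j t) (tid X A) [?F] \<otimes> paste X m (tid X A) []"
    by (rule mul_paste[OF jt m]) (use D M in auto)
  also have "\<dots> = d \<otimes> m" using f(2) D m0 by (simp add: comp2_def)
  finally have "paste X (m \<otimes> ext T' (hcart j t \<otimes> m)) (tid X A) [?F] = m \<otimes> ext T' (d \<otimes> m)"
    using m0 by simp
  with 1 *(3) show "ext T d \<otimes> mor T T' \<tau> = mor T T' \<tau> \<otimes> ext T' (d \<otimes> mor T T' \<tau>)" by (simp add: m_def)
qed

lemma monad_morphismI:
  assumes T: "relative_monad j T" and T': "relative_monad j T'"
    and \<tau>: "\<tau> \<in> two_cells (carrier T) (carrier T')" and 1: "eta T \<otimes> mor T T' \<tau> = eta T'"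
    and 2: "\<And>ps d. d \<in> el ps j (carrier T) \<Longrightarrow> ext T d \<otimes> mor T T' \<tau> = mor T T' \<tau> \<otimes> ext T' (d \<otimes> mor T T' \<tau>)"
  shows "monad_morphism j T T' \<tau>"
proof -
  note M = rm_frame[OF T]
  have "hcart (carrier T) (carrier T) \<bullet> [extension T] = ext T (hcart j (carrier T))"
    using ap_hcart[OF M(5)] M by (simp add: ext_def)
  then show ?thesis unfolding monad_morphism_iff[OF T T'] using \<tau> 1 2[OF hcart(2)[OF M(6)]] by simp
qed

section \<open>Composition of monad morphisms; the categories RMnd(j) and X/E\<close>

lemma mor_frown:
  assumes T: "relative_monad j T"
  shows "frown (carrier T) \<in> two_cells (carrier T) (carrier T)" "mor T T (frown (carrier T)) = one (carrier T)"
  using frown[OF rm_frame(1)[OF T]] by (simp_all add: two_cells_def mor_def)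

text \<open>The order of the factors is reversed because \<otimes> composes from left to
  right.\<close>

lemma mor_vcomp:
  assumes T: "relative_monad j T" and T': "relative_monad j T'" and T'': "relative_monad j T''"
    and \<tau>: "\<tau> \<in> two_cells (carrier T) (carrier T')" and \<sigma>: "\<sigma> \<in> two_cells (carrier T') (carrier T'')"
  shows "vcomp (carrier T) (carrier T') (carrier T'') \<sigma> \<tau> \<in> two_cells (carrier T) (carrier T'')"
    and "mor T T'' (vcomp (carrier T) (carrier T') (carrier T'') \<sigma> \<tau>) = mor T T' \<tau> \<otimes> mor T' T'' \<sigma>"
proof -
  note M = rm_frame[OF T] rm_frame[OF T'] rm_frame[OF T'']
  have p: "parallel (carrier T) (carrier T')" "parallel (carrier T') (carrier T'')" "parallel (carrier T) (carrier T'')"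
    using M by (auto simp: parallel_def)
  have c: "\<tau> \<in> cells [] (hom (carrier T) (carrier T')) (tid X A) (tid X A)"
     "\<sigma> \<in> cells [] (hom (carrier T') (carrier T'')) (tid X A) (tid X A)"
    using \<tau> \<sigma> p M by (simp_all add: two_cells_def globular_hom)
  show "vcomp (carrier T) (carrier T') (carrier T'') \<sigma> \<tau> \<in> two_cells (carrier T) (carrier T'')"
    and "mor T T'' (vcomp (carrier T) (carrier T') (carrier T'') \<sigma> \<tau>) = mor T T' \<tau> \<otimes> mor T' T'' \<sigma>"
    using smile_comp[OF p(1,2) c] M p by (simp_all add: two_cells_def globular_hom vcomp_def mor_def)
qed

lemma monad_morphism_id:
  assumes T: "relative_monad j T"
  shows "monad_morphism j T T (frown (carrier T))"
proof (rule monad_morphismI[OF T T mor_frown(1)[OF T]])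
  note e = mor_frown(2)[OF T]
  show "eta T \<otimes> mor T T (frown (carrier T)) = eta T" using mul_one[OF eta_in[OF T]] e by simp
  fix ps d assume d: "d \<in> el ps j (carrier T)"
  show "ext T d \<otimes> mor T T (frown (carrier T)) = mor T T (frown (carrier T)) \<otimes> ext T (d \<otimes> mor T T (frown (carrier T)))"
    using mul_one[OF ext_in[OF T d]] one_mul[OF ext_in[OF T d]] mul_one[OF d] e rm_frame(3)[OF T] by simp
qed

lemma monad_morphism_vcomp:
  assumes T: "relative_monad j T" and T': "relative_monad j T'" and T'': "relative_monad j T''"
    and \<tau>: "monad_morphism j T T' \<tau>" and \<sigma>: "monad_morphism j T' T'' \<sigma>"
  shows "monad_morphism j T T'' (vcomp (carrier T) (carrier T') (carrier T'') \<sigma> \<tau>)"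
proof -
  note M = rm_frame[OF T] rm_frame[OF T'] rm_frame[OF T'']
  note t = monad_morphismD[OF T T' \<tau>] and s = monad_morphismD[OF T' T'' \<sigma>]
  note c = mor_vcomp[OF T T' T'' t(1) s(1)]
  note mt = mor_in[OF T T' t(1)] and ms = mor_in[OF T' T'' s(1)]
  show ?thesis
  proof (rule monad_morphismI[OF T T'' c(1)], unfold c(2))
    show "eta T \<otimes> mor T T' \<tau> \<otimes> mor T' T'' \<sigma> = eta T''"
      using mul_assoc[OF eta_in[OF T] mt ms] M t(2) s(2) by simp
    fix ps d assume d: "d \<in> el ps j (carrier T)"
    have dt: "d \<otimes> mor T T' \<tau> \<in> el ps j (carrier T')" using mul_in[OF d mt] M by simp
    have dts: "(d \<otimes> mor T T' \<tau>) \<otimes> mor T' T'' \<sigma> \<in> el ps j (carrier T'')" using mul_in[OF dt ms] M by simp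
    have "ext T d \<otimes> mor T T' \<tau> \<otimes> mor T' T'' \<sigma> = (ext T d \<otimes> mor T T' \<tau>) \<otimes> mor T' T'' \<sigma>"
      using mul_assoc[OF ext_in[OF T d] mt ms] M by simp
    also have "\<dots> = (mor T T' \<tau> \<otimes> ext T' (d \<otimes> mor T T' \<tau>)) \<otimes> mor T' T'' \<sigma>" using t(3)[OF d] by simp
    also have "\<dots> = mor T T' \<tau> \<otimes> (ext T' (d \<otimes> mor T T' \<tau>) \<otimes> mor T' T'' \<sigma>)"
      using mul_assoc[OF mt ext_in[OF T' dt] ms] M by simp
    also have "\<dots> = mor T T' \<tau> \<otimes> (mor T' T'' \<sigma> \<otimes> ext T'' ((d \<otimes> mor T T' \<tau>) \<otimes> mor T' T'' \<sigma>))"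
      using s(3)[OF dt] by simp
    also have "\<dots> = (mor T T' \<tau> \<otimes> mor T' T'' \<sigma>) \<otimes> ext T'' ((d \<otimes> mor T T' \<tau>) \<otimes> mor T' T'' \<sigma>)"
      using mul_assoc[OF mt ms ext_in[OF T'' dts]] M by simp
    also have "(d \<otimes> mor T T' \<tau>) \<otimes> mor T' T'' \<sigma> = d \<otimes> mor T T' \<tau> \<otimes> mor T' T'' \<sigma>"
      using mul_assoc[OF d mt ms] M by simp
    finally show "ext T d \<otimes> mor T T' \<tau> \<otimes> mor T' T'' \<sigma> =
      (mor T T' \<tau> \<otimes> mor T' T'' \<sigma>) \<otimes> ext T'' (d \<otimes> mor T T' \<tau> \<otimes> mor T' T'' \<sigma>)" .
  qed
qed

text \<open>\<open>mor\<close> is injective and takes \<open>vcomp\<close> to \<otimes> and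
  \<open>frown\<close> to \<open>one\<close>, so the category laws are the unit and associativity
  laws of \<otimes>.\<close>

lemma RMnd_category: "category (RMnd j)"
proof
  fix a assume "a \<in> cat_ob (RMnd j)"
  then show "cat_id (RMnd j) a \<in> cat_hom (RMnd j) a a"
    using monad_morphism_id by (simp add: RMnd_def)
next
  fix a b c f g
  assume "a \<in> cat_ob (RMnd j)" "b \<in> cat_ob (RMnd j)" "c \<in> cat_ob (RMnd j)"
    "f \<in> cat_hom (RMnd j) a b" "g \<in> cat_hom (RMnd j) b c"
  then show "cat_comp (RMnd j) a b c g f \<in> cat_hom (RMnd j) a c"
    using monad_morphism_vcomp by (simp add: RMnd_def)
next
  fix a b f
  assume "a \<in> cat_ob (RMnd j)" "b \<in> cat_ob (RMnd j)" "f \<in> cat_hom (RMnd j) a b"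
  then have a: "relative_monad j a" and b: "relative_monad j b" and f: "monad_morphism j a b f"
    by (auto simp: RMnd_def)
  note M = rm_frame[OF a] rm_frame[OF b]
  note F = monad_morphismD[OF a b f] note m = mor_in[OF a b F(1)]
  note l = mor_vcomp[OF a b b F(1) mor_frown(1)[OF b]] and r = mor_vcomp[OF a a b mor_frown(1)[OF a] F(1)]
  show "cat_comp (RMnd j) a b b (cat_id (RMnd j) b) f = f"
    using mor_inj[OF a b l(1) F(1)] l(2) mor_frown(2)[OF b] mul_one[OF m] by (simp add: RMnd_def)
  show "cat_comp (RMnd j) a a b f (cat_id (RMnd j) a) = f"
    using mor_inj[OF a b r(1) F(1)] r(2) mor_frown(2)[OF a] one_mul[OF m] M by (simp add: RMnd_def)
next
  fix a b c d f g h
  assume "a \<in> cat_ob (RMnd j)" "b \<in> cat_ob (RMnd j)" "c \<in> cat_ob (RMnd j)" "d \<in> cat_ob (RMnd j)"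
    "f \<in> cat_hom (RMnd j) a b" "g \<in> cat_hom (RMnd j) b c" "h \<in> cat_hom (RMnd j) c d"
  then have a: "relative_monad j a" and b: "relative_monad j b" and c: "relative_monad j c" and d: "relative_monad j d"
    and f: "monad_morphism j a b f" and g: "monad_morphism j b c g" and h: "monad_morphism j c d h"
    by (auto simp: RMnd_def)
  note M = rm_frame[OF a] rm_frame[OF b]
  note f = monad_morphismD(1)[OF a b f] and g = monad_morphismD(1)[OF b c g] and h = monad_morphismD(1)[OF c d h]
  note gf = mor_vcomp[OF a b c f g] and hg = mor_vcomp[OF b c d g h]
  note l = mor_vcomp[OF a c d gf(1) h] and r = mor_vcomp[OF a b d f hg(1)]
  show "cat_comp (RMnd j) a c d h (cat_comp (RMnd j) a b c g f) = cat_comp (RMnd j) a b d (cat_comp (RMnd j) b c d h g) f"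
    using mor_inj[OF a d l(1) r(1)] l(2) r(2) gf(2) hg(2)
      mul_assoc[OF mor_in[OF a b f] mor_in[OF b c g] mor_in[OF c d h]] M by (simp add: RMnd_def)
qed

lemma slice_category: "category (slice e)"
proof
  fix a b c d f g h
  assume "a \<in> cat_ob (slice e)" "b \<in> cat_ob (slice e)" "c \<in> cat_ob (slice e)" "d \<in> cat_ob (slice e)"
    "f \<in> cat_hom (slice e) a b" "g \<in> cat_hom (slice e) b c" "h \<in> cat_hom (slice e) c d"
  then show "cat_comp (slice e) a c d h (cat_comp (slice e) a b c g f) =
      cat_comp (slice e) a b d (cat_comp (slice e) b c d h g) f"
    using tcomp_assoc[of f g h] by (simp add: slice_def)
next
  fix a b c f g
  assume "a \<in> cat_ob (slice e)" "b \<in> cat_ob (slice e)" "c \<in> cat_ob (slice e)"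
    "f \<in> cat_hom (slice e) a b" "g \<in> cat_hom (slice e) b c"
  then have *: "f \<in> Tight X" "tdom X f = tdom X a" "tcod X f = tdom X b" "b \<cdot> f = a"
      "g \<in> Tight X" "tdom X g = tdom X b" "tcod X g = tdom X c" "c \<cdot> g = b" "c \<in> Tight X"
    by (auto simp: slice_def)
  have "c \<cdot> (g \<cdot> f) = (c \<cdot> g) \<cdot> f"
    by (rule tcomp_assoc[symmetric]) (simp_all only: *)
  then have "c \<cdot> (g \<cdot> f) = a" by (simp only: *)
  moreover have "g \<cdot> f \<in> Tight X" "tdom X (g \<cdot> f) = tdom X a" "tcod X (g \<cdot> f) = tdom X c"
    using tcomp_tight[of f g] by (simp_all only: *)
  ultimately show "cat_comp (slice e) a b c g f \<in> cat_hom (slice e) a c"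
    by (simp add: slice_def)
qed (simp_all add: slice_def)

section \<open>Change of algebras along monad morphisms and along tight-cells\<close>

definition pullback_alg :: "('t, 'c) rmnd_data \<Rightarrow> ('t, 'c) rmnd_data \<Rightarrow> 'c \<Rightarrow> ('t, 'c) alg_data \<Rightarrow> ('t, 'c) alg_data" where
  "pullback_alg T T' \<tau> a = \<lparr>alg_carrier = alg_carrier a,
     alg_action = hom_pre (carrier T) (carrier T') \<tau> (alg_carrier a) \<bullet> [alg_action a]\<rparr>"

lemma pullback_alg_carrier [simp]: "alg_carrier (pullback_alg T T' \<tau> a) = alg_carrier a"
  by (simp add: pullback_alg_def)

text \<open>E(\<tau>,e) is left multiplication, hence pulling back along \<tau> multiplies the
  action by \<open>mor T T' \<tau>\<close>. The algebra \<open>pullback_alg\<close> is the one by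
  which \<open>u_mor\<close> is induced.\<close>

lemma pullback_alg_act:
  assumes T: "relative_monad j T" and T': "relative_monad j T'"
    and \<tau>: "\<tau> \<in> two_cells (carrier T) (carrier T')" and a: "alg_frame T' a"
  shows "alg_frame T (pullback_alg T T' \<tau> a)"
    and "\<lbrakk>b \<in> Tight X; tcod X b = tdom X (alg_carrier a); d \<in> el ps j (alg_carrier a \<cdot> b)\<rbrakk> \<Longrightarrow>
      act T (pullback_alg T T' \<tau> a) b d = mor T T' \<tau> \<otimes> act T' a b d"
proof -
  note M = rm_frame[OF T] rm_frame[OF T'] note F = alg_frameD[OF a]
  have p: "parallel (carrier T) (carrier T')" "parallel (carrier T') (alg_carrier a)"
    using M F by (auto simp: parallel_def)
  note P = hom_pre[OF \<tau>[unfolded two_cells_def] p]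
  note C = hom_transf_comp[OF F(3) P(1)]
  show "alg_frame T (pullback_alg T T' \<tau> a)"
    using C(1) F by (simp add: alg_frame_def pullback_alg_def)
  assume b: "b \<in> Tight X" "tcod X b = tdom X (alg_carrier a)" and d: "d \<in> el ps j (alg_carrier a \<cdot> b)"
  have "act T' a b d \<in> cells ps (lid (tcod X (carrier T'))) (carrier T') (alg_carrier a \<cdot> b)"
    using act_in[OF a b d] M by simp
  from P(3)[OF b this] show "act T (pullback_alg T T' \<tau> a) b d = mor T T' \<tau> \<otimes> act T' a b d"
    using C(2)[OF b d] by (simp add: act_def pullback_alg_def mor_def)
qed

lemma act_tid_in:
  assumes a: "alg_frame T a" and d: "d \<in> el ps j (alg_carrier a)"
  shows "act T a (tid X (tdom X (alg_carrier a))) d \<in> el ps (carrier T) (alg_carrier a)"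
  using ap_tid_in[OF alg_frameD(3)[OF a] d] by (simp add: act_def)

lemma tid_dom:
  assumes "a \<in> Tight X"
  shows "tid X (tdom X a) \<in> Tight X" "tcod X (tid X (tdom X a)) = tdom X a" "a \<cdot> tid X (tdom X a) = a"
  using assms by simp_all

text \<open>With actions written as products, the unit law follows from preservation of units, and
  associativity from moving \<open>mor T T' \<tau>\<close> across the two extensions.\<close>

lemma pullback_algebra:
  assumes T: "relative_monad j T" and T': "relative_monad j T'"
    and \<tau>: "monad_morphism j T T' \<tau>" and a: "algebra j T' a"
  shows "algebra j T (pullback_alg T T' \<tau> a)"
proof -
  note M = rm_frame[OF T] rm_frame[OF T']
  note t = monad_morphismD[OF T T' \<tau>]
  note mt = mor_in[OF T T' t(1)]
  note F' = algebra_frame[OF a T']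
  note F = alg_frameD[OF F']
  note P = pullback_alg_act[OF T T' t(1) F']
  define e where "e = alg_carrier a"
  define i where "i = tid X (tdom X e)"
  note F = F[folded e_def]
  have i: "i \<in> Tight X" "tcod X i = tdom X e" "e \<cdot> i = e" using tid_dom[OF F(1)] by (simp_all add: i_def)
  have act: "act T (pullback_alg T T' \<tau> a) i d = mor T T' \<tau> \<otimes> act T' a i d"
    and act_i: "act T' a i d \<in> el ps (carrier T') e" if "d \<in> el ps j e" for d ps
    using P(2)[of i d ps] act_in[OF F', of i d ps] i that by (simp_all add: e_def)
  show ?thesis
  proof (rule algebraI[OF T P(1)], unfold pullback_alg_carrier e_def[symmetric] i_def[symmetric])
    fix ps d assume d: "d \<in> el ps j e"
    have "eta T \<otimes> (mor T T' \<tau> \<otimes> act T' a i d) = (eta T \<otimes> mor T T' \<tau>) \<otimes> act T' a i d"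
      using mul_assoc[OF eta_in[OF T] mt act_i[OF d]] M by simp
    also have "\<dots> = d"
      using eta_act[OF T' a, of i d ps] d i t(2) by (simp add: e_def)
    finally show "eta T \<otimes> act T (pullback_alg T T' \<tau> a) i d = d" using act[OF d] by simp
  next
    fix ps qs d d' assume d: "d \<in> el ps j (carrier T)" and d': "d' \<in> el qs j e"
    have dt: "d \<otimes> mor T T' \<tau> \<in> el ps j (carrier T')" using mul_in[OF d mt] M by simp
    note a' = act_i[OF d']
    have ma: "mor T T' \<tau> \<otimes> act T' a i d' \<in> el qs (carrier T) e" using mul_in[OF mt a'] M by simp
    have da: "d \<otimes> (mor T T' \<tau> \<otimes> act T' a i d') \<in> el (ps @ qs) j e" using mul_in[OF d ma] M by simp
    have "ext T d \<otimes> (mor T T' \<tau> \<otimes> act T' a i d') = (ext T d \<otimes> mor T T' \<tau>) \<otimes> act T' a i d'"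
      using mul_assoc[OF ext_in[OF T d] mt a'] M by simp
    also have "\<dots> = (mor T T' \<tau> \<otimes> ext T' (d \<otimes> mor T T' \<tau>)) \<otimes> act T' a i d'" using t(3)[OF d] by simp
    also have "\<dots> = mor T T' \<tau> \<otimes> (ext T' (d \<otimes> mor T T' \<tau>) \<otimes> act T' a i d')"
      using mul_assoc[OF mt ext_in[OF T' dt] a'] M by simp
    also have "ext T' (d \<otimes> mor T T' \<tau>) \<otimes> act T' a i d' = act T' a i ((d \<otimes> mor T T' \<tau>) \<otimes> act T' a i d')"
      using ext_act[OF T' a _ _ dt, of i d' qs] i d' by (simp add: e_def)
    also have "(d \<otimes> mor T T' \<tau>) \<otimes> act T' a i d' = d \<otimes> (mor T T' \<tau> \<otimes> act T' a i d')"
      using mul_assoc[OF d mt a'] M by simp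
    finally show "ext T d \<otimes> act T (pullback_alg T T' \<tau> a) i d' =
      act T (pullback_alg T T' \<tau> a) i (d \<otimes> act T (pullback_alg T T' \<tau> a) i d')"
      using act[OF d'] act[OF da] by simp
  qed
qed

text \<open>From \<open>ap_restr_right\<close>: an algebra obtained from \<open>u\<close> along
  \<open>x\<close> acts as \<open>u\<close> does, with \<open>x\<close> prefixed to the tight-cell
  argument.\<close>

lemma mediates_act:
  assumes u: "alg_frame T u" and m: "mediates j T u a x"
    and b: "b \<in> Tight X" "tcod X b = tdom X (alg_carrier a)" and d: "d \<in> el ps j (alg_carrier a \<cdot> b)"
  shows "act T a b d = act T u (x \<cdot> b) d"
proof -
  note F = alg_frameD[OF u]
  have m: "x \<in> Tight X" "tdom X x = tdom X (alg_carrier a)" "tcod X x = tdom X (alg_carrier u)"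
    "alg_carrier u \<cdot> x = alg_carrier a"
    "restr_right j (alg_carrier u) (carrier T) (alg_carrier u) x (alg_action u) = alg_action a"
    using m by (auto simp: mediates_def)
  show ?thesis
    using ap_restr_right[OF F(3) m(1,3) b(1), of d ps] m b d by (simp add: act_def)
qed

text \<open>The required equality of actions is an equality of 2-cells into a restriction, so the
  hypothesis at the generic element gives it.\<close>

lemma mediatesI:
  assumes u: "alg_frame T u" and a: "alg_frame T a"
    and x: "x \<in> Tight X" "tdom X x = tdom X (alg_carrier a)" "tcod X x = tdom X (alg_carrier u)"
      "alg_carrier u \<cdot> x = alg_carrier a"
    and act: "\<And>ps d. d \<in> el ps j (alg_carrier a) \<Longrightarrow> act T u x d = act T a (tid X (tdom X (alg_carrier a))) d"
  shows "mediates j T u a x"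
proof -
  note F = alg_frameD[OF u] and F' = alg_frameD[OF a]
  note R = restr_right[OF F(3) x(1,3), unfolded x(4)]
  have p: "parallel j (alg_carrier a)" using F' j by (simp add: parallel_def)
  have "hcart (carrier T) (alg_carrier a) \<bullet> [alg_action a] = act T a (tid X (tdom X (alg_carrier a))) (hcart j (alg_carrier a))"
    using ap_hcart[OF F'(3)] by (simp add: act_def)
  also have "\<dots> = act T u x (hcart j (alg_carrier a))" using act[OF hcart(2)[OF p]] by simp
  finally have "restr_right j (alg_carrier u) (carrier T) (alg_carrier u) x (alg_action u) = alg_action a"
    using hom_transf_eqI[OF R(1) F'(3)] R(2) by (simp add: act_def)
  then show ?thesis using x by (simp add: mediates_def)
qed

definition restr_alg :: "('t, 'c) rmnd_data \<Rightarrow> ('t, 'c) alg_data \<Rightarrow> 't \<Rightarrow> ('t, 'c) alg_data" where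
  "restr_alg T u x = \<lparr>alg_carrier = alg_carrier u \<cdot> x,
    alg_action = restr_right j (alg_carrier u) (carrier T) (alg_carrier u) x (alg_action u)\<rparr>"

text \<open>Every tight-cell into the source of an algebra carries an algebra structure:
  \<open>eta_act\<close> and \<open>ext_act\<close> for \<open>u\<close>, taken at the tight-cell
  \<open>x\<close>, are its laws.\<close>

lemma restr_algebra:
  assumes T: "relative_monad j T" and u: "algebra j T u"
    and x: "x \<in> Tight X" "tcod X x = tdom X (alg_carrier u)"
  shows "algebra j T (restr_alg T u x)" "mediates j T u (restr_alg T u x) x"
proof -
  note fu = algebra_frame[OF u T]
  note F = alg_frameD[OF fu]
  note R = restr_right[OF F(3) x]
  define a where "a = restr_alg T u x"
  have ca: "alg_carrier a = alg_carrier u \<cdot> x" by (simp add: a_def restr_alg_def)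
  have fa: "alg_frame T a" using R(1) F x by (simp add: alg_frame_def a_def restr_alg_def)
  show m: "mediates j T u (restr_alg T u x) x" using x F by (simp add: mediates_def restr_alg_def)
  note A = mediates_act[OF fu m, folded a_def]
  note fa' = alg_frameD(1)[OF fa]
  note i = tid_dom[OF fa']
  have xi: "x \<cdot> tid X (tdom X (alg_carrier a)) = x" using ca x F by simp
  have act: "act T a (tid X (tdom X (alg_carrier a))) d = act T u x d" if "d \<in> el ps j (alg_carrier a)" for d ps
    using A[OF i(1,2), of d ps] that xi i(3) by simp
  show "algebra j T (restr_alg T u x)" unfolding a_def[symmetric]
  proof (rule algebraI[OF T fa])
    fix ps d assume d: "d \<in> el ps j (alg_carrier a)"
    show "eta T \<otimes> act T a (tid X (tdom X (alg_carrier a))) d = d"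
      using eta_act[OF T u x, of d ps] d act[OF d] ca by simp
  next
    fix ps qs d d' assume d: "d \<in> el ps j (carrier T)" and d': "d' \<in> el qs j (alg_carrier a)"
    have "act T a (tid X (tdom X (alg_carrier a))) d' \<in> el qs (carrier T) (alg_carrier a)"
      by (rule act_tid_in[OF fa d'])
    then have "d \<otimes> act T a (tid X (tdom X (alg_carrier a))) d' \<in> el (ps @ qs) j (alg_carrier a)"
      using mul_in[OF d] rm_frame[OF T] by simp
    from act[OF this] act[OF d'] show "ext T d \<otimes> act T a (tid X (tdom X (alg_carrier a))) d' =
        act T a (tid X (tdom X (alg_carrier a))) (d \<otimes> act T a (tid X (tdom X (alg_carrier a))) d')"
      using ext_act[OF T u x d, of d' qs] d' ca by simp
  qed
qed

lemma mediating_eq: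
  assumes "algebra_object j T u" "algebra j T a" "mediates j T u a x"
  shows "mediating j T u a = x"
proof -
  have "\<exists>!x. mediates j T u a x" using assms(1,2) by (auto simp: algebra_object_def)
  then show ?thesis unfolding mediating_def using assms(3) by (rule the1_equality)
qed

lemma mediating:
  assumes "algebra_object j T u" "algebra j T a"
  shows "mediates j T u a (mediating j T u a)"
proof -
  have "\<exists>!x. mediates j T u a x" using assms(1,2) by (auto simp: algebra_object_def)
  then show ?thesis unfolding mediating_def by (rule theI')
qed


section \<open>Transposition along an algebra object\<close>

text \<open>The 2-cell \<lambda> in elements: act on the product of the generic elements of E(j,1)
  and E(1,e), then multiply by that of E(1,t).\<close>

lemma action_cell:
  assumes T: "relative_monad j T" and a: "alg_frame T a"
  defines "I \<equiv> tid X E" and "t \<equiv> carrier T" and "e \<equiv> alg_carrier a"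
  shows "action_cell j T a \<in> globular [hom I t, hom j I, hom I e] (hom I e)"
    and "hcart I e \<bullet> [action_cell j T a] = hcart I t \<otimes> act T a (tid X (tdom X e)) (hcart j I \<otimes> hcart I e)"
proof -
  note M = rm_frame[OF T, folded t_def] note F = alg_frameD[OF a, folded e_def t_def]
  have I: "I \<in> Tight X" "tcod X I = E" "tdom X I = E" by (simp_all add: I_def)
  have p: "parallel I t" "parallel j I" "parallel I e" "parallel t e" "parallel j e"
    using M F I j by (auto simp: parallel_def)
  have ci: "cid X (hom I t) \<in> cells [hom I t] (hom I t) I (tid X A)"
    using cid_in[of "hom I t"] p I M by (simp add: I_def)
  note s = smile[OF p(2,3)]
  note s1 = s(1)[unfolded globular_hom[OF p(5)]]
  note G = hom_transf_comp_in[OF F(3) s1]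
  note S = smile_comp[OF p(1,4) ci G]
  show "action_cell j T a \<in> globular [hom I t, hom j I, hom I e] (hom I e)"
    using S(1) p I by (simp add: action_cell_def Let_def I_def t_def e_def globular_hom)
  show "hcart I e \<bullet> [action_cell j T a] = hcart I t \<otimes> act T a (tid X (tdom X e)) (hcart j I \<otimes> hcart I e)"
    using S(2) s(2) ap_hcart_comp[OF F(3) s1] hcart_cid[OF p(1)]
    by (simp add: action_cell_def Let_def I_def t_def e_def act_def)
qed

lemma free_frame:
  "relative_monad j T \<Longrightarrow> alg_frame T (free_alg T)" "alg_carrier (free_alg T) = carrier T"
  using algebra_frame free_algebra by (auto simp: free_alg_def)

text \<open>The action of \<open>u\<close>, with E(1,t) put in front, has domain E(1,t), E(j,v). As
  \<open>t\<close> carries the free algebra, this is the shape of a morphism from the free algebra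
  to \<open>u\<close> graded by E(j,v). The condition on graded morphisms is then the associativity
  law of the action.\<close>

lemma action_graded_morphism:
  assumes T: "relative_monad j T" and u: "algebra j T u"
  defines "I \<equiv> tid X E" and "t \<equiv> carrier T" and "v \<equiv> alg_carrier u"
  defines "eps \<equiv> smile I t v \<bullet> [cid X (hom I t), alg_action u]"
  shows "graded_morphism j T [hom j v] (free_alg T) u eps"
    and "eps \<in> globular [hom I t, hom j v] (hom I v)"
    and "hcart I v \<bullet> [eps] = hcart I t \<otimes> (hcart t v \<bullet> [alg_action u])"
proof -
  note fu = algebra_frame[OF u T]
  note M = rm_frame[OF T, folded t_def] note F = alg_frameD[OF fu, folded v_def t_def]
  have I: "I \<in> Tight X" "tcod X I = E" "tdom X I = E" by (simp_all add: I_def)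
  have p: "parallel I t" "parallel j I" "parallel I v" "parallel t v" "parallel j v"
    using M F I j by (auto simp: parallel_def)
  have ci: "cid X (hom I t) \<in> cells [hom I t] (hom I t) I (tid X A)"
    using cid_in[of "hom I t"] p I M by (simp add: I_def)
  note au = hom_transfD(6)[OF F(3)]
  note S = smile_comp[OF p(1,4) ci au, folded eps_def]
  show eps: "eps \<in> globular [hom I t, hom j v] (hom I v)"
    using S(1) p I by (simp add: globular_hom I_def)
  show e: "hcart I v \<bullet> [eps] = hcart I t \<otimes> (hcart t v \<bullet> [alg_action u])"
    using S(2) hcart_cid[OF p(1)] by simp
  define J where "J = tid X (tdom X v)"
  have eps': "eps \<in> cells [hom I t, hom j v] (hom I v) I J"
    using eps p I by (simp add: globular_hom I_def J_def)
  have J: "J \<in> Tight X" "tcod X J = tdom X v" "v \<cdot> J = v" "tdom X J = tdom X v" using F by (simp_all add: J_def)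
  note af = action_cell[OF T free_frame(1)[OF T], folded I_def t_def, unfolded free_frame(2), folded t_def]
  note ac = action_cell[OF T fu, folded I_def t_def v_def]
  have af1: "action_cell j T (free_alg T) \<in> cells [hom I t, hom j I, hom I t] (hom I t) I (tid X A)"
    using af(1) p I M by (simp add: globular_hom I_def)
  have ac1: "action_cell j T u \<in> cells [hom I t, hom j I, hom I v] (hom I v) I J"
    using ac(1) p I M by (simp add: globular_hom I_def J_def)
  have cv: "cid X (hom j v) \<in> cells [hom j v] (hom j v) (tid X A) J"
    using cid_in[of "hom j v"] p by (simp add: J_def)
  have cj: "cid X (hom j I) \<in> cells [hom j I] (hom j I) (tid X A) I"
    using cid_in[of "hom j I"] p I by (simp add: I_def)
  have hIt: "hcart I t \<in> el [hom I t] I t" and hjI: "hcart j I \<in> el [hom j I] j I"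
    and hIv: "hcart I v \<in> el [hom I v] I v" and hjv: "hcart j v \<in> el [hom j v] j v"
    using hcart(2)[OF p(1)] hcart(2)[OF p(2)] hcart(2)[OF p(3)] hcart(2)[OF p(5)] I by simp_all
  have hac: "hcart t v \<bullet> [alg_action u] \<in> el [hom j v] t v"
    using hcart_comp_in[OF p(4) au] F M by simp
  have hact: "hcart t v \<bullet> [alg_action u] = act T u J (hcart j v)"
    using ap_hcart[OF F(3)] by (simp add: act_def J_def t_def v_def)
  note cc = cellsD[OF af1] cellsD[OF ac1] cellsD[OF cv] cellsD[OF cj] cellsD[OF ci] cellsD[OF eps']
  have afc: "hcart I t \<bullet> [action_cell j T (free_alg T)] = hcart I t \<otimes> ext T (hcart j I \<otimes> hcart I t)"
    using af(2) act_free[of T] M by simp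
  have jIt: "hcart j I \<otimes> hcart I t \<in> el [hom j I, hom I t] j t" using mul_in[OF hjI hIt] I by simp
  have jIv: "hcart j I \<otimes> hcart I v \<in> el [hom j I, hom I v] j (v \<cdot> J)" using mul_in[OF hjI hIv] I J by simp
  have eI: "ext T (hcart j I \<otimes> hcart I t) \<in> el [hom j I, hom I t] t t" using ext_in[OF T jIt[unfolded t_def]] by (simp add: t_def)
  have cf: "cell_path X I [action_cell j T (free_alg T), cid X (hom j v)] J"
    "map (ccod X) [action_cell j T (free_alg T), cid X (hom j v)] = [hom I t, hom j v]"
    using cc by auto
  have ce: "cell_path X I [cid X (hom I t), cid X (hom j I), eps] J"
    "map (ccod X) [cid X (hom I t), cid X (hom j I), eps] = [hom I t, hom j I, hom I v]"
    using cc by auto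
  \<comment> \<open>\<open>L\<close> and \<open>R\<close> are the two sides of the condition on
    graded morphisms. Each is computed as an element by pasting the definition of
    \<open>eps\<close>.\<close>
  define L where "L = eps \<bullet> [action_cell j T (free_alg T), cid X (hom j v)]"
  define R where "R = action_cell j T u \<bullet> [cid X (hom I t), cid X (hom j I), eps]"
  have L: "L = paste X eps I [action_cell j T (free_alg T), cid X (hom j v)]"
    and R: "R = paste X (action_cell j T u) I [cid X (hom I t), cid X (hom j I), eps]"
    using cc by (simp_all add: L_def R_def comp2_def)
  have II: "tcod X I = tdom X I" using I by simp
  have L_in: "L \<in> cells [hom I t, hom j I, hom I t, hom j v] (hom I v) (I \<cdot> I) (J \<cdot> J)"
    using paste_in[OF eps' cf II] cc by (simp add: L)
  have R_in: "R \<in> cells [hom I t, hom j I, hom I t, hom j v] (hom I v) (I \<cdot> I) (J \<cdot> J)"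
    using paste_in[OF ac1 ce II] cc by (simp add: R)
  have "hcart I v \<bullet> [L] = paste X (hcart I v \<bullet> [eps]) I ([action_cell j T (free_alg T)] @ [cid X (hom j v)])"
    using comp1_paste[OF hIv eps' cf II] by (simp add: L)
  also have "\<dots> = paste X (hcart I t) I [action_cell j T (free_alg T)] \<otimes> paste X (hcart t v \<bullet> [alg_action u]) (tid X A) [cid X (hom j v)]"
    unfolding e by (rule mul_paste[OF hIt hac]) (use cc M I in auto)
  also have "paste X (hcart I t) I [action_cell j T (free_alg T)] = hcart I t \<otimes> ext T (hcart j I \<otimes> hcart I t)"
    using afc cc by (simp add: comp2_def)
  also have "paste X (hcart t v \<bullet> [alg_action u]) (tid X A) [cid X (hom j v)] = hcart t v \<bullet> [alg_action u]"
    using paste_cid[OF hac] M by simp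
  finally have l: "hcart I v \<bullet> [L] = (hcart I t \<otimes> ext T (hcart j I \<otimes> hcart I t)) \<otimes> (hcart t v \<bullet> [alg_action u])" .
  have actin: "act T u J (hcart j I \<otimes> hcart I v) \<in> el [hom j I, hom I v] t v"
    using act_in[OF fu, of J] J jIv by (simp add: v_def t_def)
  have "hcart I v \<bullet> [R] = paste X (hcart I v \<bullet> [action_cell j T u]) I ([cid X (hom I t)] @ [cid X (hom j I), eps])"
    using comp1_paste[OF hIv ac1 ce II] by (simp add: R)
  also have "\<dots> = paste X (hcart I t) I [cid X (hom I t)] \<otimes> paste X (act T u J (hcart j I \<otimes> hcart I v)) (tid X A) [cid X (hom j I), eps]"
    unfolding ac(2) J_def[symmetric] by (rule mul_paste[OF hIt actin]) (use cc M I in auto)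
  also have "paste X (hcart I t) I [cid X (hom I t)] = hcart I t"
    using paste_cid[OF hIt] I by (simp add: I_def)
  also have "paste X (act T u J (hcart j I \<otimes> hcart I v)) (tid X A) [cid X (hom j I), eps] =
     act T u (J \<cdot> J) (paste X (hcart j I \<otimes> hcart I v) (tid X A) [cid X (hom j I), eps])"
    using ap_paste[OF F(3) J(1,2) jIv, of "[cid X (hom j I), eps]" J] cc by (simp add: act_def v_def t_def)
  also have "paste X (hcart j I \<otimes> hcart I v) (tid X A) [cid X (hom j I), eps] = paste X (hcart j I \<otimes> hcart I v) (tid X A) ([cid X (hom j I)] @ [eps])"
    by simp
  also have "\<dots> = paste X (hcart j I) (tid X A) [cid X (hom j I)] \<otimes> paste X (hcart I v) I [eps]"
    by (rule mul_paste[OF hjI hIv]) (use cc M I in auto)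
  also have "\<dots> = hcart j I \<otimes> (hcart I t \<otimes> (hcart t v \<bullet> [alg_action u]))"
    using paste_cid[OF hjI] e cc by (simp add: comp2_def)
  also have "J \<cdot> J = J" using J by (simp add: J_def)
  finally have r: "hcart I v \<bullet> [R] = hcart I t \<otimes> act T u J (hcart j I \<otimes> (hcart I t \<otimes> (hcart t v \<bullet> [alg_action u])))" .
  \<comment> \<open>After reassociation the two elements differ by one use of
    \<open>ext_act\<close>: the first argument is the generic element of E(j,1), E(1,t), and the
    generic action is itself a value of \<open>act\<close>.\<close>
  have "ext T (hcart j I \<otimes> hcart I t) \<otimes> act T u J (hcart j v) = act T u J ((hcart j I \<otimes> hcart I t) \<otimes> act T u J (hcart j v))"
    using ext_act[OF T u, of J "hcart j I \<otimes> hcart I t" _ "hcart j v"] J jIt hjv by (simp add: v_def t_def)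
  moreover have "(hcart I t \<otimes> ext T (hcart j I \<otimes> hcart I t)) \<otimes> (hcart t v \<bullet> [alg_action u]) =
      hcart I t \<otimes> (ext T (hcart j I \<otimes> hcart I t) \<otimes> (hcart t v \<bullet> [alg_action u]))"
    using mul_assoc[OF hIt eI hac] M by simp
  moreover have "(hcart j I \<otimes> hcart I t) \<otimes> (hcart t v \<bullet> [alg_action u]) = hcart j I \<otimes> (hcart I t \<otimes> (hcart t v \<bullet> [alg_action u]))"
    using mul_assoc[OF hjI hIt hac] I by simp
  ultimately have "hcart I v \<bullet> [L] = hcart I v \<bullet> [R]" using l r hact by simp
  then have "L = R" by (rule hcart_cancel[OF p(3) L_in R_in])
  then show "graded_morphism j T [hom j v] (free_alg T) u eps"
    using eps free_frame(2)[of T] by (simp add: graded_morphism_def Let_def L_def R_def I_def t_def v_def)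
qed

text \<open>In the graded morphism used below the target is \<open>u\<close> itself. Its mediating
  tight-cell being an identity, the induced 2-cell ends in B(1,1), where B is the source of
  \<open>u\<close>.\<close>

lemma mediating_self:
  assumes T: "relative_monad j T" and u: "algebra_object j T u"
  shows "mediating j T u u = tid X (tdom X (alg_carrier u))"
proof -
  have a: "algebra j T u" using u by (simp add: algebra_object_def)
  note fu = algebra_frame[OF a T]
  have "mediates j T u u (tid X (tdom X (alg_carrier u)))"
    by (rule mediatesI[OF fu fu]) (use alg_frameD[OF fu] in auto)
  then show ?thesis by (rule mediating_eq[OF u a])
qed

(* The identity obtained from the universal property lives over E(1,v) on the left.  Pasting with
   the factorisations k and z of identities through E(1,v) and B(1,f) removes that factor. *)
lemma action_transpose_universal:
  assumes T: "relative_monad j T" and u: "algebra_object j T u"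
  defines "v \<equiv> alg_carrier u" and "f \<equiv> mediating j T u (free_alg T)"
  shows "\<exists>s \<in> cells [hom j v] (lid (tdom X v)) f (tid X (tdom X v)).
    hcart (carrier T) v \<bullet> [alg_action u] = lid_map v \<bullet> [s]"
proof -
  have a: "algebra j T u" using u by (simp add: algebra_object_def)
  note fa = free_algebra[OF T]
  note fu = algebra_frame[OF a T]
  define t I J where "t = carrier T" and "I = tid X E" and "J = tid X (tdom X v)"
  note M = rm_frame[OF T, folded t_def] note F = alg_frameD[OF fu, folded v_def t_def]
  note Gr = action_graded_morphism[OF T a, folded I_def t_def v_def]
  define eps where "eps = smile I t v \<bullet> [cid X (hom I t), alg_action u]"
  note Gr = Gr[folded eps_def]
  have f: "f \<in> Tight X" "tdom X f = A" "tcod X f = tdom X v" "v \<cdot> f = t"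
    using mediating[OF u fa] M free_frame(2)[of T] by (auto simp: mediates_def f_def v_def t_def)
  have I: "I \<in> Tight X" "tcod X I = E" "tdom X I = E" by (simp_all add: I_def)
  have J: "J \<in> Tight X" "tcod X J = tdom X v" "v \<cdot> J = v" "tdom X J = tdom X v" using F by (simp_all add: J_def)
  have p: "parallel I t" "parallel I v" "parallel t v" "parallel j v" "parallel J f" "parallel J J"
    using M F I J f j by (auto simp: parallel_def)
  have ch: "chain X (tdom X (alg_carrier (free_alg T))) [hom j v] (tdom X (alg_carrier u))"
    using p M F free_frame(2)[of T] by (simp add: v_def t_def)
  note univ = u[unfolded algebra_object_def, THEN conjunct2, THEN conjunct2, rule_format]
  \<comment> \<open>Condition (2) for the action seen as a graded morphism out of the free algebra.
    The source mediates through \<open>f\<close> and the target through the identity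
    \<open>J\<close>.\<close>
  have "\<exists>!\<nu>. \<nu> \<in> globular (hom J f # [hom j v]) (hom J J) \<and>
      eps \<bullet> (hom_split v f # map (cid X) [hom j v]) = hom_split v J \<bullet> [cid X (hom I v), \<nu>]"
    using univ[of "free_alg T" u "[hom j v]" eps, OF conjI[OF fa conjI[OF a conjI[OF ch Gr(1)]]]]
    unfolding Let_def mediating_self[OF T u] f_def[symmetric] v_def[symmetric] F(2)
        J_def[symmetric] I_def[symmetric] .
  then obtain \<nu> where "\<nu> \<in> globular (hom J f # [hom j v]) (hom J J) \<and>
      eps \<bullet> (hom_split v f # map (cid X) [hom j v]) = hom_split v J \<bullet> [cid X (hom I v), \<nu>]"
    by (rule ex1E)
  then have nu: "\<nu> \<in> globular [hom J f, hom j v] (hom J J)"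
    and eq: "eps \<bullet> [hom_split v f, cid X (hom j v)] = hom_split v J \<bullet> [cid X (hom I v), \<nu>]"
    by simp_all
  have nu': "\<nu> \<in> cells [hom J f, hom j v] (hom J J) J J" using nu p J by (simp add: globular_hom J_def)
  note Sf = hom_split[OF F(1) f(1,3), folded J_def, unfolded F(2), folded I_def, unfolded f(4)]
  note SJ = hom_split[OF F(1) J(1,2), folded J_def, unfolded F(2), folded I_def, unfolded J(3)]
  have Sf1: "hom_split v f \<in> cells [hom I v, hom J f] (hom I t) I (tid X A)"
    using Sf(1) p I M by (simp add: globular_hom I_def)
  have SJ1: "hom_split v J \<in> cells [hom I v, hom J J] (hom I v) I J"
    using SJ(1) p I by (simp add: globular_hom I_def J_def)
  have eps': "eps \<in> cells [hom I t, hom j v] (hom I v) I J"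
    using Gr(2) p I by (simp add: globular_hom I_def J_def)
  have cv: "cid X (hom j v) \<in> cells [hom j v] (hom j v) (tid X A) J"
    using cid_in[of "hom j v"] p by (simp add: J_def)
  have cI: "cid X (hom I v) \<in> cells [hom I v] (hom I v) I J"
    using cid_in[of "hom I v"] p I by (simp add: I_def J_def)
  have hIt: "hcart I t \<in> el [hom I t] I t" and hIv: "hcart I v \<in> el [hom I v] I v"
    using hcart(2)[OF p(1)] hcart(2)[OF p(2)] I by simp_all
  have hJf: "hcart J f \<in> cells [hom J f] (lid (tdom X v)) J f" using hcart(2)[OF p(5)] J by simp
  have hJJ: "hcart J J \<in> cells [hom J J] (lid (tdom X v)) J J" using hcart(2)[OF p(6)] J by simp
  have JJ: "J \<cdot> J = J" using J by (simp add: J_def)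
  \<comment> \<open>The chosen restriction B(1,1) need not be the loose-identity of B; composing
    with its cartesian 2-cell replaces \<nu> by a 2-cell into the loose-identity.\<close>
  define s1 where "s1 = hcart J J \<bullet> [\<nu>]"
  have s1: "s1 \<in> cells [hom J f, hom j v] (lid (tdom X v)) J J"
    using comp1_in[OF hJJ nu'] JJ by (simp add: s1_def)
  define h where "h = hcart t v \<bullet> [alg_action u]"
  have h: "h \<in> el [hom j v] t v"
    using hcart_comp_in[OF p(3) hom_transfD(6)[OF F(3)]] F M by (simp add: h_def)
  have Wf: "lid_map v \<bullet> [hcart J f] \<in> el [hom J f] v t" 
    using lid_map_in[OF F(1) hJf] J F f by simp
  have WJ: "lid_map v \<bullet> [hcart J J] \<in> el [hom J J] v v"
    using lid_map_in[OF F(1) hJJ] J F by simp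
  have Ws: "lid_map v \<bullet> [s1] \<in> el [hom J f, hom j v] v v"
    using lid_map_in[OF F(1) s1] J F by simp
  note cc = cellsD[OF Sf1] cellsD[OF SJ1] cellsD[OF eps'] cellsD[OF cv] cellsD[OF cI] cellsD[OF nu']
  have II: "tcod X I = tdom X I" using I by simp
  have cp1: "cell_path X I [hom_split v f, cid X (hom j v)] J" "map (ccod X) [hom_split v f, cid X (hom j v)] = [hom I t, hom j v]"
    and cp2: "cell_path X I [cid X (hom I v), \<nu>] J" "map (ccod X) [cid X (hom I v), \<nu>] = [hom I v, hom J J]"
    using cc by auto
  have "hcart I v \<bullet> [paste X eps I [hom_split v f, cid X (hom j v)]] = paste X (hcart I v \<bullet> [eps]) I ([hom_split v f] @ [cid X (hom j v)])"
    using comp1_paste[OF hIv eps' cp1 II] by simp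
  also have "\<dots> = paste X (hcart I t) I [hom_split v f] \<otimes> paste X h (tid X A) [cid X (hom j v)]"
    unfolding Gr(3) h_def[symmetric] by (rule mul_paste[OF hIt h]) (use cc M I in auto)
  also have "\<dots> = (hcart I v \<otimes> (lid_map v \<bullet> [hcart J f])) \<otimes> h"
    using Sf(2) paste_cid[OF h] M cc by (simp add: comp2_def)
  finally have 1: "hcart I v \<bullet> [paste X eps I [hom_split v f, cid X (hom j v)]] = (hcart I v \<otimes> (lid_map v \<bullet> [hcart J f])) \<otimes> h" .
  have "hcart I v \<bullet> [paste X (hom_split v J) I [cid X (hom I v), \<nu>]] = paste X (hcart I v \<bullet> [hom_split v J]) I ([cid X (hom I v)] @ [\<nu>])"
    using comp1_paste[OF hIv SJ1 cp2 II] by simp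
  also have "\<dots> = paste X (hcart I v) I [cid X (hom I v)] \<otimes> paste X (lid_map v \<bullet> [hcart J J]) J [\<nu>]"
    unfolding SJ(2) by (rule mul_paste[OF hIv WJ]) (use cc F I in auto)
  also have "paste X (hcart I v) I [cid X (hom I v)] = hcart I v"
    using paste_cid[OF hIv] I by (simp add: I_def)
  also have "paste X (lid_map v \<bullet> [hcart J J]) J [\<nu>] = lid_map v \<bullet> [s1]"
    using comp1_assoc[OF lid_map(1)[OF F(1)] hJJ nu'] cc by (simp add: comp2_def s1_def)
  finally have 2: "hcart I v \<bullet> [paste X (hom_split v J) I [cid X (hom I v), \<nu>]] = hcart I v \<otimes> (lid_map v \<bullet> [s1])" .
  \<comment> \<open>The universal equation in elements. \<open>h\<close> is the generic action, and
    on the right everything after the factor over E(1,v) is an image under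
    \<open>lid_map v\<close>.\<close>
  have star: "(hcart I v \<otimes> (lid_map v \<bullet> [hcart J f])) \<otimes> h = hcart I v \<otimes> (lid_map v \<bullet> [s1])"
    using 1 2 eq cc by (simp add: comp2_def)
  define k z where "k = fac I v t f (one t)" and "z = fac J f f (tid X A) (one f)"
  have tA: "tid X A \<in> Tight X" "tcod X (tid X A) = tdom X f" using f by simp_all
  have ot: "one t \<in> cells [] (lid (tcod X I)) (I \<cdot> t) (v \<cdot> f)" using one_in[OF M(1)] M I f by (simp add: I_def)
  have of': "one f \<in> cells [] (lid (tcod X J)) (J \<cdot> f) (f \<cdot> tid X A)" using one_in[OF f(1)] f J by (simp add: J_def)
  have tI: "tcod X t = tdom X I" and fJ: "tcod X f = tdom X J" using M I f J by simp_all
  note k = fac[OF p(2) M(1) tI f(1,3) ot, folded k_def]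
  note z = fac[OF p(5) f(1) fJ tA of', folded z_def]
  note ck = cellsD[OF k(1)] cellsD[OF z(1)]
  have hW: "hcart I v \<otimes> (lid_map v \<bullet> [hcart J f]) \<in> el [hom I v, hom J f] I t"
    using mul_in[OF hIv Wf] F by simp
  have "paste X ((hcart I v \<otimes> (lid_map v \<bullet> [hcart J f])) \<otimes> h) t (([k] @ [z]) @ [cid X (hom j v)]) =
     paste X (hcart I v \<otimes> (lid_map v \<bullet> [hcart J f])) t ([k] @ [z]) \<otimes> paste X h (tid X A) [cid X (hom j v)]"
    by (rule mul_paste[OF hW h]) (use cc ck M I in auto)
  also have "paste X (hcart I v \<otimes> (lid_map v \<bullet> [hcart J f])) t ([k] @ [z]) =
     paste X (hcart I v) t [k] \<otimes> paste X (lid_map v \<bullet> [hcart J f]) f [z]"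
    by (rule mul_paste[OF hIv Wf]) (use cc ck M I F in auto)
  also have "paste X (hcart I v) t [k] = one t" using k(2) ck by (simp add: comp2_def)
  also have "paste X (lid_map v \<bullet> [hcart J f]) f [z] = one t"
    using comp1_assoc[OF lid_map(1)[OF F(1)] hJf z(1)] z(2) ck lid_map_one[OF F(1) f(1,3)] f(4) by (simp add: comp2_def)
  also have "one t \<otimes> one t = one t" by (rule mul_one[OF one_in[OF M(1)]])
  also have "paste X h (tid X A) [cid X (hom j v)] = h" using paste_cid[OF h] M by simp
  also have "one t \<otimes> h = h" by (rule one_mul[OF h]) (use M in simp)
  finally have l: "paste X ((hcart I v \<otimes> (lid_map v \<bullet> [hcart J f])) \<otimes> h) t [k, z, cid X (hom j v)] = h" by simp
  have cz: "cell_path X f [z, cid X (hom j v)] J" "map (ccod X) [z, cid X (hom j v)] = [hom J f, hom j v]"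
    using ck cc by auto
  \<comment> \<open>Applying \<open>z\<close> to \<open>s1\<close> consumes B(1,f) and changes the
    left boundary from the identity of B to \<open>f\<close>; E(j,v) remains as domain.\<close>
  define s where "s = paste X s1 f [z, cid X (hom j v)]"
  have s: "s \<in> cells [hom j v] (lid (tdom X v)) f J"
    using paste_in[OF s1 cz] fJ ck cc f J JJ by (simp add: s_def J_def)
  have Wps: "paste X (lid_map v \<bullet> [s1]) f [z, cid X (hom j v)] = lid_map v \<bullet> [s]"
    using comp1_paste[OF lid_map(1)[OF F(1)] s1 cz] fJ by (simp add: s_def)
  have Wsin: "lid_map v \<bullet> [s] \<in> el [hom j v] t v"
    using lid_map_in[OF F(1) s] F f J by simp
  have "paste X (hcart I v \<otimes> (lid_map v \<bullet> [s1])) t ([k] @ [z, cid X (hom j v)]) =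
     paste X (hcart I v) t [k] \<otimes> paste X (lid_map v \<bullet> [s1]) f [z, cid X (hom j v)]"
    by (rule mul_paste[OF hIv Ws]) (use cc ck M I F in auto)
  also have "paste X (hcart I v) t [k] = one t" using k(2) ck by (simp add: comp2_def)
  also have "one t \<otimes> paste X (lid_map v \<bullet> [s1]) f [z, cid X (hom j v)] = lid_map v \<bullet> [s]"
    unfolding Wps by (rule one_mul[OF Wsin]) (use M in simp)
  finally have "h = lid_map v \<bullet> [s]" using l star by simp
  with s show ?thesis by (auto simp: h_def t_def J_def)
qed

text \<open>The universal case pasted with the factorisation of \<open>d\<close>: composition with
  \<open>lid_map\<close> commutes with pasting, so each value of the action comes from a 2-cell over
  the algebra object.\<close>

lemma action_transpose:
  assumes T: "relative_monad j T" and u: "algebra_object j T u"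
    and b: "b \<in> Tight X" "tcod X b = tdom X (alg_carrier u)" and d: "d \<in> el ps j (alg_carrier u \<cdot> b)"
  obtains s where "s \<in> cells ps (lid (tdom X (alg_carrier u))) (mediating j T u (free_alg T)) b"
    "act T u b d = lid_map (alg_carrier u) \<bullet> [s]"
proof -
  define v t f where "v = alg_carrier u" and "t = carrier T" and "f = mediating j T u (free_alg T)"
  have a: "algebra j T u" using u by (simp add: algebra_object_def)
  note F = alg_frameD[OF algebra_frame[OF a T], folded v_def t_def]
  note b = b[folded v_def] and d = d[folded v_def]
  obtain s where s: "s \<in> cells [hom j v] (lid (tdom X v)) f (tid X (tdom X v))"
    and e: "hcart t v \<bullet> [alg_action u] = lid_map v \<bullet> [s]"
    using action_transpose_universal[OF T u] unfolding v_def t_def f_def by blast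
  have f: "f \<in> Tight X" "tdom X f = A"
    using mediating[OF u free_algebra[OF T]] rm_frame[OF T] free_frame(2)[of T]
    by (auto simp: mediates_def f_def)
  let ?F = "fac j v (tid X A) b d"
  note G = hom_transf_fac[OF F(3) b d] note D = cellsD[OF G(1)]
  have cp: "cell_path X (tid X A) [?F] b" "map (ccod X) [?F] = [hom j v]" "tcod X (tid X A) = tdom X f" using D f by auto
  have "act T u b d = paste X (lid_map v \<bullet> [s]) (tid X A) [?F]"
    using ap_alt[OF F(3) b d] e by (simp add: act_def v_def t_def)
  also have "\<dots> = lid_map v \<bullet> [paste X s (tid X A) [?F]]"
    by (rule comp1_paste[OF lid_map(1)[OF F(1)] s cp])
  finally have 1: "act T u b d = lid_map v \<bullet> [paste X s (tid X A) [?F]]" .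
  have "paste X s (tid X A) [?F] \<in> cells ps (lid (tdom X v)) f b"
    using paste_in[OF s cp] D b f F by simp
  then show thesis using that 1 by (simp add: v_def f_def)
qed

text \<open>Any T-action on the carrier of Alg(T') factors through the T'-action. The element
  \<open>m\<close> is forced: for the pullback along \<tau>, the value at \<open>f\<close> on
  \<open>eta T'\<close> is \<open>mor T T' \<tau>\<close>, because the free algebra sends its unit
  to \<open>one\<close>.\<close>

lemma algebra_on_algebra_object:
  assumes T: "relative_monad j T" and T': "relative_monad j T'" and u: "algebra_object j T' u"
    and r: "algebra j T r" and ru: "alg_carrier r = alg_carrier u"
  defines "m \<equiv> act T r (mediating j T' u (free_alg T')) (eta T')"
  shows "m \<in> el [] (carrier T) (carrier T')"
    and "\<lbrakk>b \<in> Tight X; tcod X b = tdom X (alg_carrier u); d \<in> el ps j (alg_carrier u \<cdot> b)\<rbrakk> \<Longrightarrow>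
      m \<otimes> act T' u b d = act T r b d"
    and "\<exists>\<tau>. monad_morphism j T T' \<tau> \<and> mor T T' \<tau> = m"
proof -
  define v t t' f where "v = alg_carrier u" and "t = carrier T" and "t' = carrier T'" and "f = mediating j T' u (free_alg T')"
  have a: "algebra j T' u" using u by (simp add: algebra_object_def)
  note fa = free_algebra[OF T']
  note fr = algebra_frame[OF r T] and fu = algebra_frame[OF a T']
  note M = rm_frame[OF T, folded t_def] and M' = rm_frame[OF T', folded t'_def]
  note Fr = alg_frameD[OF fr, folded t_def, unfolded ru, folded v_def]
  note medf = mediating[OF u fa]
  have f: "f \<in> Tight X" "tdom X f = A" "tcod X f = tdom X v" "v \<cdot> f = t'"
    using medf M' free_frame(2)[of T'] by (auto simp: mediates_def f_def v_def t'_def)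
  have e': "eta T' \<in> el [] j (v \<cdot> f)" using eta_in[OF T'] f by (simp add: t'_def)
  have m: "m \<in> el [] t t'"
    using act_in[OF fr, of f "eta T'" "[]"] f e' ru by (simp add: m_def f_def v_def t_def)
  then show "m \<in> el [] (carrier T) (carrier T')" by (simp add: t_def t'_def)
  have main: "m \<otimes> act T' u b d = act T r b d"
    if b: "b \<in> Tight X" "tcod X b = tdom X v" and d: "d \<in> el ps j (v \<cdot> b)" for b d ps
  proof -
    obtain s where s: "s \<in> cells ps (lid (tdom X v)) f b" and e: "act T' u b d = lid_map v \<bullet> [s]"
      using action_transpose[OF T' u b[unfolded v_def] d[unfolded v_def]] unfolding v_def f_def by blast
    \<comment> \<open>The T'-action being an image under \<open>lid_map v\<close>,
      \<open>ap_mul\<close> moves it inside the T-action, where \<open>eta T'\<close> cancels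
      it.\<close>
    have "m \<otimes> act T' u b d = act T r b (eta T' \<otimes> (lid_map v \<bullet> [s]))"
      using ap_mul[OF Fr(3) f(1,3) e' s] e by (simp add: m_def act_def f_def v_def t_def ru)
    also have "\<dots> = act T r b d"
      using eta_act[OF T' a, of b d ps] b d e by (simp add: v_def)
    finally show ?thesis .
  qed
  then show "\<lbrakk>b \<in> Tight X; tcod X b = tdom X (alg_carrier u); d \<in> el ps j (alg_carrier u \<cdot> b)\<rbrakk> \<Longrightarrow>
      m \<otimes> act T' u b d = act T r b d" by (simp add: v_def)
  \<comment> \<open>The free T'-algebra is the restriction of \<open>u\<close> along
    \<open>f\<close>, so its extension is the action of \<open>u\<close> at
    \<open>f\<close>.\<close>
  have free: "ext T' d = act T' u f d" if "d \<in> el ps j t'" for d ps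
  proof -
    have "act T' (free_alg T') (tid X A) d = act T' u (f \<cdot> tid X A) d"
      by (rule mediates_act[OF fu medf[folded f_def]])
        (use free_frame(2)[of T'] M' that in \<open>auto simp: t'_def\<close>)
    then show ?thesis using f act_free[of T'] by simp
  qed
  obtain \<tau> where \<tau>: "\<tau> \<in> two_cells t t'" "mor T T' \<tau> = m"
    using mor_surj[OF T T'] m unfolding t_def t'_def by blast
  have "monad_morphism j T T' \<tau>"
  proof (rule monad_morphismI[OF T T' \<tau>(1)[unfolded t_def t'_def]], unfold \<tau>(2))
    show "eta T \<otimes> m = eta T'"
      using eta_act[OF T r, of f "eta T'" "[]"] f e' by (simp add: m_def f_def ru v_def)
    fix ps d assume d: "d \<in> el ps j (carrier T)"
    have dm: "d \<otimes> m \<in> el ps j t'" using mul_in[OF d m[unfolded t_def]] M by (simp add: t_def)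
    \<comment> \<open>Associativity of \<open>r\<close> at \<open>eta T'\<close>, the value of
      \<open>r\<close> there being \<open>m\<close>; the factorisation just proved then converts the
      action of \<open>r\<close> into one of T'.\<close>
    have "ext T d \<otimes> m = act T r f (d \<otimes> m)"
      using ext_act[OF T r _ _ d, of f "eta T'" "[]"] f e' by (simp add: m_def f_def ru v_def)
    also have "\<dots> = m \<otimes> act T' u f (d \<otimes> m)" using main[OF f(1,3), of "d \<otimes> m" ps] dm f(4) by simp
    also have "\<dots> = m \<otimes> ext T' (d \<otimes> m)" using free[OF dm] by simp
    finally show "ext T d \<otimes> m = m \<otimes> ext T' (d \<otimes> m)" .
  qed
  then show "\<exists>\<tau>. monad_morphism j T T' \<tau> \<and> mor T T' \<tau> = m" using \<tau> by blast
qed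

section \<open>The functor to the slice category\<close>

text \<open>The monad morphism is recovered from \<open>x\<close> alone: its element is the T-action
  of \<open>u\<close> at \<open>x \<cdot> f\<close> on \<open>eta T'\<close>.\<close>

lemma mediates_pullback_unique:
  assumes T: "relative_monad j T" and T': "relative_monad j T'" and u: "algebra_object j T u" and u': "algebra_object j T' u'"
    and \<tau>: "monad_morphism j T T' \<tau>" and \<sigma>: "monad_morphism j T T' \<sigma>"
    and x: "mediates j T u (pullback_alg T T' \<tau> u') x" "mediates j T u (pullback_alg T T' \<sigma> u') x"
  shows "\<tau> = \<sigma>"
proof -
  define f where "f = mediating j T' u' (free_alg T')"
  have a: "algebra j T u" "algebra j T' u'" using u u' by (simp_all add: algebra_object_def)
  note fu = algebra_frame[OF a(1) T] and fu' = algebra_frame[OF a(2) T']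
  note M = rm_frame[OF T] rm_frame[OF T']
  note medf = mediating[OF u' free_algebra[OF T'], folded f_def]
  have f: "f \<in> Tight X" "tdom X f = A" "tcod X f = tdom X (alg_carrier u')" "alg_carrier u' \<cdot> f = carrier T'"
    using medf M free_frame(2)[of T'] by (auto simp: mediates_def)
  have e: "eta T' \<in> el [] j (alg_carrier u' \<cdot> f)" using eta_in[OF T'] f by simp
  \<comment> \<open>The T'-action at \<open>f\<close> on the unit is the extension of the unit,
    hence \<open>one (carrier T')\<close>.\<close>
  have "act T' (free_alg T') (tid X A) (eta T') = act T' u' (f \<cdot> tid X A) (eta T')"
    by (rule mediates_act[OF fu' medf]) (use free_frame(2)[of T'] M eta_in[OF T'] in auto)
  then have 1: "act T' u' f (eta T') = one (carrier T')" using f act_free[of T'] ext_eta[OF T'] by simp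
  have *: "mor T T' \<rho> = act T u (x \<cdot> f) (eta T')"
    if r: "monad_morphism j T T' \<rho>" "mediates j T u (pullback_alg T T' \<rho> u') x" for \<rho>
  proof -
    note t = monad_morphismD(1)[OF T T' r(1)]
    note P = pullback_alg_act[OF T T' t fu']
    have "act T (pullback_alg T T' \<rho> u') f (eta T') = act T u (x \<cdot> f) (eta T')"
      using mediates_act[OF fu r(2), of f "eta T'" "[]"] f e by simp
    then show ?thesis using P(2)[OF f(1,3) e] 1 mul_one[OF mor_in[OF T T' t]] by simp
  qed
  from *[OF \<tau> x(1)] *[OF \<sigma> x(2)] show ?thesis
    using mor_inj[OF T T' monad_morphismD(1)[OF T T' \<tau>] monad_morphismD(1)[OF T T' \<sigma>]] by simp
qed

text \<open>A tight-cell over E turns the T-action of \<open>u\<close> into a T-action on the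
  carrier of \<open>u'\<close>, which \<open>algebra_on_algebra_object\<close> identifies with a
  pullback.\<close>

lemma mediates_pullback_exists:
  assumes T: "relative_monad j T" and T': "relative_monad j T'" and u: "algebra_object j T u" and u': "algebra_object j T' u'"
    and x: "x \<in> Tight X" "tdom X x = tdom X (alg_carrier u')" "tcod X x = tdom X (alg_carrier u)" "alg_carrier u \<cdot> x = alg_carrier u'"
  shows "\<exists>\<tau>. monad_morphism j T T' \<tau> \<and> mediates j T u (pullback_alg T T' \<tau> u') x"
proof -
  have a: "algebra j T u" "algebra j T' u'" using u u' by (simp_all add: algebra_object_def)
  note fu = algebra_frame[OF a(1) T] and fu' = algebra_frame[OF a(2) T']
  define r where "r = restr_alg T u x"
  note R = restr_algebra[OF T a(1) x(1,3), folded r_def]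
  have ru: "alg_carrier r = alg_carrier u'" using x by (simp add: r_def restr_alg_def)
  obtain \<tau> where \<tau>: "monad_morphism j T T' \<tau>" "mor T T' \<tau> = act T r (mediating j T' u' (free_alg T')) (eta T')"
    using algebra_on_algebra_object(3)[OF T T' u' R(1) ru] by blast
  note P = pullback_alg_act[OF T T' monad_morphismD(1)[OF T T' \<tau>(1)] fu']
  note i = tid_dom[OF alg_frameD(1)[OF fu']]
  have "mediates j T u (pullback_alg T T' \<tau> u') x"
  proof (rule mediatesI[OF fu P(1) x(1), unfolded pullback_alg_carrier, OF x(2-4)])
    fix ps d assume d: "d \<in> el ps j (alg_carrier u')"
    have d': "d \<in> el ps j (alg_carrier u' \<cdot> tid X (tdom X (alg_carrier u')))" using d i by simp
    have "act T u x d = act T r (tid X (tdom X (alg_carrier u'))) d"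
      using mediates_act[OF fu R(2), of "tid X (tdom X (alg_carrier u'))" d ps] d' i x ru by simp
    also have "\<dots> = act T (pullback_alg T T' \<tau> u') (tid X (tdom X (alg_carrier u'))) d"
      using algebra_on_algebra_object(2)[OF T T' u' R(1) ru i(1,2) d'] P(2)[OF i(1,2) d'] \<tau>(2) by simp
    finally show "act T u x d = act T (pullback_alg T T' \<tau> u') (tid X (tdom X (alg_carrier u'))) d" .
  qed
  with \<tau> show ?thesis by blast
qed

section \<open>The functor for a fixed choice of algebra objects\<close>

context
  fixes alg :: "('t, 'c) rmnd_data \<Rightarrow> ('t, 'c) alg_data"
  assumes alg: "\<And>T. T \<in> admitting j \<Longrightarrow> algebra_object j T (alg T)"
begin

lemma admittingD:
  assumes "T \<in> admitting j"
  shows "relative_monad j T" "algebra_object j T (alg T)" "algebra j T (alg T)" "alg_frame T (alg T)"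
proof -
  show *: "relative_monad j T" using assms by (simp add: admitting_def)
  show "algebra_object j T (alg T)" using alg[OF assms] .
  then show "algebra j T (alg T)" by (simp add: algebra_object_def)
  then show "alg_frame T (alg T)" using algebra_frame * by blast
qed

text \<open>By uniqueness of mediating tight-cells, a value of \<open>u_mor\<close> is computed by
  exhibiting any tight-cell that mediates; functoriality is proved in this way.\<close>

lemma u_mor_mediates:
  assumes T: "T \<in> admitting j" and T': "T' \<in> admitting j" and \<tau>: "monad_morphism j T T' \<tau>"
  shows "mediates j T (alg T) (pullback_alg T T' \<tau> (alg T')) (u_mor j alg T' T \<tau>)"
    and "mediates j T (alg T) (pullback_alg T T' \<tau> (alg T')) x \<Longrightarrow> u_mor j alg T' T \<tau> = x"
proof -
  note P = pullback_algebra[OF admittingD(1)[OF T] admittingD(1)[OF T'] \<tau> admittingD(3)[OF T']]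
  have e: "u_mor j alg T' T \<tau> = mediating j T (alg T) (pullback_alg T T' \<tau> (alg T'))"
    by (simp add: u_mor_def u_ob_def pullback_alg_def)
  show "mediates j T (alg T) (pullback_alg T T' \<tau> (alg T')) (u_mor j alg T' T \<tau>)"
    using mediating[OF admittingD(2)[OF T] P] e by simp
  show "mediates j T (alg T) (pullback_alg T T' \<tau> (alg T')) x \<Longrightarrow> u_mor j alg T' T \<tau> = x"
    using mediating_eq[OF admittingD(2)[OF T] P] e by simp
qed

lemma u_mor_slice:
  assumes "T \<in> admitting j" "T' \<in> admitting j" "monad_morphism j T T' \<tau>"
  shows "u_mor j alg T' T \<tau> \<in> cat_hom (slice E) (u_ob alg T') (u_ob alg T)"
  using u_mor_mediates(1)[OF assms] by (auto simp: slice_def mediates_def u_ob_def)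

lemma u_mor_act:
  assumes T: "T \<in> admitting j" and T': "T' \<in> admitting j" and \<tau>: "monad_morphism j T T' \<tau>"
    and b: "b \<in> Tight X" "tcod X b = tdom X (alg_carrier (alg T'))" and d: "d \<in> el ps j (alg_carrier (alg T') \<cdot> b)"
  shows "act T (alg T) (u_mor j alg T' T \<tau> \<cdot> b) d = mor T T' \<tau> \<otimes> act T' (alg T') b d"
  using mediates_act[OF admittingD(4)[OF T] u_mor_mediates(1)[OF T T' \<tau>], of b d ps]
    pullback_alg_act(2)[OF admittingD(1)[OF T] admittingD(1)[OF T'] monad_morphismD(1)[OF admittingD(1)[OF T] admittingD(1)[OF T'] \<tau>]
      admittingD(4)[OF T'] b d] b d
  by simp

lemma u_mor_id:
  assumes T: "T \<in> admitting j"
  shows "u_mor j alg T T (frown (carrier T)) = tid X (tdom X (alg_carrier (alg T)))"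
proof (rule u_mor_mediates(2)[OF T T monad_morphism_id[OF admittingD(1)[OF T]]])
  note A = admittingD[OF T] note fr = mor_frown[OF A(1)]
  note P = pullback_alg_act[OF A(1,1) fr(1) A(4)]
  note F = alg_frameD[OF A(4)] note i = tid_dom[OF F(1)]
  show "mediates j T (alg T) (pullback_alg T T (frown (carrier T)) (alg T)) (tid X (tdom X (alg_carrier (alg T))))"
  proof (rule mediatesI[OF A(4) P(1)], unfold pullback_alg_carrier)
    fix ps d assume d: "d \<in> el ps j (alg_carrier (alg T))"
    then have d': "d \<in> el ps j (alg_carrier (alg T) \<cdot> tid X (tdom X (alg_carrier (alg T))))" using i by simp
    show "act T (alg T) (tid X (tdom X (alg_carrier (alg T)))) d =
      act T (pullback_alg T T (frown (carrier T)) (alg T)) (tid X (tdom X (alg_carrier (alg T)))) d"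
      using P(2)[OF i(1,2) d'] fr(2) one_mul[OF act_tid_in[OF A(4) d]] rm_frame[OF A(1)] by simp
  qed (use F in auto)
qed

text \<open>The composite tight-cell acts by two successive left multiplications, which \<otimes>
  merges into one by the element of the composite monad morphism. It therefore mediates the pullback
  along that morphism.\<close>

lemma u_mor_vcomp:
  assumes T: "T \<in> admitting j" and T': "T' \<in> admitting j" and T'': "T'' \<in> admitting j"
    and \<tau>: "monad_morphism j T T' \<tau>" and \<sigma>: "monad_morphism j T' T'' \<sigma>"
  shows "u_mor j alg T'' T (vcomp (carrier T) (carrier T') (carrier T'') \<sigma> \<tau>) =
    u_mor j alg T' T \<tau> \<cdot> u_mor j alg T'' T' \<sigma>"
proof -
  note A = admittingD[OF T] and A' = admittingD[OF T'] and A'' = admittingD[OF T'']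
  define x y where "x = u_mor j alg T' T \<tau>" and "y = u_mor j alg T'' T' \<sigma>"
  define v v' v'' where "v = alg_carrier (alg T)" and "v' = alg_carrier (alg T')" and "v'' = alg_carrier (alg T'')"
  note F = alg_frameD[OF A(4), folded v_def] and F'' = alg_frameD[OF A''(4), folded v''_def]
  have x: "x \<in> Tight X" "tdom X x = tdom X v'" "tcod X x = tdom X v" "v \<cdot> x = v'"
    and y: "y \<in> Tight X" "tdom X y = tdom X v''" "tcod X y = tdom X v'" "v' \<cdot> y = v''"
    using u_mor_mediates(1)[OF T T' \<tau>] u_mor_mediates(1)[OF T' T'' \<sigma>]
    by (auto simp: mediates_def x_def y_def v_def v'_def v''_def)
  note t = monad_morphismD(1)[OF A(1) A'(1) \<tau>] and s = monad_morphismD(1)[OF A'(1) A''(1) \<sigma>]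
  note c = mor_vcomp[OF A(1) A'(1) A''(1) t s]
  note P = pullback_alg_act[OF A(1) A''(1) c(1) A''(4), folded v''_def]
  define i where "i = tid X (tdom X v'')"
  have i: "i \<in> Tight X" "tcod X i = tdom X v''" "v'' \<cdot> i = v''" "y \<cdot> i = y"
    using tid_dom[OF F''(1)] y by (simp_all add: i_def)
  have xy: "x \<cdot> y \<in> Tight X" "tdom X (x \<cdot> y) = tdom X v''" "tcod X (x \<cdot> y) = tdom X v" using x y by simp_all
  have vxy: "v \<cdot> (x \<cdot> y) = v''"
  proof -
    have "(v \<cdot> x) \<cdot> y = v \<cdot> (x \<cdot> y)"
      by (rule tcomp_assoc) (simp_all only: x y F)
    then show ?thesis using x(4) y(4) by simp
  qed
  show ?thesis unfolding x_def[symmetric] y_def[symmetric]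
  proof (rule u_mor_mediates(2)[OF T T'' monad_morphism_vcomp[OF A(1) A'(1) A''(1) \<tau> \<sigma>]],
      rule mediatesI[OF A(4) P(1)], unfold pullback_alg_carrier v_def[symmetric] v''_def[symmetric] i_def[symmetric])
    fix ps d assume d: "d \<in> el ps j v''"
    have dy: "d \<in> el ps j (v' \<cdot> y)" and di: "d \<in> el ps j (v'' \<cdot> i)" using d y i by simp_all
    have "act T (alg T) (x \<cdot> y) d = mor T T' \<tau> \<otimes> act T' (alg T') y d"
      using u_mor_act[OF T T' \<tau>, of y d ps] y dy by (simp add: x_def v'_def)
    also have "act T' (alg T') y d = mor T' T'' \<sigma> \<otimes> act T'' (alg T'') i d"
      using u_mor_act[OF T' T'' \<sigma>, of i d ps] i di by (simp add: y_def v''_def)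
    also have "mor T T' \<tau> \<otimes> (mor T' T'' \<sigma> \<otimes> act T'' (alg T'') i d) = (mor T T' \<tau> \<otimes> mor T' T'' \<sigma>) \<otimes> act T'' (alg T'') i d"
      using mul_assoc[OF mor_in[OF A(1) A'(1) t] mor_in[OF A'(1) A''(1) s] act_tid_in[OF A''(4), folded v''_def i_def, OF d]]
        rm_frame[OF A'(1)] by (simp add: i_def)
    also have "\<dots> = act T (pullback_alg T T'' (vcomp (carrier T) (carrier T') (carrier T'') \<sigma> \<tau>) (alg T'')) i d"
      using P(2)[OF i(1,2) di] c(2) by simp
    finally show "act T (alg T) (x \<cdot> y) d = act T (pullback_alg T T'' (vcomp (carrier T) (carrier T') (carrier T'') \<sigma> \<tau>) (alg T'')) i d" .
  qed (simp_all only: xy vxy)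
qed

lemma u_mor_bij:
  assumes T: "T \<in> admitting j" and T': "T' \<in> admitting j"
  shows "bij_betw (u_mor j alg T' T) {\<tau>. monad_morphism j T T' \<tau>} (cat_hom (slice E) (u_ob alg T') (u_ob alg T))"
  unfolding bij_betw_def
proof
  note A = admittingD[OF T] and A' = admittingD[OF T']
  show "inj_on (u_mor j alg T' T) {\<tau>. monad_morphism j T T' \<tau>}"
  proof (rule inj_onI)
    fix \<tau> \<sigma> assume *: "\<tau> \<in> {\<tau>. monad_morphism j T T' \<tau>}" "\<sigma> \<in> {\<tau>. monad_morphism j T T' \<tau>}"
      "u_mor j alg T' T \<tau> = u_mor j alg T' T \<sigma>"
    then show "\<tau> = \<sigma>"
      using mediates_pullback_unique[OF A(1) A'(1) A(2) A'(2), of \<tau> \<sigma> "u_mor j alg T' T \<sigma>"]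
        u_mor_mediates(1)[OF T T', of \<tau>] u_mor_mediates(1)[OF T T', of \<sigma>] by simp
  qed
  show "u_mor j alg T' T ` {\<tau>. monad_morphism j T T' \<tau>} = cat_hom (slice E) (u_ob alg T') (u_ob alg T)"
  proof
    show "u_mor j alg T' T ` {\<tau>. monad_morphism j T T' \<tau>} \<subseteq> cat_hom (slice E) (u_ob alg T') (u_ob alg T)"
      using u_mor_slice[OF T T'] by auto
    show "cat_hom (slice E) (u_ob alg T') (u_ob alg T) \<subseteq> u_mor j alg T' T ` {\<tau>. monad_morphism j T T' \<tau>}"
    proof
      fix x assume "x \<in> cat_hom (slice E) (u_ob alg T') (u_ob alg T)"
      then have "x \<in> Tight X" "tdom X x = tdom X (alg_carrier (alg T'))" "tcod X x = tdom X (alg_carrier (alg T))"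
         "alg_carrier (alg T) \<cdot> x = alg_carrier (alg T')" by (auto simp: slice_def u_ob_def)
      then obtain \<tau> where \<tau>: "monad_morphism j T T' \<tau>" "mediates j T (alg T) (pullback_alg T T' \<tau> (alg T')) x"
        using mediates_pullback_exists[OF A(1) A'(1) A(2) A'(2)] by blast
      then show "x \<in> u_mor j alg T' T ` {\<tau>. monad_morphism j T T' \<tau>}"
        using u_mor_mediates(2)[OF T T' \<tau>(1,2)] by (intro image_eqI[of _ _ \<tau>]) auto
    qed
  qed
qed

end

end

section \<open>Opposites and full subcategories; fully faithfulness\<close>

lemma opposite_category:
  assumes "category C"
  shows "category (opposite C)"
proof -
  interpret category C by fact
  show ?thesis
    by standard (simp_all add: opposite_def id_hom comp_hom comp_id_left comp_id_right comp_assoc)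
qed

lemma full_subcategory_category:
  assumes "category C"
  shows "category (full_subcategory C S)"
proof -
  interpret category C by fact
  show ?thesis
    by standard (simp_all add: full_subcategory_def id_hom comp_hom comp_id_left comp_id_right comp_assoc)
qed

theorem corollary6p40:
  fixes X :: "('o, 't, 'l, 'c) vdc_data"
    and A E :: 'o and j :: 't
    and alg :: "('t, 'c) rmnd_data \<Rightarrow> ('t, 'c) alg_data"
  assumes "virtual_equipment X"
    and "j \<in> Tight X" and "tdom X j = A" and "tcod X j = E"
    and "\<And>T. T \<in> vdc.admitting X j \<Longrightarrow> vdc.algebra_object X j T (alg T)"
  shows "is_partial_functor (opposite (vdc.RMnd X j)) (vdc.admitting X j) (vdc.slice X E)
           (vdc.u_ob alg) (vdc.u_mor X j alg) \<and>
         fully_faithful (full_subcategory (opposite (vdc.RMnd X j)) (vdc.admitting X j))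
           (vdc.slice X E) (vdc.u_ob alg) (vdc.u_mor X j alg)"
proof -
  interpret virtual_equipment X by fact
  interpret tight_cell_in_equipment X j by unfold_locales fact
  note alg = assms(5)
  let ?C = "full_subcategory (opposite (RMnd j)) (admitting j)"
  have C: "category (opposite (RMnd j))" by (rule opposite_category[OF RMnd_category])
  have ob: "cat_ob ?C = admitting j"
    by (auto simp: full_subcategory_def opposite_def RMnd_def admitting_def)
  have hom: "cat_hom ?C T' T = {\<tau>. monad_morphism j T T' \<tau>}" for T T'
    by (simp add: full_subcategory_def opposite_def RMnd_def)
  have "is_functor ?C (slice (tcod X j)) (u_ob alg) (u_mor j alg)"
    unfolding is_functor_def ob hom
  proof (intro conjI ballI)
    show "category ?C" by (rule full_subcategory_category[OF C])
    show "category (slice (tcod X j))" by (rule slice_category)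
  next
    fix T assume T: "T \<in> admitting j"
    show "u_ob alg T \<in> cat_ob (slice (tcod X j))"
      using alg_frameD[OF admittingD(4)[OF alg T]] by (simp add: u_ob_def slice_def)
    show "u_mor j alg T T (cat_id ?C T) = cat_id (slice (tcod X j)) (u_ob alg T)"
      using u_mor_id[OF alg T]
      by (simp add: full_subcategory_def opposite_def RMnd_def slice_def u_ob_def)
  next
    fix T' T \<tau> assume "T' \<in> admitting j" "T \<in> admitting j" "\<tau> \<in> {\<tau>. monad_morphism j T T' \<tau>}"
    then show "u_mor j alg T' T \<tau> \<in> cat_hom (slice (tcod X j)) (u_ob alg T') (u_ob alg T)"
      using u_mor_slice[OF alg] by simp
  next
    \<comment> \<open>In the opposite category the composite of \<sigma> and \<tau> is
      \<open>vcomp\<close> with \<sigma> after \<tau>, a monad morphism from \<open>T\<close> to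
      \<open>T''\<close>.\<close>
    fix T'' T' T \<sigma> \<tau>
    assume "T'' \<in> admitting j" "T' \<in> admitting j" "T \<in> admitting j"
      "\<sigma> \<in> {\<tau>. monad_morphism j T' T'' \<tau>}" "\<tau> \<in> {\<tau>. monad_morphism j T T' \<tau>}"
    then show "u_mor j alg T'' T (cat_comp ?C T'' T' T \<tau> \<sigma>) =
        cat_comp (slice (tcod X j)) (u_ob alg T'') (u_ob alg T') (u_ob alg T) (u_mor j alg T' T \<tau>) (u_mor j alg T'' T' \<sigma>)"
      using u_mor_vcomp[OF alg, of T T' T'' \<tau> \<sigma>]
      by (simp add: full_subcategory_def opposite_def RMnd_def slice_def)
  qed
  moreover have "admitting j \<subseteq> cat_ob (opposite (RMnd j))"
    by (auto simp: opposite_def RMnd_def admitting_def)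
  moreover have "fully_faithful ?C (slice (tcod X j)) (u_ob alg) (u_mor j alg)"
    unfolding fully_faithful_def ob hom using u_mor_bij[OF alg] by blast
  ultimately show ?thesis using C assms(4) by (simp add: is_partial_functor_def)
qed

end
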